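(* (Convergence of X-ETD($n$)) In the sequential off-policy setting described in the context, assume that: the Markov chain induced by $\mu$ is ergodic; $\pi(a|s)>0$ implies $\mu(a|s)>0$ for all $(s,a)$; and the learning rates $\{\alpha_t^{\mathbf w}\}_{t=0}^\infty$ are nonnegative, deterministic, and satisfy $\sum_t\alpha_t^{\mathbf w}=\infty$ and $\sum_t(\alpha_t^{\mathbf w})^2<\infty$. Then, for the iterates $\{\mathbf w_t\}$ generated by $$\mathbf w_{t+1}=\mathbf w_t+\alpha_t^{\mathbf w}f_\theta(S_t)\sum_{k=t}^{t+n-1}\Big(\prod_{i=t}^{k-1}\gamma_{i+1}\rho_i\Big)\rho_k\big(R_{k+1}+\gamma_{k+1}\mathbf w_t^\top\boldsymbol\phi(S_{k+1})-\mathbf w_t^\top\boldsymbol\phi(S_k)\big)\boldsymbol\phi(S_t),$$ there exists a constant $\eta>0$ such that $$\|\mathbf D_\mu^\epsilon\|<\eta\ \Longrightarrow\ \lim_{t\to\infty}\mathbf w_t=\mathbf A^{-1}\mathbf b\quad\text{almost surely},$$ where $\mathbf A=\boldsymbol\Phi^\top\mathbf D_\mu^\theta(\mathbf I-(\mathbf P_\pi\boldsymbol\Gamma)^n)\boldsymbol\Phi$ and $\mathbf b=\boldsymbol\Phi^\top\mathbf D_\mu^\theta\mathbf r_\pi^n$.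
   Context: **MDP.** $\mathcal S$ and $\mathcal A$ are finite state and action sets, $P(s'|s,a)$ is the transition probability, $r:\mathcal S\times\mathcal A\to\mathbb R$ is the reward function, $\gamma:\mathcal S\to[0,1]$ is a state-dependent discount, and $n\ge 1$ is a fixed integer. $\pi(a|s)$ is the target policy and $\mu(a|s)$ the behavior policy; $d_\mu$ is the ergodic (stationary) distribution of the chain on $\mathcal S$ induced by $\mu$. **Sequential setting.** One infinite trajectory $(S_0,A_0,R_1,S_1,A_1,R_2,\dots)$ with $A_t\sim\mu(\cdot|S_t)$, $R_{t+1}=r(S_t,A_t)$, $S_{t+1}\sim P(\cdot|S_t,A_t)$. Write $\rho_t=\pi(A_t|S_t)/\mu(A_t|S_t)$, $\gamma_t=\gamma(S_t)$. **Followon trace.** $F_0=\dots=F_{n-1}=1$ and $F_t=\big(\prod_{i=t-n}^{t-1}\rho_i\gamma_{i+1}\big)F_{t-n}+1$ for $t\ge n$. It is a standing assumption that the limit $\lim_{t\to\infty}\mathbb E_\mu[F_t\mid S_t=s]$ exists for every $s$. **Trace model and matrices.** $f_\theta:\mathcal S\to\mathbb R$ is a function with a fixed parameter $\theta$, meant to approximate this limit. $\mathbf D_\mu^\theta$ and $\mathbf D_\mu^f$ are the diagonal matrices with diagonal entries $d_\mu(s)f_\theta(s)$ and $d_\mu(s)\lim_{t\to\infty}\mathbb E_\mu[F_t\mid S_t=s]$ respectively, and $\mathbf D_\mu^\epsilon=\mathbf D_\mu^\theta-\mathbf D_\mu^f$. $\mathbf P_\pi(s,s')=\sum_a\pi(a|s)P(s'|s,a)$;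 $\boldsymbol\Gamma$ is diagonal with entries $\gamma(s)$; $\mathbf r_\pi(s)=\sum_a\pi(a|s)r(s,a)$; $\mathbf r_\pi^n=\sum_{i=0}^{n-1}(\mathbf P_\pi\boldsymbol\Gamma)^i\mathbf r_\pi$; $\mathbf I$ is the identity. $\boldsymbol\phi(s)$ is the feature vector of $s$ and $\boldsymbol\Phi$ is the matrix whose $s$-th row is $\boldsymbol\phi(s)^\top$. $\|\cdot\|$ is the matrix norm induced by the Euclidean norm.
   Formalization: The feature matrix Φ is additionally assumed to have full column rank (linearly independent columns); otherwise A is singular (e.g. Φ = 0 gives A = 0) and A⁻¹b is undefined. Invertibility of A is proved as part of the conclusion. *)

theory Defs
  imports "HOL-Probability.Probability"
begin

definition diag_mat :: "('n \<Rightarrow> real) \<Rightarrow> real ^ 'n ^ 'n" where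
  "diag_mat d = (\<chi> i j. if i = j then d i else 0)"

definition mat_pow :: "real ^ 'n ^ 'n \<Rightarrow> nat \<Rightarrow> real ^ 'n ^ 'n" where
  "mat_pow A k = (((**) A) ^^ k) (mat 1)"

definition mat_norm :: "real ^ 'm ^ 'n \<Rightarrow> real" where
  "mat_norm A = onorm ((*v) A)"


(* A policy maps a state to a distribution over actions; P s a is the distribution of the
   next state. *)

definition trans_mat ::
    "('s::finite \<Rightarrow> 'a::finite \<Rightarrow> 's pmf) \<Rightarrow> ('s \<Rightarrow> 'a pmf) \<Rightarrow> real ^ 's ^ 's" where
  "trans_mat P \<pi> = (\<chi> s s'. \<Sum>a\<in>UNIV. pmf (\<pi> s) a * pmf (P s a) s')"

definition reward_vec ::
    "('s::finite \<Rightarrow> 'a::finite \<Rightarrow> real) \<Rightarrow> ('s \<Rightarrow> 'a pmf) \<Rightarrow> real ^ 's" where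
  "reward_vec r \<pi> = (\<chi> s. \<Sum>a\<in>UNIV. pmf (\<pi> s) a * r s a)"

definition nstep_reward_vec ::
    "('s::finite \<Rightarrow> 'a::finite \<Rightarrow> 's pmf) \<Rightarrow> ('s \<Rightarrow> 'a \<Rightarrow> real) \<Rightarrow> ('s \<Rightarrow> real) \<Rightarrow>
     ('s \<Rightarrow> 'a pmf) \<Rightarrow> nat \<Rightarrow> real ^ 's" where
  "nstep_reward_vec P r \<gamma> \<pi> n =
     (\<Sum>i<n. mat_pow (trans_mat P \<pi> ** diag_mat \<gamma>) i *v reward_vec r \<pi>)"

definition irreducible_chain :: "real ^ 's ^ 's \<Rightarrow> bool" where
  "irreducible_chain Q \<longleftrightarrow> (\<forall>s s'. \<exists>k. mat_pow Q k $ s $ s' > 0)"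

definition aperiodic_chain :: "real ^ 's ^ 's \<Rightarrow> bool" where
  "aperiodic_chain Q \<longleftrightarrow> (\<forall>s. Gcd {k::nat. k > 0 \<and> mat_pow Q k $ s $ s > 0} = 1)"

definition ergodic_chain :: "real ^ 's ^ 's \<Rightarrow> bool" where
  "ergodic_chain Q \<longleftrightarrow> irreducible_chain Q \<and> aperiodic_chain Q"

definition stationary_distribution :: "'s::finite pmf \<Rightarrow> real ^ 's ^ 's \<Rightarrow> bool" where
  "stationary_distribution d Q \<longleftrightarrow> (\<chi> s. pmf d s) v* Q = (\<chi> s. pmf d s)"


(* S and A are the state and action processes of one infinite trajectory: given the whole past,
   A t has distribution \<mu> (S t) and S (t + 1) has distribution P (S t) (A t). The conditional
   probabilities are multiplied out so that histories of probability 0 need no separate treatment;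
   the distribution of S 0 is arbitrary. *)

definition mdp_trajectory ::
    "('s::finite \<Rightarrow> 'a::finite \<Rightarrow> 's pmf) \<Rightarrow> ('s \<Rightarrow> 'a pmf) \<Rightarrow> 'w measure \<Rightarrow>
     (nat \<Rightarrow> 'w \<Rightarrow> 's) \<Rightarrow> (nat \<Rightarrow> 'w \<Rightarrow> 'a) \<Rightarrow> bool" where
  "mdp_trajectory P \<mu> M S A \<longleftrightarrow>
     prob_space M \<and>
     (\<forall>t. S t \<in> measurable M (count_space UNIV)) \<and>
     (\<forall>t. A t \<in> measurable M (count_space UNIV)) \<and>
     (\<forall>t s a.
        measure M {\<omega>\<in>space M. (\<forall>i\<le>t. S i \<omega> = s i) \<and> (\<forall>i\<le>t. A i \<omega> = a i)} =
        measure M {\<omega>\<in>space M. (\<forall>i\<le>t. S i \<omega> = s i) \<and> (\<forall>i<t. A i \<omega> = a i)} *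
        pmf (\<mu> (s t)) (a t)) \<and>
     (\<forall>t s a.
        measure M {\<omega>\<in>space M. (\<forall>i\<le>Suc t. S i \<omega> = s i) \<and> (\<forall>i\<le>t. A i \<omega> = a i)} =
        measure M {\<omega>\<in>space M. (\<forall>i\<le>t. S i \<omega> = s i) \<and> (\<forall>i\<le>t. A i \<omega> = a i)} *
        pmf (P (s t) (a t)) (s (Suc t)))"

definition is_ratio ::
    "('s \<Rightarrow> 'a pmf) \<Rightarrow> ('s \<Rightarrow> 'a pmf) \<Rightarrow> (nat \<Rightarrow> 'w \<Rightarrow> 's) \<Rightarrow> (nat \<Rightarrow> 'w \<Rightarrow> 'a) \<Rightarrow>
     nat \<Rightarrow> 'w \<Rightarrow> real" where
  "is_ratio \<pi> \<mu> S A t \<omega> = pmf (\<pi> (S t \<omega>)) (A t \<omega>) / pmf (\<mu> (S t \<omega>)) (A t \<omega>)"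

(* The disjunct n = 0 only serves termination. *)

fun followon_rec :: "nat \<Rightarrow> (nat \<Rightarrow> real) \<Rightarrow> (nat \<Rightarrow> real) \<Rightarrow> nat \<Rightarrow> real" where
  "followon_rec n \<rho> g t =
     (if t < n \<or> n = 0 then 1
      else (\<Prod>i\<in>{t-n..<t}. \<rho> i * g (Suc i)) * followon_rec n \<rho> g (t - n) + 1)"

declare followon_rec.simps [simp del]

definition followon ::
    "nat \<Rightarrow> ('s \<Rightarrow> real) \<Rightarrow> ('s \<Rightarrow> 'a pmf) \<Rightarrow> ('s \<Rightarrow> 'a pmf) \<Rightarrow>
     (nat \<Rightarrow> 'w \<Rightarrow> 's) \<Rightarrow> (nat \<Rightarrow> 'w \<Rightarrow> 'a) \<Rightarrow> nat \<Rightarrow> 'w \<Rightarrow> real" where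
  "followon n \<gamma> \<pi> \<mu> S A t \<omega> =
     followon_rec n (\<lambda>i. is_ratio \<pi> \<mu> S A i \<omega>) (\<lambda>i. \<gamma> (S i \<omega>)) t"

(* Elementary conditional expectation given an event; it is 0 if the event has probability 0. *)

definition cond_expectation :: "'w measure \<Rightarrow> ('w \<Rightarrow> real) \<Rightarrow> 'w set \<Rightarrow> real" where
  "cond_expectation M X B = (LINT \<omega>:B|M. X \<omega>) / measure M B"

definition expected_followon ::
    "nat \<Rightarrow> ('s \<Rightarrow> real) \<Rightarrow> ('s \<Rightarrow> 'a pmf) \<Rightarrow> ('s \<Rightarrow> 'a pmf) \<Rightarrow> 'w measure \<Rightarrow>
     (nat \<Rightarrow> 'w \<Rightarrow> 's) \<Rightarrow> (nat \<Rightarrow> 'w \<Rightarrow> 'a) \<Rightarrow> nat \<Rightarrow> 's \<Rightarrow> real" where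
  "expected_followon n \<gamma> \<pi> \<mu> M S A t s =
     cond_expectation M (followon n \<gamma> \<pi> \<mu> S A t) {\<omega>\<in>space M. S t \<omega> = s}"


definition D_theta :: "'s::finite pmf \<Rightarrow> ('s \<Rightarrow> real) \<Rightarrow> real ^ 's ^ 's" where
  "D_theta d f = diag_mat (\<lambda>s. pmf d s * f s)"

definition D_followon ::
    "'s::finite pmf \<Rightarrow> nat \<Rightarrow> ('s \<Rightarrow> real) \<Rightarrow> ('s \<Rightarrow> 'a pmf) \<Rightarrow> ('s \<Rightarrow> 'a pmf) \<Rightarrow>
     'w measure \<Rightarrow> (nat \<Rightarrow> 'w \<Rightarrow> 's) \<Rightarrow> (nat \<Rightarrow> 'w \<Rightarrow> 'a) \<Rightarrow> real ^ 's ^ 's" where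
  "D_followon d n \<gamma> \<pi> \<mu> M S A =
     diag_mat (\<lambda>s. pmf d s * lim (\<lambda>t. expected_followon n \<gamma> \<pi> \<mu> M S A t s))"

definition feature_mat :: "('s::finite \<Rightarrow> real ^ 'd) \<Rightarrow> real ^ 'd ^ 's" where
  "feature_mat \<phi> = (\<chi> s. \<phi> s)"

definition xetd_A ::
    "('s::finite \<Rightarrow> 'a::finite \<Rightarrow> 's pmf) \<Rightarrow> ('s \<Rightarrow> real) \<Rightarrow> ('s \<Rightarrow> 'a pmf) \<Rightarrow> nat \<Rightarrow>
     ('s \<Rightarrow> real ^ 'd) \<Rightarrow> 's pmf \<Rightarrow> ('s \<Rightarrow> real) \<Rightarrow> real ^ 'd ^ 'd" where
  "xetd_A P \<gamma> \<pi> n \<phi> d f =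
     transpose (feature_mat \<phi>) ** D_theta d f **
     (mat 1 - mat_pow (trans_mat P \<pi> ** diag_mat \<gamma>) n) ** feature_mat \<phi>"

definition xetd_b ::
    "('s::finite \<Rightarrow> 'a::finite \<Rightarrow> 's pmf) \<Rightarrow> ('s \<Rightarrow> 'a \<Rightarrow> real) \<Rightarrow> ('s \<Rightarrow> real) \<Rightarrow>
     ('s \<Rightarrow> 'a pmf) \<Rightarrow> nat \<Rightarrow> ('s \<Rightarrow> real ^ 'd) \<Rightarrow> 's pmf \<Rightarrow> ('s \<Rightarrow> real) \<Rightarrow> real ^ 'd" where
  "xetd_b P r \<gamma> \<pi> n \<phi> d f =
     (transpose (feature_mat \<phi>) ** D_theta d f) *v nstep_reward_vec P r \<gamma> \<pi> n"

(* The reward R (k + 1) is r (S k) (A k). *)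

primrec xetd ::
    "('s \<Rightarrow> 'a \<Rightarrow> real) \<Rightarrow> ('s \<Rightarrow> real) \<Rightarrow> ('s \<Rightarrow> 'a pmf) \<Rightarrow> ('s \<Rightarrow> 'a pmf) \<Rightarrow> nat \<Rightarrow>
     ('s \<Rightarrow> real ^ 'd) \<Rightarrow> (nat \<Rightarrow> 'w \<Rightarrow> 's) \<Rightarrow> (nat \<Rightarrow> 'w \<Rightarrow> 'a) \<Rightarrow> (nat \<Rightarrow> real) \<Rightarrow>
     ('s \<Rightarrow> real) \<Rightarrow> real ^ 'd \<Rightarrow> nat \<Rightarrow> 'w \<Rightarrow> real ^ 'd" where
  "xetd r \<gamma> \<pi> \<mu> n \<phi> S A \<alpha> f w0 0 \<omega> = w0"
| "xetd r \<gamma> \<pi> \<mu> n \<phi> S A \<alpha> f w0 (Suc t) \<omega> =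
     (let w = xetd r \<gamma> \<pi> \<mu> n \<phi> S A \<alpha> f w0 t \<omega>;
          \<rho> = (\<lambda>i. is_ratio \<pi> \<mu> S A i \<omega>)
      in w + (\<alpha> t * f (S t \<omega>) *
           (\<Sum>k\<in>{t..<t+n}. (\<Prod>i\<in>{t..<k}. \<gamma> (S (Suc i) \<omega>) * \<rho> i) * \<rho> k *
              (r (S k \<omega>) (A k \<omega>) + \<gamma> (S (Suc k) \<omega>) * (w \<bullet> \<phi> (S (Suc k) \<omega>))
               - w \<bullet> \<phi> (S k \<omega>)))) *\<^sub>R \<phi> (S t \<omega>))"

end

theory Submission
  imports Defs
begin

text \<open>
  Let \<open>m(s)\<close> be the diagonal entries of \<open>D_followon\<close> and \<open>C\<close> the \<open>n\<close>-th power of the discounted target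
  kernel. Taking limits in the recursion of the followon trace gives \<open>m = d + C\<^sup>T m\<close>, hence
  \<open>x\<^sup>T diag(m) (I - C) x \<ge> 1/2 \<Sum> d(s) x(s)\<^sup>2\<close>. As \<open>d > 0\<close> and the features are independent, the
  matrix \<open>A\<close> stays positive definite under small perturbations of \<open>m\<close>.

  For the convergence let \<open>e\<^sub>t\<close> be the error of the \<open>t\<close>-th iterate. The function
  \<open>V\<^sub>t = |e\<^sub>t|\<^sup>2 + 2 q\<^sub>t(e\<^sub>t, S\<^sub>t)\<close> has expected drift at most
  \<open>- 2 c \<alpha>\<^sub>t |e|\<^sup>2 + \<kappa>\<^sub>t (1 + |e|\<^sup>2)\<close> with summable \<open>\<kappa>\<close>, where
  \<open>q\<^sub>t(e, s) = \<Sum>k. \<alpha>\<^sub>t\<^sub>+\<^sub>k (Q\<^sup>k h\<^sub>e)(s)\<close> sums the expected future noise \<open>h\<^sub>e\<close> along the behavior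
  chain \<open>Q\<close>; geometric mixing makes it small. Consequently the second moments of the errors are
  bounded, they come arbitrarily close to \<open>0\<close> because the step sizes are not summable, and a maximal
  inequality started at such times gives almost sure convergence. All processes are functions of
  finite histories over finite alphabets, so conditional expectations are finite sums.
\<close>

section \<open>Powers of stochastic matrices and geometric mixing\<close>

text \<open>The main obstacle is the delay. The update at time t reads the trajectory up to time t +
  n, so in general the current error is not a function of the history at which its own update
  starts, and conditioning on that history gives no direct drift estimate. The argument looks n
  steps back: \<open>err t\<close> is known at time t + n, and the update direction of time t + n is
  evaluated at this frozen error. Given the history at t + n, that direction has an exact mean,
  computed by importance sampling.

  A second obstacle is that no bound on the iterates is available in advance, while the update is
  affine and the noise quadratic in the error. All estimates are therefore relative to 1 + |e|^2,
  and boundedness of the second moments is itself derived from the drift inequality.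

  The balance equation behind definiteness holds for the limiting weights and in general not for f.
  Definiteness is thus proved with a margin for those weights, and this margin fixes \<eta>
  independently of f.\<close>

lemma mat_pow_0 [simp]: "mat_pow A 0 = mat 1"
  by (simp add: mat_pow_def)

lemma mat_pow_Suc: "mat_pow A (Suc k) = A ** mat_pow A k"
  by (simp add: mat_pow_def)

lemma mat_pow_add: "mat_pow A (i + j) = mat_pow A i ** mat_pow A j"
  for A :: "real ^ 'n::finite ^ 'n"
  by (induction i) (simp_all add: mat_pow_Suc matrix_mul_assoc)

lemma mat_pow_Suc2: "mat_pow A (Suc k) = mat_pow A k ** A"
  for A :: "real ^ 'n::finite ^ 'n"
  using mat_pow_add[of A k 1] by (simp add: mat_pow_Suc)

definition substochastic :: "real ^ 'n::finite ^ 'n \<Rightarrow> bool" where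
  "substochastic Q \<longleftrightarrow> (\<forall>i j. Q $ i $ j \<ge> 0) \<and> (\<forall>i. (\<Sum>j\<in>UNIV. Q $ i $ j) \<le> 1)"

definition stochastic :: "real ^ 'n::finite ^ 'n \<Rightarrow> bool" where
  "stochastic Q \<longleftrightarrow> (\<forall>i j. Q $ i $ j \<ge> 0) \<and> (\<forall>i. (\<Sum>j\<in>UNIV. Q $ i $ j) = 1)"

lemma matrix_mult_component: "(A ** B) $ i $ j = (\<Sum>k\<in>UNIV. A $ i $ k * B $ k $ j)"
  by (simp add: matrix_matrix_mult_def)

lemma row_sum_mult:
  "(\<Sum>j\<in>UNIV. (A ** B) $ i $ j) = (\<Sum>k\<in>UNIV. A $ i $ k * (\<Sum>j\<in>UNIV. B $ k $ j))"
  for A :: "real ^ 'm::finite ^ 'n" and B :: "real ^ 'p::finite ^ 'm"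
  unfolding matrix_mult_component sum_distrib_left by (rule sum.swap)

lemma substochastic_mult: "substochastic A \<Longrightarrow> substochastic B \<Longrightarrow> substochastic (A ** B)"
proof -
  assume A: "substochastic A" and B: "substochastic B"
  have "(\<Sum>j\<in>UNIV. (A ** B) $ i $ j) \<le> 1" for i
  proof -
    have "(\<Sum>j\<in>UNIV. (A ** B) $ i $ j) \<le> (\<Sum>k\<in>UNIV. A $ i $ k * 1)"
      unfolding row_sum_mult
      by (intro sum_mono mult_left_mono) (use A B in \<open>auto simp: substochastic_def\<close>)
    also have "\<dots> \<le> 1" using A by (simp add: substochastic_def)
    finally show ?thesis .
  qed
  moreover have "(A ** B) $ i $ j \<ge> 0" for i j
    unfolding matrix_mult_component
    by (intro sum_nonneg mult_nonneg_nonneg) (use A B in \<open>auto simp: substochastic_def\<close>)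
  ultimately show ?thesis by (simp add: substochastic_def)
qed

lemma substochastic_mat_1: "substochastic (mat 1)"
  by (auto simp: substochastic_def mat_def)

lemma substochastic_mat_pow: "substochastic A \<Longrightarrow> substochastic (mat_pow A k)"
  by (induction k) (simp_all add: mat_pow_Suc substochastic_mat_1 substochastic_mult)

lemma stochastic_mat_pow: "stochastic A \<Longrightarrow> stochastic (mat_pow A k)"
proof (induction k)
  case 0
  then show ?case by (auto simp: stochastic_def mat_def)
next
  case (Suc k)
  then have A: "stochastic A" and B: "stochastic (mat_pow A k)" by auto
  have "(A ** mat_pow A k) $ i $ j \<ge> 0" for i j
    unfolding matrix_mult_component
    by (intro sum_nonneg mult_nonneg_nonneg) (use A B in \<open>auto simp: stochastic_def\<close>)
  moreover have "(\<Sum>j\<in>UNIV. (A ** mat_pow A k) $ i $ j) = 1" for i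
    unfolding row_sum_mult using A B by (simp add: stochastic_def)
  ultimately show ?case by (simp add: stochastic_def mat_pow_Suc)
qed

text \<open>Division with remainder gives m = q * k + r with r < k, and m \<ge> k * k forces k \<le>
  q. Then m = (q - r) * k + r * (k + 1) combines the two consecutive members with nonnegative
  coefficients.\<close>

lemma consecutive_members_imp_cofinite:
  fixes X :: "nat set"
  assumes add: "\<And>a b. a \<in> X \<Longrightarrow> b \<in> X \<Longrightarrow> a + b \<in> X"
    and "k \<in> X" "Suc k \<in> X" "k > 0"
  shows "\<exists>N. \<forall>m\<ge>N. m \<in> X"
proof -
  have mult: "j * a \<in> X" if "a \<in> X" "j > 0" for a j
    using that(2)
  proof (induction j)
    case (Suc j)
    then show ?case using that(1) add by (cases "j = 0") auto
  qed simp
  have "m \<in> X" if m: "m \<ge> k * k" for m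
  proof -
    define q r where "q = m div k" and "r = m mod k"
    have mq: "m = q * k + r" by (simp add: q_def r_def)
    have "r < k" using assms by (simp add: r_def)
    moreover have "k \<le> q"
      using m assms unfolding q_def by (metis div_le_mono nonzero_mult_div_cancel_left neq0_conv)
    ultimately have "r < q" by simp
    then have "q * k = (q - r) * k + r * k" by (simp flip: add_mult_distrib)
    then have "m = (q - r) * k + r * Suc k" unfolding mq by simp
    moreover have "(q - r) * k \<in> X" using mult[of k "q - r"] \<open>r < q\<close> assms by simp
    ultimately show ?thesis
      using mult[of "Suc k" r] assms add by (cases "r = 0") auto
  qed
  then show ?thesis by blast
qed

text \<open>The least positive difference g of two members divides every member, so gcd 1 forces g =
  1 and two consecutive members exist.\<close>

lemma Gcd_1_imp_cofinite:
  fixes X :: "nat set"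
  assumes add: "\<And>a b. a \<in> X \<Longrightarrow> b \<in> X \<Longrightarrow> a + b \<in> X"
    and Gcd: "Gcd X = 1" and pos: "\<And>a. a \<in> X \<Longrightarrow> a > 0"
  shows "\<exists>N. \<forall>m\<ge>N. m \<in> X"
proof -
  have mult: "j * a \<in> X" if "a \<in> X" "j > 0" for a j
    using that(2)
  proof (induction j)
    case (Suc j)
    then show ?case using that(1) add by (cases "j = 0") auto
  qed simp
  have "X \<noteq> {}" using Gcd by auto
  then obtain a0 where a0: "a0 \<in> X" by blast
  define D where "D = {c. c > 0 \<and> (\<exists>b\<in>X. b + c \<in> X)}"
  have "a0 \<in> D" using a0 add pos by (auto simp: D_def)
  define g where "g = (LEAST c. c \<in> D)"
  have gD: "g \<in> D" unfolding g_def by (rule LeastI) fact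
  have gmin: "g \<le> c" if "c \<in> D" for c unfolding g_def using that by (rule Least_le)
  obtain b where b: "b \<in> X" "b + g \<in> X" and "g > 0" using gD by (auto simp: D_def)
  have "g dvd a" if a: "a \<in> X" for a
  proof (rule ccontr)
    assume "\<not> g dvd a"
    then have r: "a mod g > 0" by (simp add: mod_greater_zero_iff_not_dvd)
    define q where "q = a div g"
    have aq: "a = q * g + a mod g" by (simp add: q_def)
    \<comment> \<open>With a = q * g + a mod g, this member and \<open>Suc q * b + b + a\<close>
      differ by g - a mod g, a positive difference smaller than g.\<close>
    have "Suc q * b + b + a + (g - a mod g) = Suc q * b + b + q * g + (a mod g + (g - a mod g))"
      using aq by linarith
    also have "a mod g + (g - a mod g) = g" using \<open>g > 0\<close> by (simp add: less_imp_le)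
    also have "Suc q * b + b + q * g + g = Suc q * (b + g) + b" by (simp add: algebra_simps)
    also have "\<dots> \<in> X" by (intro add mult b) simp
    finally have "Suc q * b + b + a + (g - a mod g) \<in> X" .
    moreover have "Suc q * b + b + a \<in> X" by (intro add mult b a) simp
    moreover have "g - a mod g > 0" using \<open>g > 0\<close> by simp
    ultimately have "g - a mod g \<in> D" unfolding D_def by blast
    then show False using gmin r \<open>g > 0\<close> by fastforce
  qed
  then have "g dvd Gcd X" by (rule Gcd_greatest)
  then have "g = 1" using Gcd by simp
  then show ?thesis using consecutive_members_imp_cofinite[of X b] add b pos by auto
qed

text \<open>Return times to a state are closed under addition and have gcd 1, so loops of every
  large length exist. Any two states are then joined by a loop followed by a connecting path; the
  common length N is chosen large enough for every pair.\<close>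

lemma ergodic_imp_positive_power:
  fixes Q :: "real ^ 'n::finite ^ 'n"
  assumes sto: "stochastic Q" and erg: "ergodic_chain Q"
  shows "\<exists>N. \<forall>i j. mat_pow Q N $ i $ j > 0"
proof -
  have nonneg: "mat_pow Q k $ i $ j \<ge> 0" for k i j
    using stochastic_mat_pow[OF sto] by (simp add: stochastic_def)
  have step: "mat_pow Q (k + l) $ i $ j > 0"
    if "mat_pow Q k $ i $ m > 0" "mat_pow Q l $ m $ j > 0" for k l i j m
  proof -
    have "0 < mat_pow Q k $ i $ m * mat_pow Q l $ m $ j" using that by simp
    also have "\<dots> \<le> (\<Sum>m\<in>UNIV. mat_pow Q k $ i $ m * mat_pow Q l $ m $ j)"
      by (rule member_le_sum) (auto simp: nonneg)
    finally show ?thesis by (simp add: mat_pow_add matrix_mult_component)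
  qed
  have "\<exists>N. \<forall>m\<ge>N. m \<in> {k. k > 0 \<and> mat_pow Q k $ i $ i > 0}" for i
  proof (rule Gcd_1_imp_cofinite)
    show "Gcd {k. k > 0 \<and> mat_pow Q k $ i $ i > 0} = 1"
      using erg by (simp add: ergodic_chain_def aperiodic_chain_def)
  qed (auto intro: step)
  then obtain R where R: "\<And>i m. m \<ge> R i \<Longrightarrow> mat_pow Q m $ i $ i > 0" by simp metis
  obtain K where K: "\<And>i j. mat_pow Q (K i j) $ i $ j > 0"
    using erg unfolding ergodic_chain_def irreducible_chain_def by metis
  define N where "N = (\<Sum>i\<in>UNIV. R i) + (\<Sum>i\<in>UNIV. \<Sum>j\<in>UNIV. K i j)"
  have "mat_pow Q N $ i $ j > 0" for i j
  proof -
    have "R i \<le> (\<Sum>i\<in>UNIV. R i)" by (rule member_le_sum) auto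
    moreover have "K i j \<le> (\<Sum>i\<in>UNIV. \<Sum>j\<in>UNIV. K i j)"
      by (rule order.trans[OF member_le_sum[of j UNIV "K i"] member_le_sum[of i UNIV "\<lambda>i. \<Sum>j\<in>UNIV. K i j"]]) auto
    ultimately have *: "N - K i j \<ge> R i" "N = (N - K i j) + K i j" unfolding N_def by linarith+
    show ?thesis by (subst *(2)) (rule step[OF R[OF *(1)] K])
  qed
  then show ?thesis by blast
qed

section \<open>Stationary distributions\<close>

lemma stationary_mat_pow:
  fixes Q :: "real ^ 's::finite ^ 's"
  assumes "stationary_distribution d Q"
  shows "(\<chi> s. pmf d s) v* mat_pow Q k = (\<chi> s. pmf d s)"
proof (induction k)
  case (Suc k)
  have "(\<chi> s. pmf d s) v* mat_pow Q (Suc k) = ((\<chi> s. pmf d s) v* Q) v* mat_pow Q k"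
    by (simp add: mat_pow_Suc vector_matrix_mul_assoc)
  then show ?case using Suc assms by (simp add: stationary_distribution_def)
qed simp

lemma stationary_component:
  fixes Q :: "real ^ 's::finite ^ 's"
  assumes "stationary_distribution d Q"
  shows "pmf d s = (\<Sum>s'\<in>UNIV. pmf d s' * mat_pow Q k $ s' $ s)"
  using arg_cong[OF stationary_mat_pow[OF assms, of k], of "\<lambda>v. v $ s"]
  by (simp add: vector_matrix_mult_def mult.commute)

lemma sum_pmf_UNIV: "(\<Sum>s\<in>UNIV. pmf d s) = 1" for d :: "'s::finite pmf"
  by (rule sum_pmf_eq_1) auto

lemma stationary_sum:
  fixes Q :: "real ^ 's::finite ^ 's"
  assumes "stationary_distribution d Q"
  shows "(\<Sum>s\<in>UNIV. pmf d s * (mat_pow Q k *v h) $ s) = (\<Sum>s\<in>UNIV. pmf d s * h $ s)"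
proof -
  have "(\<Sum>s\<in>UNIV. pmf d s * (mat_pow Q k *v h) $ s)
      = (\<Sum>s\<in>UNIV. \<Sum>s'\<in>UNIV. pmf d s * mat_pow Q k $ s $ s' * h $ s')"
    by (simp add: matrix_vector_mult_def sum_distrib_left mult.assoc)
  also have "\<dots> = (\<Sum>s'\<in>UNIV. (\<Sum>s\<in>UNIV. pmf d s * mat_pow Q k $ s $ s') * h $ s')"
    by (subst sum.swap) (simp add: sum_distrib_right)
  also have "\<dots> = (\<Sum>s\<in>UNIV. pmf d s * h $ s)"
    by (simp add: stationary_component[OF assms, of _ k, symmetric])
  finally show ?thesis .
qed

text \<open>A strictly positive power of the chain moves some mass of an atom of d to every state,
  and d is invariant under that power.\<close>

lemma stationary_pos:
  fixes Q :: "real ^ 's::finite ^ 's"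
  assumes "stochastic Q" "ergodic_chain Q" "stationary_distribution d Q"
  shows "pmf d s > 0"
proof -
  obtain N where N: "\<And>i j. mat_pow Q N $ i $ j > 0"
    using ergodic_imp_positive_power[OF assms(1,2)] by blast
  obtain s0 where "s0 \<in> set_pmf d" using set_pmf_not_empty[of d] by blast
  then have "0 < pmf d s0 * mat_pow Q N $ s0 $ s" using N by (simp add: pmf_positive)
  also have "\<dots> \<le> (\<Sum>s'\<in>UNIV. pmf d s' * mat_pow Q N $ s' $ s)"
    by (rule member_le_sum) (auto intro!: mult_nonneg_nonneg less_imp_le[OF N])
  finally show ?thesis using stationary_component[OF assms(3), of s N] by simp
qed

section \<open>Contraction of the oscillation and geometric mixing\<close>

lemma stochastic_interval:
  assumes "stochastic Q" "\<And>s. a \<le> h $ s" "\<And>s. h $ s \<le> b"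
  shows "a \<le> (Q *v h) $ s" "(Q *v h) $ s \<le> b"
proof -
  have q: "Q $ s $ j \<ge> 0" "(\<Sum>j\<in>UNIV. Q $ s $ j) = 1" for j
    using assms(1) by (auto simp: stochastic_def)
  have "(\<Sum>j\<in>UNIV. Q $ s $ j * a) \<le> (\<Sum>j\<in>UNIV. Q $ s $ j * h $ j)"
    "(\<Sum>j\<in>UNIV. Q $ s $ j * h $ j) \<le> (\<Sum>j\<in>UNIV. Q $ s $ j * b)"
    using assms q by (auto intro!: sum_mono mult_left_mono)
  then show "a \<le> (Q *v h) $ s" "(Q *v h) $ s \<le> b"
    using q by (simp_all add: matrix_vector_mult_def sum_distrib_right[symmetric])
qed

text \<open>Doeblin's minorisation: all rows share mass \<delta> on \<open>s0\<close>, so this part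
  contributes the same number to every component, and only the remaining mass 1 - \<delta> can see
  the spread b - a.\<close>

lemma doeblin_contraction:
  assumes sto: "stochastic Q" and \<delta>: "\<And>s. \<delta> \<le> Q $ s $ s0"
    and h: "\<And>s. a \<le> h $ s" "\<And>s. h $ s \<le> b"
  shows "\<delta> * h $ s0 + (1 - \<delta>) * a \<le> (Q *v h) $ s" "(Q *v h) $ s \<le> \<delta> * h $ s0 + (1 - \<delta>) * b"
proof -
  have q: "Q $ s $ j \<ge> 0" "(\<Sum>j\<in>UNIV. Q $ s $ j) = 1" for j
    using sto by (auto simp: stochastic_def)
  define c where "c = (\<lambda>j. Q $ s $ j - (if j = s0 then \<delta> else 0))"
  have c0: "c j \<ge> 0" for j using q \<delta> by (simp add: c_def)
  have c1: "(\<Sum>j\<in>UNIV. c j) = 1 - \<delta>" using q by (simp add: c_def sum_subtractf)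
  have eq: "(Q *v h) $ s = \<delta> * h $ s0 + (\<Sum>j\<in>UNIV. c j * h $ j)"
  proof -
    have "(\<Sum>j\<in>UNIV. c j * h $ j)
        = (\<Sum>j\<in>UNIV. Q $ s $ j * h $ j - (if j = s0 then \<delta> * h $ s0 else 0))"
      by (intro sum.cong) (auto simp: c_def algebra_simps)
    then show ?thesis by (simp add: sum_subtractf matrix_vector_mult_def)
  qed
  have "(\<Sum>j\<in>UNIV. c j * a) \<le> (\<Sum>j\<in>UNIV. c j * h $ j)"
    "(\<Sum>j\<in>UNIV. c j * h $ j) \<le> (\<Sum>j\<in>UNIV. c j * b)"
    using c0 h by (auto intro!: sum_mono mult_left_mono)
  then show "\<delta> * h $ s0 + (1 - \<delta>) * a \<le> (Q *v h) $ s" "(Q *v h) $ s \<le> \<delta> * h $ s0 + (1 - \<delta>) * b"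
    unfolding eq by (simp_all add: sum_distrib_right[symmetric] c1)
qed

text \<open>The oscillation of Q^k h shrinks by the factor 1 - \<delta> every N steps. Stationarity
  preserves the mean of h under d, so for a centred h the enclosing interval contains 0 and its
  length bounds the absolute value.\<close>

proposition geometric_mixing:
  fixes Q :: "real ^ 's::finite ^ 's"
  assumes sto: "stochastic Q" and erg: "ergodic_chain Q" and stat: "stationary_distribution d Q"
  shows "\<exists>C \<rho>. C > 0 \<and> 0 < \<rho> \<and> \<rho> < 1 \<and>
    (\<forall>h k s. (\<Sum>s\<in>UNIV. pmf d s * h $ s) = 0 \<longrightarrow> \<bar>(mat_pow Q k *v h) $ s\<bar> \<le> C * \<rho> ^ k * norm h)"
proof -
  obtain N0 where N0: "\<And>i j. mat_pow Q N0 $ i $ j > 0"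
    using ergodic_imp_positive_power[OF sto erg] by blast
  \<comment> \<open>The successor makes N positive, so that the N-th root below is meaningful;
    positivity of the power survives the extra step because each row of Q has a positive
    entry.\<close>
  define N where "N = Suc N0"
  fix s0 :: 's
  have N: "mat_pow Q N $ i $ s0 > 0" for i
  proof -
    have "\<exists>k. Q $ i $ k > 0"
    proof (rule ccontr)
      assume "\<not> ?thesis"
      then have "(\<Sum>k\<in>UNIV. Q $ i $ k) \<le> 0" by (intro sum_nonpos) (auto simp: not_less)
      then show False using sto by (simp add: stochastic_def)
    qed
    then obtain k where "Q $ i $ k > 0" by blast
    then have "0 < Q $ i $ k * mat_pow Q N0 $ k $ s0" using N0 by simp
    also have "\<dots> \<le> (\<Sum>k\<in>UNIV. Q $ i $ k * mat_pow Q N0 $ k $ s0)"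
      by (rule member_le_sum)
        (use sto less_imp_le[OF N0] in \<open>auto simp: stochastic_def intro!: mult_nonneg_nonneg\<close>)
    finally show ?thesis by (simp add: N_def mat_pow_Suc matrix_mult_component)
  qed
  \<comment> \<open>The cap 1/2 keeps 1 - \<delta> at least 1/2, which absorbs the remainder k mod N
    in \<open>pow\<close> at the price of a factor 2.\<close>
  define \<delta> where "\<delta> = min (1/2) (Min (range (\<lambda>i. mat_pow Q N $ i $ s0)))"
  have \<delta>: "0 < \<delta>" "\<delta> \<le> 1/2" "\<And>i. \<delta> \<le> mat_pow Q N $ i $ s0"
    using N by (auto simp: \<delta>_def min_le_iff_disj Min_gr_iff intro!: disjI2 Min_le)
  have stoN: "stochastic (mat_pow Q k)" for k by (rule stochastic_mat_pow[OF sto])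
  have iter: "\<exists>a b. (\<forall>s. a \<le> (mat_pow Q (j * N) *v h) $ s \<and> (mat_pow Q (j * N) *v h) $ s \<le> b)
      \<and> b - a = (1 - \<delta>) ^ j * (2 * norm h)" for h j
  proof (induction j)
    case 0
    have "\<bar>h $ s\<bar> \<le> norm h" for s by (rule component_le_norm_cart)
    then show ?case
      by (intro exI[of _ "- norm h"] exI[of _ "norm h"]) (auto simp: abs_le_iff minus_le_iff)
  next
    case (Suc j)
    define g where "g = mat_pow Q (j * N) *v h"
    obtain a b where ab: "\<And>s. a \<le> g $ s" "\<And>s. g $ s \<le> b" "b - a = (1 - \<delta>) ^ j * (2 * norm h)"
      using Suc by (auto simp: g_def)
    have eq: "mat_pow Q (Suc j * N) *v h = mat_pow Q N *v g"
      by (simp add: g_def mat_pow_add matrix_vector_mul_assoc)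
    show ?case unfolding eq
      by (intro exI[of _ "\<delta> * g $ s0 + (1 - \<delta>) * a"] exI[of _ "\<delta> * g $ s0 + (1 - \<delta>) * b"] conjI allI
        doeblin_contraction[OF stoN \<delta>(3) ab(1,2)])
        (simp add: ab(3) flip: right_diff_distrib)
  qed
  define \<rho> where "\<rho> = root N (1 - \<delta>)"
  have \<rho>N: "\<rho> ^ N = 1 - \<delta>" using \<delta> unfolding \<rho>_def by (intro real_root_pow_pos2) (auto simp: N_def)
  have \<rho>: "0 < \<rho>" "\<rho> < 1" using \<delta> by (auto simp: \<rho>_def N_def)
  have pow: "(1 - \<delta>) ^ (k div N) \<le> 2 * \<rho> ^ k" for k
  proof -
    have "k = N * (k div N) + k mod N" by simp
    then have "\<rho> ^ k = (1 - \<delta>) ^ (k div N) * \<rho> ^ (k mod N)"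
      by (metis power_add power_mult \<rho>N)
    also have "\<rho> ^ (k mod N) \<ge> \<rho> ^ N"
      using \<rho> by (intro power_decreasing) (auto simp: N_def less_imp_le)
    then have "(1 - \<delta>) ^ (k div N) * \<rho> ^ (k mod N) \<ge> (1 - \<delta>) ^ (k div N) * (1/2)"
      using \<delta> \<rho>N by (intro mult_left_mono) auto
    finally show ?thesis by simp
  qed
  \<comment> \<open>The 4 is the factor 2 from \<open>pow\<close> times the initial interval length
    of 2 * norm h.\<close>
  have main: "\<bar>(mat_pow Q k *v h) $ s\<bar> \<le> 4 * \<rho> ^ k * norm h"
    if h: "(\<Sum>s\<in>UNIV. pmf d s * h $ s) = 0" for h k s
  proof -
    define j where "j = k div N"
    define g where "g = mat_pow Q (j * N) *v h"
    obtain a b where ab: "\<And>s. a \<le> g $ s" "\<And>s. g $ s \<le> b" "b - a = (1 - \<delta>) ^ j * (2 * norm h)"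
      using iter[of j h] unfolding g_def by metis
    have eq: "mat_pow Q k *v h = mat_pow Q (k mod N) *v g"
    proof -
      have "k = k mod N + j * N" by (simp add: j_def)
      then show ?thesis unfolding g_def by (metis mat_pow_add matrix_vector_mul_assoc)
    qed
    have in_ab: "a \<le> (mat_pow Q k *v h) $ s" "(mat_pow Q k *v h) $ s \<le> b" for s
      unfolding eq by (rule stochastic_interval[OF stoN ab(1,2)])+
    have "(\<Sum>s\<in>UNIV. pmf d s * a) \<le> (\<Sum>s\<in>UNIV. pmf d s * (mat_pow Q k *v h) $ s)"
      "(\<Sum>s\<in>UNIV. pmf d s * (mat_pow Q k *v h) $ s) \<le> (\<Sum>s\<in>UNIV. pmf d s * b)"
      by (intro sum_mono mult_left_mono in_ab; simp)+
    then have "a \<le> 0" "0 \<le> b"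
      using stationary_sum[OF stat, of k h] h
      by (simp_all add: sum_distrib_right[symmetric] sum_pmf_UNIV)
    then have "\<bar>(mat_pow Q k *v h) $ s\<bar> \<le> b - a" using in_ab[of s] by linarith
    also have "\<dots> \<le> 2 * \<rho> ^ k * (2 * norm h)" unfolding ab(3) j_def
      by (intro mult_right_mono pow) auto
    finally show ?thesis by simp
  qed
  show ?thesis using main \<rho> by (intro exI[of _ 4] exI[of _ \<rho>]) auto
qed

section \<open>Discounted step sizes and the Poisson corrector\<close>

text \<open>The scale of the Poisson corrector: under mixing with rate \<rho> the noise expected k
  steps ahead has decayed like \<rho>^k and is weighted by the step size used then.\<close>

definition discounted_tail :: "real \<Rightarrow> (nat \<Rightarrow> real) \<Rightarrow> nat \<Rightarrow> real" where
  "discounted_tail \<rho> \<alpha> t = (\<Sum>k. \<alpha> (t + k) * \<rho> ^ k)"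

text \<open>Weighting the Poisson equation with the future step sizes, instead of multiplying one fixed
  solution by the current step size, makes the recursion exact, so no monotonicity of the step sizes
  is needed.\<close>

definition poisson_corrector ::
    "real ^ 's ^ 's \<Rightarrow> (nat \<Rightarrow> real) \<Rightarrow> nat \<Rightarrow> real ^ 's::finite \<Rightarrow> real ^ 's" where
  "poisson_corrector Q \<alpha> t h = (\<chi> s. \<Sum>k. \<alpha> (t + k) * (mat_pow Q k *v h) $ s)"

lemma square_summable_imp_tendsto_zero:
  fixes \<alpha> :: "nat \<Rightarrow> real"
  assumes "summable (\<lambda>t. (\<alpha> t)\<^sup>2)"
  shows "\<alpha> \<longlonglongrightarrow> 0"
proof -
  have "(\<lambda>t. sqrt ((\<alpha> t)\<^sup>2)) \<longlonglongrightarrow> sqrt 0"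
    by (intro tendsto_intros summable_LIMSEQ_zero assms)
  then show ?thesis by (simp add: tendsto_rabs_zero_iff)
qed

lemma square_summable_imp_bounded:
  fixes \<alpha> :: "nat \<Rightarrow> real"
  assumes "summable (\<lambda>t. (\<alpha> t)\<^sup>2)"
  shows "\<exists>B>0. \<forall>t. \<bar>\<alpha> t\<bar> \<le> B"
proof -
  have "Bseq \<alpha>"
    by (intro convergent_imp_Bseq convergentI[of _ 0] square_summable_imp_tendsto_zero assms)
  then show ?thesis by (auto simp: Bseq_def)
qed

context
  fixes \<alpha> :: "nat \<Rightarrow> real" and \<rho> :: real
  assumes \<alpha>_nonneg: "\<And>t. \<alpha> t \<ge> 0" and \<alpha>_sq: "summable (\<lambda>t. (\<alpha> t)\<^sup>2)"
    and \<rho>: "0 < \<rho>" "\<rho> < 1"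
begin

lemma summable_discounted: "summable (\<lambda>k. \<alpha> (t + k) * \<rho> ^ k)"
proof -
  obtain B where B: "\<And>t. \<bar>\<alpha> t\<bar> \<le> B" using square_summable_imp_bounded[OF \<alpha>_sq] by blast
  show ?thesis
  proof (rule summable_comparison_test')
    show "summable (\<lambda>k. B * \<rho> ^ k)" using \<rho> by (intro summable_mult summable_geometric) simp
    show "norm (\<alpha> (t + k) * \<rho> ^ k) \<le> B * \<rho> ^ k" for k
      using B[of "t + k"] \<rho> by (simp add: abs_mult mult_right_mono)
  qed
qed

lemma discounted_tail_nonneg: "discounted_tail \<rho> \<alpha> t \<ge> 0"
  unfolding discounted_tail_def using \<alpha>_nonneg \<rho>
  by (intro suminf_nonneg summable_discounted) simp

lemma discounted_tail_rec: "discounted_tail \<rho> \<alpha> t = \<alpha> t + \<rho> * discounted_tail \<rho> \<alpha> (Suc t)"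
proof -
  have "discounted_tail \<rho> \<alpha> t = (\<Sum>k. \<alpha> (t + Suc k) * \<rho> ^ Suc k) + \<alpha> t"
    unfolding discounted_tail_def using suminf_split_head[OF summable_discounted, of t] by simp
  also have "(\<Sum>k. \<alpha> (t + Suc k) * \<rho> ^ Suc k) = (\<Sum>k. \<rho> * (\<alpha> (Suc t + k) * \<rho> ^ k))"
    by (simp add: mult_ac)
  also have "\<dots> = \<rho> * discounted_tail \<rho> \<alpha> (Suc t)"
    unfolding discounted_tail_def by (rule suminf_mult[OF summable_discounted])
  finally show ?thesis by simp
qed

lemma discounted_tail_bounded: "\<exists>B>0. \<forall>t. discounted_tail \<rho> \<alpha> t \<le> B"
proof -
  obtain B where B: "B > 0" "\<And>t. \<bar>\<alpha> t\<bar> \<le> B" using square_summable_imp_bounded[OF \<alpha>_sq] by blast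
  have "discounted_tail \<rho> \<alpha> t \<le> (\<Sum>k. B * \<rho> ^ k)" for t
    unfolding discounted_tail_def
    by (intro suminf_le summable_discounted summable_mult summable_geometric mult_right_mono)
      (use B \<rho> in \<open>auto simp: abs_le_iff\<close>)
  also have "(\<Sum>k. B * \<rho> ^ k) = B / (1 - \<rho>)"
    using \<rho> by (simp add: suminf_mult summable_geometric suminf_geometric divide_inverse)
  finally show ?thesis using B \<rho> by (intro exI[of _ "B / (1 - \<rho>)"]) auto
qed

text \<open>The recursion writes the tail as a convex combination of \<alpha> t / (1 - \<rho>) and
  the next tail, with weights 1 - \<rho> and \<rho>. Convexity of the square and summation reproduce
  the same sum with factor \<rho> < 1 on the right, where it can be absorbed.\<close>

lemma discounted_tail_square_summable: "summable (\<lambda>t. (discounted_tail \<rho> \<alpha> t)\<^sup>2)"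
proof -
  let ?\<beta> = "discounted_tail \<rho> \<alpha>"
  obtain B where B: "\<And>t. ?\<beta> t \<le> B" using discounted_tail_bounded by blast
  have conv: "(?\<beta> t)\<^sup>2 \<le> (\<alpha> t)\<^sup>2 / (1 - \<rho>) + \<rho> * (?\<beta> (Suc t))\<^sup>2" for t
  proof -
    have "(\<alpha> t)\<^sup>2 / (1 - \<rho>) + \<rho> * (?\<beta> (Suc t))\<^sup>2 - (?\<beta> t)\<^sup>2
        = \<rho> / (1 - \<rho>) * (\<alpha> t - (1 - \<rho>) * ?\<beta> (Suc t))\<^sup>2"
      unfolding discounted_tail_rec[of t] using \<rho>
      by (simp add: field_simps power2_eq_square)
    also have "\<dots> \<ge> 0" using \<rho> by simp
    finally show ?thesis by simp
  qed
  have "(\<Sum>t<T. (?\<beta> t)\<^sup>2) \<le> ((\<Sum>t. (\<alpha> t)\<^sup>2) / (1 - \<rho>) + B\<^sup>2) / (1 - \<rho>)" for T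
  proof -
    have B0: "0 \<le> B" using B[of 0] discounted_tail_nonneg[of 0] by linarith
    \<comment> \<open>Shifting the index adds only the boundary term at T, which is at most the
      square of B.\<close>
    have shift: "(\<Sum>t<T. (?\<beta> (Suc t))\<^sup>2) \<le> (\<Sum>t<T. (?\<beta> t)\<^sup>2) + B\<^sup>2"
    proof -
      have "(\<Sum>t<T. (?\<beta> (Suc t))\<^sup>2) \<le> (\<Sum>t<Suc T. (?\<beta> t)\<^sup>2)"
        by (subst sum.lessThan_Suc_shift) simp
      moreover have "(?\<beta> T)\<^sup>2 \<le> B\<^sup>2" using B discounted_tail_nonneg by (intro power_mono)
      ultimately show ?thesis by simp
    qed
    have "(\<Sum>t<T. (?\<beta> t)\<^sup>2) \<le> (\<Sum>t<T. (\<alpha> t)\<^sup>2 / (1 - \<rho>) + \<rho> * (?\<beta> (Suc t))\<^sup>2)"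
      by (intro sum_mono conv)
    also have "\<dots> = (\<Sum>t<T. (\<alpha> t)\<^sup>2) / (1 - \<rho>) + \<rho> * (\<Sum>t<T. (?\<beta> (Suc t))\<^sup>2)"
      by (simp add: sum.distrib sum_divide_distrib sum_distrib_left)
    also have "\<dots> \<le> (\<Sum>t. (\<alpha> t)\<^sup>2) / (1 - \<rho>) + \<rho> * ((\<Sum>t<T. (?\<beta> t)\<^sup>2) + B\<^sup>2)"
      using \<rho> shift by (intro add_mono divide_right_mono sum_le_suminf \<alpha>_sq mult_left_mono) auto
    also have "\<dots> \<le> (\<Sum>t. (\<alpha> t)\<^sup>2) / (1 - \<rho>) + \<rho> * (\<Sum>t<T. (?\<beta> t)\<^sup>2) + B\<^sup>2"
      using \<rho> by (simp add: distrib_left mult_left_le_one_le)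
    finally have "(\<Sum>t<T. (?\<beta> t)\<^sup>2) * (1 - \<rho>) \<le> (\<Sum>t. (\<alpha> t)\<^sup>2) / (1 - \<rho>) + B\<^sup>2"
      by (simp add: algebra_simps)
    then show ?thesis using \<rho> by (simp add: pos_le_divide_eq)
  qed
  then show ?thesis by (intro summableI_nonneg_bounded) auto
qed

context
  fixes Q :: "real ^ 's::finite ^ 's" and d :: "'s pmf" and C :: real
  assumes C: "C > 0"
    and mix: "\<And>h k s. (\<Sum>s\<in>UNIV. pmf d s * h $ s) = 0 \<Longrightarrow>
      \<bar>(mat_pow Q k *v h) $ s\<bar> \<le> C * \<rho> ^ k * norm h"
begin

lemma corrector_term_bound:
  assumes "(\<Sum>s\<in>UNIV. pmf d s * h $ s) = 0"
  shows "\<bar>\<alpha> (t + k) * (mat_pow Q k *v h) $ s\<bar> \<le> C * norm h * (\<alpha> (t + k) * \<rho> ^ k)"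
proof -
  have "\<bar>\<alpha> (t + k) * (mat_pow Q k *v h) $ s\<bar> \<le> \<alpha> (t + k) * (C * \<rho> ^ k * norm h)"
    unfolding abs_mult using \<alpha>_nonneg mix[OF assms] by (simp add: mult_left_mono)
  then show ?thesis by (simp add: mult_ac)
qed

lemma summable_corrector:
  assumes "(\<Sum>s\<in>UNIV. pmf d s * h $ s) = 0"
  shows "summable (\<lambda>k. \<alpha> (t + k) * (mat_pow Q k *v h) $ s)"
  by (rule summable_comparison_test'[OF summable_mult[OF summable_discounted]])
    (use corrector_term_bound[OF assms] in auto)

lemma poisson_corrector_bound:
  assumes "(\<Sum>s\<in>UNIV. pmf d s * h $ s) = 0"
  shows "\<bar>poisson_corrector Q \<alpha> t h $ s\<bar> \<le> C * discounted_tail \<rho> \<alpha> t * norm h"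
proof -
  have "norm (\<Sum>k. \<alpha> (t + k) * (mat_pow Q k *v h) $ s) \<le> (\<Sum>k. C * norm h * (\<alpha> (t + k) * \<rho> ^ k))"
    by (intro norm_suminf_le summable_mult summable_discounted)
      (use corrector_term_bound[OF assms] in auto)
  also have "\<dots> = C * norm h * discounted_tail \<rho> \<alpha> t"
    unfolding discounted_tail_def by (rule suminf_mult[OF summable_discounted])
  finally show ?thesis by (simp add: poisson_corrector_def mult_ac)
qed

lemma poisson_corrector_diff:
  assumes "(\<Sum>s\<in>UNIV. pmf d s * h $ s) = 0" "(\<Sum>s\<in>UNIV. pmf d s * h' $ s) = 0"
  shows "poisson_corrector Q \<alpha> t (h - h') = poisson_corrector Q \<alpha> t h - poisson_corrector Q \<alpha> t h'"
  unfolding poisson_corrector_def vec_eq_iff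
  using suminf_diff[OF summable_corrector[OF assms(1)] summable_corrector[OF assms(2)], of t]
  by (simp add: matrix_vector_mult_diff_distrib right_diff_distrib)

text \<open>Splitting off k = 0 and factoring one Q out of the other terms; the state space is
  finite, so Q may be exchanged with the series. The identity writes \<alpha>_t h as q_t - Q
  q_{t+1}, so that adding the corrector to the Lyapunov function cancels the noise in conditional
  mean.\<close>

lemma poisson_corrector_rec:
  assumes h: "(\<Sum>s\<in>UNIV. pmf d s * h $ s) = 0"
  shows "poisson_corrector Q \<alpha> t h $ s = \<alpha> t * h $ s + (Q *v poisson_corrector Q \<alpha> (Suc t) h) $ s"
proof -
  have "poisson_corrector Q \<alpha> t h $ s
      = (\<Sum>k. \<alpha> (t + Suc k) * (mat_pow Q (Suc k) *v h) $ s) + \<alpha> t * h $ s"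
    unfolding poisson_corrector_def using suminf_split_head[OF summable_corrector[OF h], of t s] by simp
  also have "(\<Sum>k. \<alpha> (t + Suc k) * (mat_pow Q (Suc k) *v h) $ s)
      = (\<Sum>k. \<Sum>j\<in>UNIV. Q $ s $ j * (\<alpha> (Suc t + k) * (mat_pow Q k *v h) $ j))"
  proof (rule suminf_cong)
    fix k
    have "(mat_pow Q (Suc k) *v h) $ s = (\<Sum>j\<in>UNIV. Q $ s $ j * (mat_pow Q k *v h) $ j)"
      by (simp add: mat_pow_Suc flip: matrix_vector_mul_assoc) (simp add: matrix_vector_mult_def)
    then show "\<alpha> (t + Suc k) * (mat_pow Q (Suc k) *v h) $ s
        = (\<Sum>j\<in>UNIV. Q $ s $ j * (\<alpha> (Suc t + k) * (mat_pow Q k *v h) $ j))"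
      by (simp add: sum_distrib_left mult_ac)
  qed
  also have "\<dots> = (\<Sum>j\<in>UNIV. \<Sum>k. Q $ s $ j * (\<alpha> (Suc t + k) * (mat_pow Q k *v h) $ j))"
    by (intro suminf_sum summable_mult summable_corrector h)
  also have "\<dots> = (\<Sum>j\<in>UNIV. Q $ s $ j * (\<Sum>k. (\<alpha> (Suc t + k) * (mat_pow Q k *v h) $ j)))"
    by (intro sum.cong refl suminf_mult summable_corrector h)
  also have "\<dots> = (Q *v poisson_corrector Q \<alpha> (Suc t) h) $ s"
    by (simp add: matrix_vector_mult_def poisson_corrector_def)
  finally show ?thesis by simp
qed

end

end

section \<open>Almost supermartingales\<close>

lemma gronwall_summable:
  fixes v \<kappa> :: "nat \<Rightarrow> real"
  assumes step: "\<And>t. t \<ge> T0 \<Longrightarrow> v (Suc t) \<le> (1 + \<kappa> t) * v t" and v: "\<And>t. t \<ge> T0 \<Longrightarrow> v t \<ge> 0"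
    and \<kappa>: "\<And>t. \<kappa> t \<ge> 0" "summable \<kappa>" and "t \<ge> T0"
  shows "v t \<le> exp (suminf \<kappa>) * v T0"
proof -
  have "v t \<le> exp (\<Sum>i<t. \<kappa> i) * v T0"
    using \<open>t \<ge> T0\<close>
  proof (induction t rule: dec_induct)
    \<comment> \<open>The exponent sums from 0 rather than from \<open>T0\<close>; the surplus is
      harmless because \<open>v T0\<close> is nonnegative.\<close>
    case base
    have "1 \<le> exp (\<Sum>i<T0. \<kappa> i)" using \<kappa> by (simp add: sum_nonneg)
    then show ?case using v[of T0] mult_right_mono by fastforce
  next
    case (step t)
    have "v (Suc t) \<le> (1 + \<kappa> t) * v t" by (rule assms(1)) fact
    also have "\<dots> \<le> exp (\<kappa> t) * v t"
      using step v by (intro mult_right_mono exp_ge_add_one_self)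
    also have "\<dots> \<le> exp (\<kappa> t) * (exp (\<Sum>i<t. \<kappa> i) * v T0)"
      using step by (intro mult_left_mono) auto
    finally show ?case by (simp add: exp_add mult_ac)
  qed
  also have "\<dots> \<le> exp (suminf \<kappa>) * v T0"
    using v[of T0] sum_le_suminf[OF \<kappa>(2), of "{..<t}"] \<kappa>(1) by (intro mult_right_mono) auto
  finally show ?thesis .
qed

text \<open>\<open>x t\<close> is the error norm at time \<open>t\<close>, whereas \<open>V t\<close> is a Lyapunov function of the error at time
  \<open>t + n\<close>: an \<open>n\<close>-step window separates the two, so the drift inequality only conditions on
  events determined by the errors up to time \<open>t\<close>.\<close>

locale perturbed_lyapunov = prob_space M for M :: "'w measure" +
  fixes x V :: "nat \<Rightarrow> 'w \<Rightarrow> real" and \<alpha> \<kappa> a b :: "nat \<Rightarrow> real" and n :: nat and c :: real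
  assumes x_nonneg: "\<And>t \<omega>. \<omega> \<in> space M \<Longrightarrow> x t \<omega> \<ge> 0"
    and x_measurable: "\<And>t. x t \<in> borel_measurable M"
    and x_sq_integrable: "\<And>t. integrable M (\<lambda>\<omega>. (x t \<omega>)\<^sup>2)"
    and V_integrable: "\<And>t. integrable M (V t)"
    and c_pos: "c > 0"
    and \<alpha>_nonneg: "\<And>t. \<alpha> t \<ge> 0" and \<alpha>_diverges: "\<not> summable \<alpha>"
    and \<kappa>_nonneg: "\<And>t. \<kappa> t \<ge> 0" and \<kappa>_summable: "summable \<kappa>"
    and a_tendsto: "a \<longlonglongrightarrow> 0" and a_nonneg: "\<And>t. a t \<ge> 0"
    and b_tendsto: "b \<longlonglongrightarrow> 0" and b_nonneg: "\<And>t. b t \<ge> 0"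
    and x_increment: "\<And>t \<omega>. \<omega> \<in> space M \<Longrightarrow> \<bar>x (t + n) \<omega> - x t \<omega>\<bar> \<le> a t * (1 + x t \<omega>)"
    and V_close: "\<And>t \<omega>. \<omega> \<in> space M \<Longrightarrow> \<bar>V t \<omega> - (x (t + n) \<omega>)\<^sup>2\<bar> \<le> b t * (1 + (x (t + n) \<omega>)\<^sup>2)"
    and drift: "\<And>t I \<theta>. I \<subseteq> {..t} \<Longrightarrow>
      (\<integral>\<omega>. of_bool (\<forall>s\<in>I. x s \<omega> < \<theta>) * (V (Suc t) \<omega> - V t \<omega>) \<partial>M)
      \<le> (\<integral>\<omega>. of_bool (\<forall>s\<in>I. x s \<omega> < \<theta>) * (\<kappa> t * (1 + (x t \<omega>)\<^sup>2) - c * \<alpha> t * (x t \<omega>)\<^sup>2) \<partial>M)"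
begin

declare x_measurable [measurable]

definition "y t \<omega> = 1 + (x t \<omega>)\<^sup>2"

lemma y_integrable: "integrable M (y t)"
  unfolding y_def using x_sq_integrable by simp

lemma small_eventually:
  assumes "\<epsilon> > 0"
  shows "\<exists>T. \<forall>t\<ge>T. a t \<le> \<epsilon> \<and> b t \<le> \<epsilon>"
proof -
  have "eventually (\<lambda>t. a t < \<epsilon>) sequentially" "eventually (\<lambda>t. b t < \<epsilon>) sequentially"
    using order_tendstoD(2)[OF a_tendsto assms] order_tendstoD(2)[OF b_tendsto assms] by auto
  then have "eventually (\<lambda>t. a t \<le> \<epsilon> \<and> b t \<le> \<epsilon>) sequentially"
    by eventually_elim auto
  then show ?thesis by (simp add: eventually_sequentially)
qed

lemma V_lower:
  assumes "\<omega> \<in> space M" "b t \<le> 1/2"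
  shows "V t \<omega> \<ge> (x (t + n) \<omega>)\<^sup>2 / 2 - b t"
proof -
  have "b t * (x (t + n) \<omega>)\<^sup>2 \<le> (1/2) * (x (t + n) \<omega>)\<^sup>2" using assms by (intro mult_right_mono) auto
  then show ?thesis using V_close[OF assms(1), of t] by (simp add: distrib_left abs_le_iff)
qed

text \<open>Turns a bound on V into one on the second moment despite the delay. For a t \<le> 1/2, x
  t is at most twice the delayed value plus 1, and squaring gives 8 times its square plus 2;
  \<open>V_lower\<close> costs another factor 2, whence 16.\<close>

lemma y_le_V:
  assumes "\<omega> \<in> space M" "a t \<le> 1/2" "b t \<le> 1/2"
  shows "y t \<omega> \<le> 16 * (V t \<omega> + 1)"
proof -
  let ?x = "x t \<omega>" and ?z = "x (t + n) \<omega>"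
  have "a t * (1 + ?x) \<le> (1/2) * (1 + ?x)" using assms x_nonneg by (intro mult_right_mono) auto
  then have "?x \<le> 2 * ?z + 1" using x_increment[OF assms(1), of t] by (simp add: abs_le_iff)
  then have "?x\<^sup>2 \<le> (2 * ?z + 1)\<^sup>2" using x_nonneg[OF assms(1)] by (intro power_mono)
  also have "\<dots> \<le> 8 * ?z\<^sup>2 + 2"
    using zero_le_power2[of "2 * ?z - 1"] by (simp add: power2_eq_square algebra_simps)
  finally show ?thesis using V_lower[OF assms(1,3)] assms(3)
    by (simp add: y_def)
qed

lemma expectation_step:
  "expectation (V (Suc t)) \<le> expectation (V t) + \<kappa> t * expectation (y t)
     - c * \<alpha> t * expectation (\<lambda>\<omega>. (x t \<omega>)\<^sup>2)"
proof -
  have "(\<integral>\<omega>. V (Suc t) \<omega> - V t \<omega> \<partial>M) \<le> (\<integral>\<omega>. \<kappa> t * y t \<omega> - c * \<alpha> t * (x t \<omega>)\<^sup>2 \<partial>M)"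
    using drift[of "{}" t] by (simp add: y_def)
  then show ?thesis using V_integrable y_integrable x_sq_integrable by simp
qed

text \<open>Without its negative term the drift inequality is a Gronwall recursion for E V + 1,
  since \<open>y_le_V\<close> bounds the perturbation by 16 times this quantity. Adding 1 makes it
  nonnegative.\<close>

lemma bounded_second_moment: "\<exists>K T. K \<ge> 0 \<and> (\<forall>t\<ge>T. expectation (y t) \<le> K \<and> expectation (V t) \<le> K)"
proof -
  obtain T where T: "\<And>t. t \<ge> T \<Longrightarrow> a t \<le> 1/2 \<and> b t \<le> 1/2" using small_eventually[of "1/2"] by auto
  define v where "v t = expectation (V t) + 1" for t
  have Ey: "expectation (y t) \<le> 16 * v t" if "t \<ge> T" for t
  proof -
    have "expectation (y t) \<le> (\<integral>\<omega>. 16 * (V t \<omega> + 1) \<partial>M)"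
      using T[OF that] by (intro integral_mono y_integrable) (use V_integrable y_le_V in auto)
    then show ?thesis using V_integrable by (simp add: v_def prob_space)
  qed
  have y0: "expectation (y t) \<ge> 0" for t
    by (rule integral_nonneg_AE) (auto simp: y_def)
  have "v t \<le> exp (\<Sum>t. 16 * \<kappa> t) * v T" if "t \<ge> T" for t
  proof (rule gronwall_summable)
    fix t assume t: "t \<ge> T"
    have "v (Suc t) \<le> v t + \<kappa> t * expectation (y t) - c * \<alpha> t * expectation (\<lambda>\<omega>. (x t \<omega>)\<^sup>2)"
      using expectation_step[of t] by (simp add: v_def)
    also have "\<dots> \<le> v t + \<kappa> t * (16 * v t) - 0"
      using \<kappa>_nonneg Ey[OF t] c_pos \<alpha>_nonneg by (intro diff_mono add_mono mult_left_mono) auto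
    finally show "v (Suc t) \<le> (1 + 16 * \<kappa> t) * v t" by (simp add: algebra_simps)
    show "v t \<ge> 0" using Ey[OF t] y0[of t] by linarith
  qed (use \<kappa>_nonneg \<kappa>_summable that in auto)
  then have "expectation (y t) \<le> 16 * (exp (\<Sum>t. 16 * \<kappa> t) * v T)
      \<and> expectation (V t) \<le> 16 * (exp (\<Sum>t. 16 * \<kappa> t) * v T)" if "t \<ge> T" for t
    using that Ey[OF that] y0[of t] unfolding v_def by (smt (verit))
  moreover have "16 * (exp (\<Sum>t. 16 * \<kappa> t) * v T) \<ge> 0"
    using Ey[of T] y0[of T] by simp
  ultimately show ?thesis by blast
qed

text \<open>If the second moments stayed above \<epsilon>, the negative drift would be at least c *
  \<epsilon> * \<alpha> t. Summation telescopes E V, which is eventually bounded on both sides, and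
  \<alpha> would be summable.\<close>

lemma second_moment_frequently_small:
  assumes "\<epsilon> > 0"
  shows "\<exists>t\<ge>N. expectation (\<lambda>\<omega>. (x t \<omega>)\<^sup>2) < \<epsilon>"
proof (rule ccontr)
  assume "\<not> ?thesis"
  then have big: "\<And>t. t \<ge> N \<Longrightarrow> expectation (\<lambda>\<omega>. (x t \<omega>)\<^sup>2) \<ge> \<epsilon>" by force
  obtain K T where K: "K \<ge> 0" "\<And>t. t \<ge> T \<Longrightarrow> expectation (y t) \<le> K"
    "\<And>t. t \<ge> T \<Longrightarrow> expectation (V t) \<le> K"
    using bounded_second_moment by blast
  obtain T1 where T1: "\<And>t. t \<ge> T1 \<Longrightarrow> a t \<le> 1/2 \<and> b t \<le> 1/2" using small_eventually[of "1/2"] by auto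
  define T2 where "T2 = max N (max T T1)"
  have T2: "T2 \<ge> N" "T2 \<ge> T" "T2 \<ge> T1" by (auto simp: T2_def)
  have lower: "expectation (V t) \<ge> -1" if "t \<ge> T2" for t
  proof -
    have "(\<integral>\<omega>. -1 \<partial>M) \<le> expectation (V t)"
    proof (intro integral_mono V_integrable)
      fix \<omega> assume "\<omega> \<in> space M"
      then show "-1 \<le> V t \<omega>" using V_lower[of \<omega> t] T1[of t] that T2(3) zero_le_power2[of "x (t + n) \<omega>"]
        by (smt (verit) field_sum_of_halves le_trans zero_le_power2)
    qed simp
    then show ?thesis by (simp add: prob_space)
  qed
  have step: "c * \<epsilon> * \<alpha> t \<le> expectation (V t) - expectation (V (Suc t)) + K * \<kappa> t" if "t \<ge> T2" for t
  proof -
    have "c * \<alpha> t * \<epsilon> \<le> c * \<alpha> t * expectation (\<lambda>\<omega>. (x t \<omega>)\<^sup>2)"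
      using that T2 big c_pos \<alpha>_nonneg by (intro mult_left_mono) auto
    moreover have "\<kappa> t * expectation (y t) \<le> \<kappa> t * K"
      using that T2 K \<kappa>_nonneg by (intro mult_left_mono) auto
    ultimately show ?thesis using expectation_step[of t] by (simp add: mult_ac)
  qed
  have "summable (\<lambda>t. c * \<epsilon> * \<alpha> (t + T2))"
  proof (rule summableI_nonneg_bounded)
    show "0 \<le> c * \<epsilon> * \<alpha> (t + T2)" for t using c_pos assms \<alpha>_nonneg by simp
    fix m
    have "(\<Sum>t<m. c * \<epsilon> * \<alpha> (t + T2))
        \<le> (\<Sum>t<m. expectation (V (t + T2)) - expectation (V (Suc t + T2)) + K * \<kappa> (t + T2))"
      by (intro sum_mono) (use step in auto)
    also have "\<dots> = expectation (V T2) - expectation (V (m + T2)) + K * (\<Sum>t<m. \<kappa> (t + T2))"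
      using sum_lessThan_telescope'[of "\<lambda>t. expectation (V (t + T2))" m]
      by (simp add: sum.distrib sum_distrib_left)
    also have "\<dots> \<le> K - (-1) + K * (\<Sum>t. \<kappa> (t + T2))"
      using K T2 lower \<kappa>_nonneg \<kappa>_summable
      by (intro add_mono diff_mono mult_left_mono sum_le_suminf) (auto simp: summable_iff_shift)
    finally show "(\<Sum>t<m. c * \<epsilon> * \<alpha> (t + T2)) \<le> K + 1 + K * (\<Sum>t. \<kappa> (t + T2))" by simp
  qed
  then have "summable (\<lambda>t. \<alpha> (t + T2))" using c_pos assms by (simp add: summable_cmult_iff)
  then show False using \<alpha>_diverges by (simp add: summable_iff_shift)
qed

text \<open>Ville's inequality for the process stopped when \<open>x\<close> first reaches \<open>\<theta>\<close> after \<open>t0\<close>; the second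
  moment bound \<open>K\<close> makes the multiplicative perturbation additive.\<close>

lemma maximal_inequality:
  assumes \<theta>: "\<theta> > 0" and K: "\<And>t. t \<ge> t0 \<Longrightarrow> expectation (y t) \<le> K"
    and \<epsilon>: "\<And>t. t \<ge> t0 \<Longrightarrow> b t \<le> \<epsilon>" "\<epsilon> \<le> 1/2"
    and a: "\<And>t. t \<ge> t0 \<Longrightarrow> a t \<le> min (1/4) (\<theta>/4)" and T: "T \<ge> t0"
  shows "\<theta>\<^sup>2 / 8 * prob {\<omega>\<in>space M. \<exists>s\<in>{t0<..T}. x s \<omega> \<ge> \<theta>}
    \<le> expectation (V t0) + \<epsilon> + K * (\<Sum>t. \<kappa> (t + t0))"
proof -
  \<comment> \<open>Indicator of the paths not yet stopped. The interval excludes t0, so that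
    \<open>g t0\<close> is 1.\<close>
  define g where "g t \<omega> = (of_bool (\<forall>s\<in>{t0<..t}. x s \<omega> < \<theta>) :: real)" for t \<omega>
  have g_meas [measurable]: "g t \<in> borel_measurable M" for t unfolding g_def by measurable
  have g01: "0 \<le> g t \<omega>" "g t \<omega> \<le> 1" for t \<omega> by (auto simp: g_def)
  have int_g: "integrable M (\<lambda>\<omega>. g t \<omega> * f \<omega>)" if "integrable M f" for t f
    by (rule Bochner_Integration.integrable_bound[OF that])
      (use that g01 in \<open>auto simp: abs_mult mult_left_le_one_le\<close>)
  have int_g1: "integrable M (g t)" for t using int_g[of "\<lambda>_. 1"] by simp
  have V_pos: "V t \<omega> + \<epsilon> \<ge> (x (t + n) \<omega>)\<^sup>2 / 2" if "\<omega> \<in> space M" "t \<ge> t0" for t \<omega>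
    using V_lower[of \<omega> t] \<epsilon>(1)[OF that(2)] \<epsilon>(2) that by linarith
  \<comment> \<open>V at the hitting time sees x only n steps later. The bound on a lets x lose at
    most x / 4 + \<theta> / 4 meanwhile, so the later value is still at least \<theta> / 2; half its
    square gives \<theta>^2 / 8.\<close>
  have V_hit: "V t \<omega> + \<epsilon> \<ge> \<theta>\<^sup>2 / 8" if "\<omega> \<in> space M" "t \<ge> t0" "x t \<omega> \<ge> \<theta>" for t \<omega>
  proof -
    have "a t * (1 + x t \<omega>) = a t + a t * x t \<omega>" by (simp add: distrib_left)
    also have "\<dots> \<le> \<theta> / 4 + 1/4 * x t \<omega>"
      using a[OF that(2)] x_nonneg[OF that(1)] by (intro add_mono mult_right_mono) auto
    finally have "\<theta> / 2 \<le> x (t + n) \<omega>"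
      using x_increment[OF that(1), of t] that(3) by (simp add: abs_le_iff)
    then have "(\<theta> / 2)\<^sup>2 \<le> (x (t + n) \<omega>)\<^sup>2" using \<theta> by (intro power_mono) auto
    then show ?thesis using V_pos[OF that(1,2)] by (simp add: power_divide)
  qed
  \<comment> \<open>Stopped paths are credited with the fixed value \<theta>^2 / 8 and running paths
    with V + \<epsilon>, which is nonnegative. \<open>1 - expectation (g T)\<close> is the
    probability of having been stopped.\<close>
  have main: "expectation (\<lambda>\<omega>. g T \<omega> * (V T \<omega> + \<epsilon>)) + \<theta>\<^sup>2 / 8 * (1 - expectation (g T))
      \<le> expectation (V t0) + \<epsilon> + K * (\<Sum>t\<in>{t0..<T}. \<kappa> t)"
    using T
  proof (induction T rule: dec_induct)
    case base
    have "g t0 = (\<lambda>_. 1)" by (auto simp: g_def)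
    then show ?case using V_integrable by (simp add: prob_space)
  next
    case (step T)
    have pw: "g (Suc T) \<omega> * (V (Suc T) \<omega> + \<epsilon>) + \<theta>\<^sup>2 / 8 * (g T \<omega> - g (Suc T) \<omega>)
        \<le> g T \<omega> * (V T \<omega> + \<epsilon>) + g T \<omega> * (V (Suc T) \<omega> - V T \<omega>)" if "\<omega> \<in> space M" for \<omega>
    proof (cases "x (Suc T) \<omega> < \<theta>")
      case True
      have "{t0<..Suc T} = insert (Suc T) {t0<..T}" using step by auto
      then have "g (Suc T) \<omega> = g T \<omega>" using True by (auto simp: g_def)
      then show ?thesis by (simp add: algebra_simps)
    next
      case False
      have "Suc T \<in> {t0<..Suc T}" using step by auto
      then have "g (Suc T) \<omega> = 0" using False by (auto simp: g_def)
      moreover have "g T \<omega> * (\<theta>\<^sup>2 / 8) \<le> g T \<omega> * (V (Suc T) \<omega> + \<epsilon>)"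
        using V_hit[OF that, of "Suc T"] step False g01 by (intro mult_left_mono) auto
      ultimately show ?thesis by (simp add: algebra_simps)
    qed
    have "expectation (\<lambda>\<omega>. g T \<omega> * (V (Suc T) \<omega> - V T \<omega>))
        \<le> expectation (\<lambda>\<omega>. g T \<omega> * (\<kappa> T * (1 + (x T \<omega>)\<^sup>2) - c * \<alpha> T * (x T \<omega>)\<^sup>2))"
      unfolding g_def by (rule drift) auto
    also have "\<dots> \<le> expectation (\<lambda>\<omega>. \<kappa> T * y T \<omega>)"
    proof (intro integral_mono int_g)
      fix \<omega>
      have "g T \<omega> * (\<kappa> T * (1 + (x T \<omega>)\<^sup>2) - c * \<alpha> T * (x T \<omega>)\<^sup>2) \<le> g T \<omega> * (\<kappa> T * y T \<omega>)"
        using g01 c_pos \<alpha>_nonneg by (intro mult_left_mono) (auto simp: y_def)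
      also have "\<dots> \<le> \<kappa> T * y T \<omega>"
        using g01 \<kappa>_nonneg by (intro mult_left_le_one_le) (auto simp: y_def)
      finally show "g T \<omega> * (\<kappa> T * (1 + (x T \<omega>)\<^sup>2) - c * \<alpha> T * (x T \<omega>)\<^sup>2) \<le> \<kappa> T * y T \<omega>" .
    qed (use x_sq_integrable y_integrable in auto)
    also have "\<dots> \<le> \<kappa> T * K" using K[of T] step \<kappa>_nonneg by (simp add: mult_left_mono)
    finally have dr: "expectation (\<lambda>\<omega>. g T \<omega> * (V (Suc T) \<omega> - V T \<omega>)) \<le> \<kappa> T * K" .
    have "expectation (\<lambda>\<omega>. g (Suc T) \<omega> * (V (Suc T) \<omega> + \<epsilon>) + \<theta>\<^sup>2 / 8 * (g T \<omega> - g (Suc T) \<omega>))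
        \<le> expectation (\<lambda>\<omega>. g T \<omega> * (V T \<omega> + \<epsilon>) + g T \<omega> * (V (Suc T) \<omega> - V T \<omega>))"
      by (intro integral_mono pw Bochner_Integration.integrable_add integrable_mult_right
          Bochner_Integration.integrable_diff int_g int_g1 V_integrable) auto
    then have "expectation (\<lambda>\<omega>. g (Suc T) \<omega> * (V (Suc T) \<omega> + \<epsilon>))
          + \<theta>\<^sup>2 / 8 * (expectation (g T) - expectation (g (Suc T)))
        \<le> expectation (\<lambda>\<omega>. g T \<omega> * (V T \<omega> + \<epsilon>)) + \<kappa> T * K"
      using dr by (simp add: int_g int_g1 V_integrable)
    moreover have "\<theta>\<^sup>2 / 8 * (1 - expectation (g (Suc T)))
        = \<theta>\<^sup>2 / 8 * (1 - expectation (g T)) + \<theta>\<^sup>2 / 8 * (expectation (g T) - expectation (g (Suc T)))"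
      by (simp flip: distrib_left)
    moreover have "K * (\<Sum>t\<in>{t0..<Suc T}. \<kappa> t) = K * (\<Sum>t\<in>{t0..<T}. \<kappa> t) + \<kappa> T * K"
      using step(1) by (simp add: distrib_left)
    ultimately show ?case using step(3) by linarith
  qed
  have "prob {\<omega>\<in>space M. \<exists>s\<in>{t0<..T}. x s \<omega> \<ge> \<theta>} = expectation (\<lambda>\<omega>. 1 - g T \<omega>)"
  proof -
    have "expectation (\<lambda>\<omega>. 1 - g T \<omega>)
        = expectation (indicator {\<omega>\<in>space M. \<exists>s\<in>{t0<..T}. x s \<omega> \<ge> \<theta>})"
      by (intro Bochner_Integration.integral_cong) (auto simp: g_def indicator_def not_less)
    then show ?thesis by simp
  qed
  also have "\<dots> = 1 - expectation (g T)" by (simp add: int_g1 prob_space)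
  finally have pr: "prob {\<omega>\<in>space M. \<exists>s\<in>{t0<..T}. x s \<omega> \<ge> \<theta>} = 1 - expectation (g T)" .
  have "0 \<le> expectation (\<lambda>\<omega>. g T \<omega> * (V T \<omega> + \<epsilon>))"
  proof (intro integral_nonneg_AE AE_I2 mult_nonneg_nonneg g01)
    fix \<omega> assume "\<omega> \<in> space M"
    then show "0 \<le> V T \<omega> + \<epsilon>" using V_pos[of \<omega> T] T zero_le_power2[of "x (T + n) \<omega>"] by linarith
  qed
  moreover have "K * (\<Sum>t\<in>{t0..<T}. \<kappa> t) \<le> K * (\<Sum>t. \<kappa> (t + t0))"
  proof (rule mult_left_mono)
    have "(\<Sum>t\<in>{t0..<T}. \<kappa> t) = (\<Sum>t<T - t0. \<kappa> (t + t0))"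
      using T by (intro sum.reindex_bij_witness[of _ "\<lambda>i. i + t0" "\<lambda>i. i - t0"]) auto
    also have "\<dots> \<le> (\<Sum>t. \<kappa> (t + t0))"
      using \<kappa>_nonneg \<kappa>_summable by (intro sum_le_suminf) (auto simp: summable_iff_shift)
    finally show "(\<Sum>t\<in>{t0..<T}. \<kappa> t) \<le> (\<Sum>t. \<kappa> (t + t0))" .
    have "0 \<le> expectation (y t0)" by (rule integral_nonneg_AE) (auto simp: y_def)
    then show "0 \<le> K" using K[of t0] by simp
  qed
  ultimately show ?thesis using main by (simp add: pr)
qed

text \<open>The maximal inequality starts from E V, whereas
  \<open>second_moment_frequently_small\<close> speaks of x t. The two differ by the delay and the
  corrector, at a cost of a multiple of \<delta> times the second moment, hence of \<delta> *
  K.\<close>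

lemma expectation_V_frequently_small:
  assumes "\<epsilon> > 0"
  shows "\<exists>t\<ge>N. expectation (V t) < \<epsilon>"
proof -
  obtain K T where K: "K \<ge> 0" "\<And>t. t \<ge> T \<Longrightarrow> expectation (y t) \<le> K"
    using bounded_second_moment by blast
  \<comment> \<open>Chosen so that 16 * \<delta> * K < \<epsilon>. The final bound \<epsilon> / 4 +
    11 * \<delta> * K is then below \<epsilon>.\<close>
  define \<delta> where "\<delta> = min 1 (\<epsilon> / (16 * (K + 1)))"
  have \<delta>: "\<delta> > 0" "\<delta> \<le> 1" using K assms by (auto simp: \<delta>_def)
  have "\<delta> * (16 * (K + 1)) \<le> \<epsilon> / (16 * (K + 1)) * (16 * (K + 1))"
    using K by (intro mult_right_mono) (auto simp: \<delta>_def)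
  also have "\<dots> = \<epsilon>" using K by simp
  finally have "\<delta> * (16 * (K + 1)) \<le> \<epsilon>" .
  then have \<delta>K: "16 * (\<delta> * K) < \<epsilon>" using \<delta> by (simp add: algebra_simps)
  obtain T1 where T1: "\<And>t. t \<ge> T1 \<Longrightarrow> a t \<le> \<delta> \<and> b t \<le> \<delta>" using small_eventually[OF \<delta>(1)] by auto
  define \<epsilon>' where "\<epsilon>' = (\<epsilon> - 16 * (\<delta> * K)) / 16"
  obtain t where t: "t \<ge> max N (max T T1)" "expectation (\<lambda>\<omega>. (x t \<omega>)\<^sup>2) < \<epsilon>'"
    using second_moment_frequently_small[of \<epsilon>' "max N (max T T1)"] \<delta>K by (auto simp: \<epsilon>'_def)
  have ab: "a t \<le> \<delta>" "b t \<le> \<delta>" using T1 t by auto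
  have V_up: "V t \<omega> \<le> 4 * (x t \<omega>)\<^sup>2 + 15 * \<delta> * y t \<omega>" if "\<omega> \<in> space M" for \<omega>
  proof -
    let ?x = "x t \<omega>" and ?z = "x (t + n) \<omega>"
    have z: "?z \<le> ?x + \<delta> * (1 + ?x)" "0 \<le> ?z" "0 \<le> ?x"
      using x_increment[OF that, of t] ab mult_right_mono[OF ab(1), of "1 + ?x"] x_nonneg[OF that]
      by (auto simp: abs_le_iff)
    have "?z\<^sup>2 \<le> (?x + \<delta> * (1 + ?x))\<^sup>2" using z by (intro power_mono)
    also have "\<dots> \<le> 2 * ?x\<^sup>2 + 2 * (\<delta> * (1 + ?x))\<^sup>2"
      using zero_le_power2[of "?x - \<delta> * (1 + ?x)"] by (simp add: power2_diff power2_sum)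
    also have "(\<delta> * (1 + ?x))\<^sup>2 \<le> \<delta> * (2 * y t \<omega>)"
    proof -
      have "(1 + ?x)\<^sup>2 \<le> 2 * y t \<omega>" unfolding y_def
        using zero_le_power2[of "1 - ?x"] by (simp add: power2_diff power2_sum)
      moreover have "\<delta>\<^sup>2 \<le> \<delta>" using \<delta> by (simp add: power2_eq_square mult_left_le)
      ultimately show ?thesis unfolding power_mult_distrib using \<delta> by (intro mult_mono) auto
    qed
    finally have z2: "?z\<^sup>2 \<le> 2 * ?x\<^sup>2 + 4 * \<delta> * y t \<omega>" by (simp add: mult_ac)
    have y0: "0 \<le> \<delta> * y t \<omega>" using \<delta> by (simp add: y_def)
    have "V t \<omega> \<le> ?z\<^sup>2 + b t * (1 + ?z\<^sup>2)" using V_close[OF that, of t] by linarith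
    also have "\<dots> \<le> ?z\<^sup>2 + \<delta> * (1 + ?z\<^sup>2)" using ab by (intro add_left_mono mult_right_mono) auto
    also have "\<dots> \<le> 2 * ?z\<^sup>2 + \<delta>" using \<delta> mult_left_le_one_le[of "?z\<^sup>2" \<delta>] by (simp add: distrib_left)
    also have "\<dots> \<le> 4 * ?x\<^sup>2 + 8 * (\<delta> * y t \<omega>) + \<delta>" using z2 by simp
    finally have "V t \<omega> \<le> 4 * ?x\<^sup>2 + 8 * (\<delta> * y t \<omega>) + \<delta>" .
    moreover have "\<delta> \<le> \<delta> * y t \<omega>" using \<delta> by (simp add: y_def)
    ultimately show ?thesis using y0 by simp
  qed
  have "expectation (V t) \<le> (\<integral>\<omega>. 4 * (x t \<omega>)\<^sup>2 + 15 * \<delta> * y t \<omega> \<partial>M)"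
    by (intro integral_mono V_up) (auto simp: V_integrable y_integrable x_sq_integrable)
  also have "\<dots> = 4 * expectation (\<lambda>\<omega>. (x t \<omega>)\<^sup>2) + 15 * \<delta> * expectation (y t)"
    by (simp add: y_integrable x_sq_integrable)
  also have "\<dots> \<le> 4 * \<epsilon>' + 15 * \<delta> * K"
    using t K \<delta> by (intro add_mono mult_left_mono) auto
  also have "\<dots> = \<epsilon> / 4 + 11 * (\<delta> * K)" by (simp add: \<epsilon>'_def field_simps)
  also have "\<dots> < \<epsilon>" using \<delta>K assms by linarith
  finally show ?thesis using t by auto
qed

text \<open>For a fixed level \<theta> the maximal inequality bounds the chance of reaching \<theta>
  after t0 by a multiple of \<epsilon>, if t0 is late enough for the perturbations to be small and
  is one of the times at which E V is small.\<close>

lemma eventually_below: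
  assumes \<theta>: "\<theta> > 0"
  shows "AE \<omega> in M. \<exists>t0. \<forall>s>t0. x s \<omega> < \<theta>"
proof -
  define B where "B t0 = {\<omega>\<in>space M. \<exists>s>t0. x s \<omega> \<ge> \<theta>}" for t0
  have B_sets [measurable]: "B t0 \<in> sets M" for t0 unfolding B_def by measurable
  \<comment> \<open>Paths reaching \<theta> at arbitrarily late times. This set involves neither a
    particular starting time nor \<epsilon>, so a bound for every small \<epsilon> makes it
    null.\<close>
  define N where "N = (\<Inter>t0. B t0)"
  have N_sets: "N \<in> sets M" unfolding N_def by measurable
  obtain K T where K: "K \<ge> 0" "\<And>t. t \<ge> T \<Longrightarrow> expectation (y t) \<le> K"
    using bounded_second_moment by blast
  have small: "prob N \<le> 8 / \<theta>\<^sup>2 * (2 * \<epsilon> + K * \<epsilon>)" if \<epsilon>: "\<epsilon> > 0" "\<epsilon> \<le> 1/4" "\<epsilon> \<le> \<theta> / 4" for \<epsilon>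
  proof -
    obtain T1 where T1: "\<And>t. t \<ge> T1 \<Longrightarrow> a t \<le> \<epsilon> \<and> b t \<le> \<epsilon>" using small_eventually[OF \<epsilon>(1)] by auto
    obtain T2 where T2: "\<And>t. t \<ge> T2 \<Longrightarrow> (\<Sum>i. \<kappa> (i + t)) \<le> \<epsilon>"
      using suminf_exist_split[OF \<epsilon>(1) \<kappa>_summable] by (force simp: abs_less_iff)
    obtain t0 where t0: "t0 \<ge> max T (max T1 T2)" "expectation (V t0) < \<epsilon>"
      using expectation_V_frequently_small[OF \<epsilon>(1)] by blast
    \<comment> \<open>The maximal inequality has a finite horizon; these events increase with it, so
      the bound passes to their union.\<close>
    define C where "C m = {\<omega>\<in>space M. \<exists>s\<in>{t0<..m + t0}. x s \<omega> \<ge> \<theta>}" for m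
    have C_sets [measurable]: "C m \<in> sets M" for m unfolding C_def by measurable
    have "prob (C m) \<le> 8 / \<theta>\<^sup>2 * (2 * \<epsilon> + K * \<epsilon>)" for m
    proof -
      have "\<theta>\<^sup>2 / 8 * prob (C m) \<le> expectation (V t0) + \<epsilon> + K * (\<Sum>t. \<kappa> (t + t0))"
        unfolding C_def
      proof (rule maximal_inequality[OF \<theta>])
        fix t assume t: "t \<ge> t0"
        show "expectation (y t) \<le> K" "b t \<le> \<epsilon>" "a t \<le> min (1/4) (\<theta>/4)"
          using K T1[of t] t t0 \<epsilon> by auto
      qed (use \<epsilon> in auto)
      also have "\<dots> \<le> \<epsilon> + \<epsilon> + K * \<epsilon>" using t0 T2 K(1) by (intro add_mono mult_left_mono) auto
      finally show ?thesis using \<theta> by (simp add: field_simps)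
    qed
    moreover have "(\<lambda>m. prob (C m)) \<longlonglongrightarrow> prob (\<Union>m. C m)"
      by (intro finite_Lim_measure_incseq) (force simp: incseq_def C_def)+
    ultimately have "prob (\<Union>m. C m) \<le> 8 / \<theta>\<^sup>2 * (2 * \<epsilon> + K * \<epsilon>)"
      by (intro LIMSEQ_le_const2) auto
    moreover have "N \<subseteq> (\<Union>m. C m)"
    proof
      fix \<omega> assume "\<omega> \<in> N"
      then have "\<omega> \<in> B t0" by (simp add: N_def)
      then obtain s where "\<omega> \<in> space M" "s > t0" "x s \<omega> \<ge> \<theta>" by (auto simp: B_def)
      then have "\<omega> \<in> C s" by (auto simp: C_def intro!: bexI[of _ s])
      then show "\<omega> \<in> (\<Union>m. C m)" by blast
    qed
    ultimately show ?thesis using finite_measure_mono[of N "\<Union>m. C m"] by (simp add: order.trans)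
  qed
  have "prob N \<le> 0"
  proof (rule field_le_epsilon)
    fix \<epsilon> :: real assume "\<epsilon> > 0"
    \<comment> \<open>The last term solves 8 / \<theta>^2 * (2 + K) * \<epsilon>' = \<epsilon>; the
      others meet the size conditions of \<open>small\<close>.\<close>
    define \<epsilon>' where "\<epsilon>' = min (min (1/4) (\<theta>/4)) (\<epsilon> * \<theta>\<^sup>2 / (8 * (2 + K)))"
    have "\<epsilon>' > 0" using \<open>\<epsilon> > 0\<close> \<theta> K by (simp add: \<epsilon>'_def)
    moreover have "\<epsilon>' \<le> min (1/4) (\<theta>/4)" unfolding \<epsilon>'_def by (rule min.cobounded1)
    ultimately have "prob N \<le> 8 / \<theta>\<^sup>2 * (2 * \<epsilon>' + K * \<epsilon>')" by (intro small) auto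
    also have "\<dots> = 8 / \<theta>\<^sup>2 * (2 + K) * \<epsilon>'" by (simp add: algebra_simps)
    also have "\<dots> \<le> 8 / \<theta>\<^sup>2 * (2 + K) * (\<epsilon> * \<theta>\<^sup>2 / (8 * (2 + K)))"
      using K by (intro mult_left_mono) (auto simp: \<epsilon>'_def)
    also have "\<dots> = \<epsilon>"
    proof -
      have *: "8 / \<theta>\<^sup>2 * q * (\<epsilon> * \<theta>\<^sup>2 / (8 * q)) = \<epsilon>" if "q \<noteq> 0" for q
        using that \<theta> by simp
      show ?thesis by (rule *) (use K in simp)
    qed
    finally show "prob N \<le> 0 + \<epsilon>" by simp
  qed
  then have "prob N = 0" using measure_nonneg[of M N] by linarith
  then have "N \<in> null_sets M" using N_sets by (simp add: null_sets_def emeasure_eq_measure)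
  then show ?thesis
    by (rule AE_I'[rotated, rotated]) (auto simp: N_def B_def not_less)
qed

text \<open>The countably many levels 1 / (m + 1) suffice, which keeps the exceptional set
  null.\<close>

theorem x_tendsto_zero: "AE \<omega> in M. (\<lambda>t. x t \<omega>) \<longlonglongrightarrow> 0"
proof -
  have "AE \<omega> in M. \<forall>m. \<exists>t0. \<forall>s>t0. x s \<omega> < inverse (real (Suc m))"
    by (simp add: AE_all_countable eventually_below)
  then show ?thesis
  proof (rule AE_mp, intro AE_I2 impI)
    fix \<omega> assume \<omega>: "\<omega> \<in> space M" and *: "\<forall>m. \<exists>t0. \<forall>s>t0. x s \<omega> < inverse (real (Suc m))"
    show "(\<lambda>t. x t \<omega>) \<longlonglongrightarrow> 0"
    proof (rule LIMSEQ_I)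
      fix e :: real assume "e > 0"
      then obtain m where m: "inverse (real (Suc m)) < e" using reals_Archimedean by blast
      obtain t0 where "\<forall>s>t0. x s \<omega> < inverse (real (Suc m))" using * by blast
      then have "norm (x s \<omega> - 0) < e" if "s \<ge> Suc t0" for s
        using m x_nonneg[OF \<omega>, of s] that by (auto simp: Suc_le_eq intro: less_trans)
      then show "\<exists>no. \<forall>s\<ge>no. norm (x s \<omega> - 0) < e" by blast
    qed
  qed
qed

end

section \<open>Finite histories of the decision process\<close>

lemma trans_mat_component: "trans_mat P \<pi> $ s $ s' = (\<Sum>a\<in>UNIV. pmf (\<pi> s) a * pmf (P s a) s')"
  by (simp add: trans_mat_def)

lemma mult_diag_component: "(A ** diag_mat g) $ i $ j = A $ i $ j * g j"
  for A :: "real ^ 'n::finite ^ 'n"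
  by (simp add: matrix_mult_component diag_mat_def if_distrib cong: if_cong)

lemma diag_mat_vec: "(diag_mat g *v x) $ i = g i * x $ i" for x :: "real ^ 'n::finite"
  by (simp add: matrix_vector_mult_def diag_mat_def if_distrib[of "\<lambda>y. y * _"] cong: if_cong)

lemma stochastic_trans_mat: "stochastic (trans_mat P \<pi>)"
proof -
  have "(\<Sum>s'\<in>UNIV. trans_mat P \<pi> $ s $ s') = 1" for s
    unfolding trans_mat_component by (subst sum.swap) (simp add: sum_pmf_UNIV flip: sum_distrib_left)
  then show ?thesis unfolding stochastic_def trans_mat_component
    by (auto intro!: sum_nonneg simp: trans_mat_component)
qed

lemma substochastic_discounted:
  assumes "\<And>s. 0 \<le> \<gamma> s \<and> \<gamma> s \<le> 1"
  shows "substochastic (trans_mat P \<pi> ** diag_mat \<gamma>)"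
proof -
  have st: "trans_mat P \<pi> $ i $ j \<ge> 0" "(\<Sum>j\<in>UNIV. trans_mat P \<pi> $ i $ j) = 1" for i j
    using stochastic_trans_mat[of P \<pi>] by (auto simp: stochastic_def)
  have "(\<Sum>j\<in>UNIV. trans_mat P \<pi> $ i $ j * \<gamma> j) \<le> (\<Sum>j\<in>UNIV. trans_mat P \<pi> $ i $ j)" for i
    using assms st by (intro sum_mono mult_left_le) auto
  then show ?thesis using assms st by (auto simp: substochastic_def mult_diag_component)
qed

locale mdp_process =
  fixes P :: "'s::finite \<Rightarrow> 'a::finite \<Rightarrow> 's pmf" and \<mu> :: "'s \<Rightarrow> 'a pmf"
    and M :: "'w measure" and S :: "nat \<Rightarrow> 'w \<Rightarrow> 's" and A :: "nat \<Rightarrow> 'w \<Rightarrow> 'a"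
  assumes trajectory: "mdp_trajectory P \<mu> M S A"
begin

sublocale prob_space M
  using trajectory unfolding mdp_trajectory_def by (elim conjE) assumption

lemma S_measurable [measurable]: "S t \<in> measurable M (count_space UNIV)"
  by (rule trajectory[unfolded mdp_trajectory_def, THEN conjunct2, THEN conjunct1, THEN spec])

lemma A_measurable [measurable]: "A t \<in> measurable M (count_space UNIV)"
  by (rule trajectory[unfolded mdp_trajectory_def, THEN conjunct2, THEN conjunct2, THEN conjunct1, THEN spec])

text \<open>What is known just before the action at time t is drawn. \<open>restrict\<close> fixes
  the values outside the index range, so only finitely many histories occur.\<close>

definition past :: "nat \<Rightarrow> 'w \<Rightarrow> (nat \<Rightarrow> 's) \<times> (nat \<Rightarrow> 'a)" where
  "past t \<omega> = (restrict (\<lambda>i. S i \<omega>) {..t}, restrict (\<lambda>i. A i \<omega>) {..<t})"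

text \<open>Stands in for measurability with respect to the finite algebra generated by
  \<open>past t\<close>. It makes sense for any codomain and is closed under arbitrary composition,
  so the maps applied to a history need no measurability argument of their own.\<close>

definition determined :: "nat \<Rightarrow> ('w \<Rightarrow> 'b) \<Rightarrow> bool" where
  "determined t g \<longleftrightarrow>
    (\<forall>\<omega>\<in>space M. \<forall>\<omega>'\<in>space M. past t \<omega> = past t \<omega>' \<longrightarrow> g \<omega> = g \<omega>')"

lemma past_eq_iff:
  "past t \<omega> = past t \<omega>' \<longleftrightarrow> (\<forall>i\<le>t. S i \<omega> = S i \<omega>') \<and> (\<forall>i<t. A i \<omega> = A i \<omega>')"
  by (auto simp: past_def restrict_def fun_eq_iff)

lemma determinedI:
  "(\<And>\<omega> \<omega>'. \<omega> \<in> space M \<Longrightarrow> \<omega>' \<in> space M \<Longrightarrow> past t \<omega> = past t \<omega>' \<Longrightarrow> g \<omega> = g \<omega>') \<Longrightarrow> determined t g"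
  unfolding determined_def by blast

lemma determinedD:
  "determined t g \<Longrightarrow> \<omega> \<in> space M \<Longrightarrow> \<omega>' \<in> space M \<Longrightarrow> past t \<omega> = past t \<omega>' \<Longrightarrow> g \<omega> = g \<omega>'"
  unfolding determined_def by blast

lemma determined_mono:
  assumes "determined t g" "t \<le> t'"
  shows "determined t' g"
proof (rule determinedI)
  fix \<omega> \<omega>' assume *: "\<omega> \<in> space M" "\<omega>' \<in> space M" "past t' \<omega> = past t' \<omega>'"
  then have "past t \<omega> = past t \<omega>'" using assms(2) by (auto simp: past_eq_iff)
  then show "g \<omega> = g \<omega>'" using determinedD[OF assms(1) *(1,2)] by simp
qed

lemma determined_const: "determined t (\<lambda>_. c)"
  by (simp add: determined_def)

lemma determined_S: "i \<le> t \<Longrightarrow> determined t (S i)"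
  by (rule determinedI) (simp add: past_eq_iff)

lemma determined_A: "i < t \<Longrightarrow> determined t (A i)"
  by (rule determinedI) (simp add: past_eq_iff)

lemma determined_compose:
  assumes "determined t g"
  shows "determined t (\<lambda>\<omega>. F (g \<omega>))"
  by (rule determinedI) (rule arg_cong[of _ _ F], rule determinedD[OF assms])

lemma determined_Pair:
  assumes "determined t g" "determined t h"
  shows "determined t (\<lambda>\<omega>. (g \<omega>, h \<omega>))"
  by (rule determinedI) (rule arg_cong2[of _ _ _ _ Pair], rule determinedD[OF assms(1)],
    assumption+, rule determinedD[OF assms(2)])

lemma determined_compose2:
  assumes "determined t g" "determined t h"
  shows "determined t (\<lambda>\<omega>. F (g \<omega>) (h \<omega>))"
  using determined_compose[OF determined_Pair[OF assms], of "\<lambda>(x, y). F x y"] by simp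

lemma determined_compose3:
  assumes "determined t g" "determined t h" "determined t k"
  shows "determined t (\<lambda>\<omega>. F (g \<omega>) (h \<omega>) (k \<omega>))"
  using determined_compose2[OF determined_Pair[OF assms(1,2)] assms(3), of "\<lambda>(x, y). F x y"] by simp

lemma determined_sum:
  assumes "\<And>i. i \<in> I \<Longrightarrow> determined t (g i)"
  shows "determined t (\<lambda>\<omega>. \<Sum>i\<in>I. g i \<omega>)"
  by (rule determinedI) (rule sum.cong[OF refl], rule determinedD[OF assms])

lemma determined_prod:
  assumes "\<And>i. i \<in> I \<Longrightarrow> determined t (g i)"
  shows "determined t (\<lambda>\<omega>. \<Prod>i\<in>I. g i \<omega>)"
  by (rule determinedI) (rule prod.cong[OF refl], rule determinedD[OF assms])

lemma determined_Ball:
  assumes "\<And>i. i \<in> I \<Longrightarrow> determined t (g i)"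
  shows "determined t (\<lambda>\<omega>. \<forall>i\<in>I. g i \<omega>)"
  by (rule determinedI) (rule ball_cong[OF refl], rule determinedD[OF assms])

lemma finite_past: "finite (past t ` space M)"
proof (rule finite_subset)
  show "past t ` space M \<subseteq> (PiE {..t} (\<lambda>_. UNIV)) \<times> (PiE {..<t} (\<lambda>_. UNIV))"
    by (auto simp: past_def split: if_splits)
qed (intro finite_cartesian_product finite_PiE; simp)

lemma past_event: "past t \<omega> = past t \<omega>0 \<longleftrightarrow>
    (\<forall>i\<in>{..t}. S i \<omega> = S i \<omega>0) \<and> (\<forall>i\<in>{..<t}. A i \<omega> = A i \<omega>0)"
  by (auto simp: past_eq_iff)

lemma past_sets [measurable]: "{\<omega>\<in>space M. past t \<omega> = past t \<omega>0} \<in> sets M"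
  unfolding past_event by measurable

lemma past_in_sets: "h \<in> past t ` space M \<Longrightarrow> {\<omega>\<in>space M. past t \<omega> = h} \<in> sets M"
  using past_sets by auto

text \<open>g factors through the finite-valued map \<open>past t\<close> by picking a
  representative outcome for every history.\<close>

lemma determined_simple:
  assumes "determined t g"
  shows "simple_function M g"
proof -
  define rep where "rep h = (SOME \<omega>. \<omega> \<in> space M \<and> past t \<omega> = h)" for h
  have rep: "rep (past t \<omega>) \<in> space M" "past t (rep (past t \<omega>)) = past t \<omega>" if "\<omega> \<in> space M" for \<omega>
    using someI_ex[of "\<lambda>\<omega>'. \<omega>' \<in> space M \<and> past t \<omega>' = past t \<omega>"] that unfolding rep_def by blast+
  have g: "g \<omega> = g (rep (past t \<omega>))" if "\<omega> \<in> space M" for \<omega>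
    by (rule determinedD[OF assms that rep(1)[OF that] rep(2)[OF that, symmetric]])
  have "simple_function M (past t)"
    unfolding simple_function_def
  proof (intro conjI ballI finite_past)
    fix h assume "h \<in> past t ` space M"
    moreover have "past t -` {h} \<inter> space M = {\<omega>\<in>space M. past t \<omega> = h}" by auto
    ultimately show "past t -` {h} \<inter> space M \<in> sets M" using past_in_sets by simp
  qed
  then have "simple_function M (\<lambda>\<omega>. g (rep (past t \<omega>)))"
    by (rule simple_function_compose1)
  moreover have "simple_function M g \<longleftrightarrow> simple_function M (\<lambda>\<omega>. g (rep (past t \<omega>)))"
    using g by (rule simple_function_cong)
  ultimately show ?thesis by simp
qed

lemma determined_integrable:
  fixes g :: "'w \<Rightarrow> real"
  assumes "determined t g"
  shows "integrable M g"
proof -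
  have sf: "simple_function M g" by (rule determined_simple[OF assms])
  have "finite (g ` space M)" using sf by (simp add: simple_function_def)
  then obtain B where B: "\<And>\<omega>. \<omega> \<in> space M \<Longrightarrow> norm (g \<omega>) \<le> B"
    using finite_imp_bounded bounded_iff by (metis imageI)
  show ?thesis
    by (rule integrable_const_bound[of _ B]) (use sf B in \<open>auto intro: borel_measurable_simple_function\<close>)
qed

section \<open>The one-step law, and conditional expectations as finite sums\<close>

lemma prob_action:
  "prob {\<omega>\<in>space M. (\<forall>i\<le>t. S i \<omega> = fs i) \<and> (\<forall>i\<le>t. A i \<omega> = fa i)}
    = prob {\<omega>\<in>space M. (\<forall>i\<le>t. S i \<omega> = fs i) \<and> (\<forall>i<t. A i \<omega> = fa i)} * pmf (\<mu> (fs t)) (fa t)"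
proof -
  have "\<forall>t s a. prob {\<omega>\<in>space M. (\<forall>i\<le>t. S i \<omega> = s i) \<and> (\<forall>i\<le>t. A i \<omega> = a i)}
    = prob {\<omega>\<in>space M. (\<forall>i\<le>t. S i \<omega> = s i) \<and> (\<forall>i<t. A i \<omega> = a i)} * pmf (\<mu> (s t)) (a t)"
    using trajectory unfolding mdp_trajectory_def by (elim conjE) assumption
  then show ?thesis by (elim allE)
qed

lemma prob_transition:
  "prob {\<omega>\<in>space M. (\<forall>i\<le>Suc t. S i \<omega> = fs i) \<and> (\<forall>i\<le>t. A i \<omega> = fa i)}
    = prob {\<omega>\<in>space M. (\<forall>i\<le>t. S i \<omega> = fs i) \<and> (\<forall>i\<le>t. A i \<omega> = fa i)}
      * pmf (P (fs t) (fa t)) (fs (Suc t))"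
proof -
  have "\<forall>t s a. prob {\<omega>\<in>space M. (\<forall>i\<le>Suc t. S i \<omega> = s i) \<and> (\<forall>i\<le>t. A i \<omega> = a i)}
    = prob {\<omega>\<in>space M. (\<forall>i\<le>t. S i \<omega> = s i) \<and> (\<forall>i\<le>t. A i \<omega> = a i)}
      * pmf (P (s t) (a t)) (s (Suc t))"
    using trajectory unfolding mdp_trajectory_def by (elim conjE) assumption
  then show ?thesis by (elim allE)
qed

lemma prob_past_step:
  assumes "\<omega>0 \<in> space M"
  shows "prob {\<omega>\<in>space M. past t \<omega> = past t \<omega>0 \<and> A t \<omega> = a \<and> S (Suc t) \<omega> = s'}
    = prob {\<omega>\<in>space M. past t \<omega> = past t \<omega>0} * pmf (\<mu> (S t \<omega>0)) a * pmf (P (S t \<omega>0) a) s'"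
proof -
  \<comment> \<open>The trajectory laws are stated for fixed sequences of states and actions. These
    two follow \<omega>0 and are altered only where the new action and state enter.\<close>
  define fs where "fs = (\<lambda>i. S i \<omega>0)(Suc t := s')"
  define fa where "fa = (\<lambda>i. A i \<omega>0)(t := a)"
  have ev: "{\<omega>\<in>space M. past t \<omega> = past t \<omega>0 \<and> A t \<omega> = a \<and> S (Suc t) \<omega> = s'}
      = {\<omega>\<in>space M. (\<forall>i\<le>Suc t. S i \<omega> = fs i) \<and> (\<forall>i\<le>t. A i \<omega> = fa i)}"
  proof -
    have "(\<forall>i\<le>Suc t. S i \<omega> = fs i) \<longleftrightarrow> (\<forall>i\<le>t. S i \<omega> = S i \<omega>0) \<and> S (Suc t) \<omega> = s'" for \<omega>
      by (auto simp: fs_def le_Suc_eq)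
    moreover have "(\<forall>i\<le>t. A i \<omega> = fa i) \<longleftrightarrow> (\<forall>i<t. A i \<omega> = A i \<omega>0) \<and> A t \<omega> = a" for \<omega>
      by (auto simp: fa_def le_less)
    ultimately show ?thesis by (simp only: past_eq_iff conj_ac)
  qed
  have "prob {\<omega>\<in>space M. past t \<omega> = past t \<omega>0 \<and> A t \<omega> = a \<and> S (Suc t) \<omega> = s'}
      = prob {\<omega>\<in>space M. (\<forall>i\<le>t. S i \<omega> = fs i) \<and> (\<forall>i\<le>t. A i \<omega> = fa i)}
        * pmf (P (fs t) (fa t)) (fs (Suc t))"
    unfolding ev by (rule prob_transition)
  also have "prob {\<omega>\<in>space M. (\<forall>i\<le>t. S i \<omega> = fs i) \<and> (\<forall>i\<le>t. A i \<omega> = fa i)}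
      = prob {\<omega>\<in>space M. (\<forall>i\<le>t. S i \<omega> = fs i) \<and> (\<forall>i<t. A i \<omega> = fa i)} * pmf (\<mu> (fs t)) (fa t)"
    by (rule prob_action)
  also have "{\<omega>\<in>space M. (\<forall>i\<le>t. S i \<omega> = fs i) \<and> (\<forall>i<t. A i \<omega> = fa i)}
      = {\<omega>\<in>space M. past t \<omega> = past t \<omega>0}"
    unfolding past_eq_iff fs_def fa_def by auto
  finally show ?thesis by (simp add: fs_def fa_def)
qed

text \<open>The tower property at time t: the inner sum is the conditional mean given the history.
  The space is decomposed into the finitely many history atoms, on which \<open>S t\<close> and all
  values of G are constant.\<close>

proposition expectation_one_step:
  fixes G :: "'w \<Rightarrow> 'a \<Rightarrow> 's \<Rightarrow> real"
  assumes G: "\<And>a s'. determined t (\<lambda>\<omega>. G \<omega> a s')"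
  shows "expectation (\<lambda>\<omega>. G \<omega> (A t \<omega>) (S (Suc t) \<omega>))
    = expectation (\<lambda>\<omega>. \<Sum>a\<in>UNIV. \<Sum>s'\<in>UNIV. pmf (\<mu> (S t \<omega>)) a * pmf (P (S t \<omega>) a) s' * G \<omega> a s')"
proof -
  define H where "H = past t ` space M"
  define rep where "rep h = (SOME \<omega>. \<omega> \<in> space M \<and> past t \<omega> = h)" for h
  have rep: "rep h \<in> space M" "past t (rep h) = h" if "h \<in> H" for h
    using someI_ex[of "\<lambda>\<omega>'. \<omega>' \<in> space M \<and> past t \<omega>' = h"] that unfolding rep_def H_def by blast+
  have H: "finite H" "\<And>\<omega>. \<omega> \<in> space M \<Longrightarrow> past t \<omega> \<in> H"
    unfolding H_def by (auto simp: finite_past)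
  have Grep: "G \<omega> a s' = G (rep (past t \<omega>)) a s'" "S t \<omega> = S t (rep (past t \<omega>))"
    if "\<omega> \<in> space M" for \<omega> a s'
    using determinedD[OF G that rep(1)[OF H(2)[OF that]] rep(2)[OF H(2)[OF that], symmetric]]
      determinedD[OF determined_S[OF order_refl] that rep(1)[OF H(2)[OF that]] rep(2)[OF H(2)[OF that], symmetric]]
    by auto
  have set1: "{\<omega>\<in>space M. past t \<omega> = h} \<in> sets M" if "h \<in> H" for h
    using that past_in_sets by (simp add: H_def)
  have set2: "{\<omega>\<in>space M. past t \<omega> = h \<and> A t \<omega> = a \<and> S (Suc t) \<omega> = s'} \<in> sets M"
    if "h \<in> H" for h a s'
    using past_sets[of t "rep h"] rep[OF that] by (simp add: pred_def[symmetric]) measurable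
  have "expectation (\<lambda>\<omega>. G \<omega> (A t \<omega>) (S (Suc t) \<omega>))
      = expectation (\<lambda>\<omega>. \<Sum>h\<in>H. \<Sum>a\<in>UNIV. \<Sum>s'\<in>UNIV. G (rep h) a s' *
          indicator {\<omega>\<in>space M. past t \<omega> = h \<and> A t \<omega> = a \<and> S (Suc t) \<omega> = s'} \<omega>)"
  proof (rule Bochner_Integration.integral_cong[OF refl])
    fix \<omega> assume \<omega>: "\<omega> \<in> space M"
    \<comment> \<open>Nesting the conditions, one per summation variable, lets each of the three
      sums collapse to a single term.\<close>
    have "(\<Sum>h\<in>H. \<Sum>a\<in>UNIV. \<Sum>s'\<in>UNIV. G (rep h) a s' *
          indicator {\<omega>\<in>space M. past t \<omega> = h \<and> A t \<omega> = a \<and> S (Suc t) \<omega> = s'} \<omega>)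
        = (\<Sum>h\<in>H. \<Sum>a\<in>UNIV. \<Sum>s'\<in>UNIV. if s' = S (Suc t) \<omega> then
            if a = A t \<omega> then if h = past t \<omega> then G (rep h) a s' else 0 else 0 else 0)"
      using \<omega> by (intro sum.cong refl) (simp add: indicator_def)
    also have "\<dots> = G (rep (past t \<omega>)) (A t \<omega>) (S (Suc t) \<omega>)"
      using H \<omega> by simp
    finally show "G \<omega> (A t \<omega>) (S (Suc t) \<omega>) = (\<Sum>h\<in>H. \<Sum>a\<in>UNIV. \<Sum>s'\<in>UNIV. G (rep h) a s' *
          indicator {\<omega>\<in>space M. past t \<omega> = h \<and> A t \<omega> = a \<and> S (Suc t) \<omega> = s'} \<omega>)"
      using Grep(1)[OF \<omega>] by simp
  qed
  also have "\<dots> = (\<Sum>h\<in>H. \<Sum>a\<in>UNIV. \<Sum>s'\<in>UNIV. G (rep h) a s' *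
      prob {\<omega>\<in>space M. past t \<omega> = h \<and> A t \<omega> = a \<and> S (Suc t) \<omega> = s'})"
  proof -
    have int: "integrable M (\<lambda>\<omega>. c * indicator
        {\<omega>\<in>space M. past t \<omega> = h \<and> A t \<omega> = a \<and> S (Suc t) \<omega> = s'} \<omega>)"
      if "h \<in> H" for h a s' and c :: real
      using set2[OF that] by (intro integrable_mult_right integrable_real_indicator) (simp_all add: less_top[symmetric])
    show ?thesis
      apply (subst Bochner_Integration.integral_sum, intro Bochner_Integration.integrable_sum int, assumption)
      apply (rule sum.cong[OF refl])
      apply (subst Bochner_Integration.integral_sum, intro Bochner_Integration.integrable_sum int, assumption)
      apply (rule sum.cong[OF refl])
      apply (subst Bochner_Integration.integral_sum, intro Bochner_Integration.integrable_sum int, assumption)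
      apply (rule sum.cong[OF refl])
      apply (simp add: set2)
      done
  qed
  also have "\<dots> = (\<Sum>h\<in>H. (\<Sum>a\<in>UNIV. \<Sum>s'\<in>UNIV. pmf (\<mu> (S t (rep h))) a * pmf (P (S t (rep h)) a) s'
      * G (rep h) a s') * prob {\<omega>\<in>space M. past t \<omega> = h})"
  proof (intro sum.cong refl, unfold sum_distrib_right, intro sum.cong refl)
    fix h a s' assume "h \<in> H"
    then show "G (rep h) a s' * prob {\<omega>\<in>space M. past t \<omega> = h \<and> A t \<omega> = a \<and> S (Suc t) \<omega> = s'}
      = pmf (\<mu> (S t (rep h))) a * pmf (P (S t (rep h)) a) s' * G (rep h) a s' *
        prob {\<omega>\<in>space M. past t \<omega> = h}"
      using prob_past_step[OF rep(1), of h t a s'] rep(2)[of h] by simp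
  qed
  also have "\<dots> = expectation (\<lambda>\<omega>. \<Sum>h\<in>H. (\<Sum>a\<in>UNIV. \<Sum>s'\<in>UNIV.
      pmf (\<mu> (S t (rep h))) a * pmf (P (S t (rep h)) a) s' * G (rep h) a s') *
      indicator {\<omega>\<in>space M. past t \<omega> = h} \<omega>)"
  proof -
    have "integrable M (\<lambda>\<omega>. c * indicator {\<omega>\<in>space M. past t \<omega> = h} \<omega>)" if "h \<in> H" for h and c :: real
      using set1[OF that] by (intro integrable_mult_right integrable_real_indicator) (simp_all add: less_top[symmetric])
    then have "expectation (\<lambda>\<omega>. \<Sum>h\<in>H. c h * indicator {\<omega>\<in>space M. past t \<omega> = h} \<omega>)
        = (\<Sum>h\<in>H. expectation (\<lambda>\<omega>. c h * indicator {\<omega>\<in>space M. past t \<omega> = h} \<omega>))" for c :: "_ \<Rightarrow> real"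
      by (intro Bochner_Integration.integral_sum)
    then show ?thesis by (simp add: set1)
  qed
  also have "\<dots> = expectation (\<lambda>\<omega>. \<Sum>a\<in>UNIV. \<Sum>s'\<in>UNIV.
      pmf (\<mu> (S t \<omega>)) a * pmf (P (S t \<omega>) a) s' * G \<omega> a s')"
  proof (rule Bochner_Integration.integral_cong[OF refl])
    fix \<omega> assume \<omega>: "\<omega> \<in> space M"
    let ?F = "\<lambda>h. \<Sum>a\<in>UNIV. \<Sum>s'\<in>UNIV. pmf (\<mu> (S t (rep h))) a * pmf (P (S t (rep h)) a) s' * G (rep h) a s'"
    have "(\<Sum>h\<in>H. ?F h * indicator {\<omega>\<in>space M. past t \<omega> = h} \<omega>)
        = (\<Sum>h\<in>H. if h = past t \<omega> then ?F h else 0)"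
      using \<omega> by (intro sum.cong) (auto simp: indicator_def)
    also have "\<dots> = ?F (past t \<omega>)" using H \<omega> by simp
    finally show "(\<Sum>h\<in>H. ?F h * indicator {\<omega>\<in>space M. past t \<omega> = h} \<omega>)
        = (\<Sum>a\<in>UNIV. \<Sum>s'\<in>UNIV. pmf (\<mu> (S t \<omega>)) a * pmf (P (S t \<omega>) a) s' * G \<omega> a s')"
      using Grep[OF \<omega>] by simp
  qed
  finally show ?thesis .
qed

lemma expectation_next_state:
  fixes u :: "'w \<Rightarrow> real ^ 's"
  assumes "determined t u"
  shows "expectation (\<lambda>\<omega>. u \<omega> $ S (Suc t) \<omega>) = expectation (\<lambda>\<omega>. (trans_mat P \<mu> *v u \<omega>) $ S t \<omega>)"
proof -
  have "expectation (\<lambda>\<omega>. u \<omega> $ S (Suc t) \<omega>)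
    = expectation (\<lambda>\<omega>. \<Sum>a\<in>UNIV. \<Sum>s'\<in>UNIV. pmf (\<mu> (S t \<omega>)) a * pmf (P (S t \<omega>) a) s' * u \<omega> $ s')"
    by (rule expectation_one_step[of t "\<lambda>\<omega> a s'. u \<omega> $ s'"])
      (rule determined_compose[OF assms, of "\<lambda>v. v $ s'" for s'])
  also have "\<dots> = expectation (\<lambda>\<omega>. (trans_mat P \<mu> *v u \<omega>) $ S t \<omega>)"
    by (subst sum.swap) (simp add: matrix_vector_mult_def trans_mat_component sum_distrib_right)
  finally show ?thesis .
qed

text \<open>With a centred u this reduces the law at time t to powers of the chain applied at the
  initial state, where mixing gives a bound uniform in that state.\<close>

lemma expectation_state:
  "expectation (\<lambda>\<omega>. u $ S t \<omega>) = expectation (\<lambda>\<omega>. (mat_pow (trans_mat P \<mu>) t *v u) $ S 0 \<omega>)"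
proof (induction t arbitrary: u)
  case (Suc t)
  have "expectation (\<lambda>\<omega>. u $ S (Suc t) \<omega>) = expectation (\<lambda>\<omega>. (trans_mat P \<mu> *v u) $ S t \<omega>)"
    by (rule expectation_next_state) (rule determined_const)
  also have "\<dots> = expectation (\<lambda>\<omega>. (mat_pow (trans_mat P \<mu>) t *v (trans_mat P \<mu> *v u)) $ S 0 \<omega>)"
    by (rule Suc)
  finally show ?case by (simp add: mat_pow_Suc2 matrix_vector_mul_assoc)
qed simp

end

section \<open>Importance sampling for the target policy\<close>

locale off_policy = mdp_process P \<mu> M S A
  for P :: "'s::finite \<Rightarrow> 'a::finite \<Rightarrow> 's pmf" and \<mu> :: "'s \<Rightarrow> 'a pmf"
    and M :: "'w measure" and S :: "nat \<Rightarrow> 'w \<Rightarrow> 's" and A :: "nat \<Rightarrow> 'w \<Rightarrow> 'a" +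
  fixes \<pi> :: "'s \<Rightarrow> 'a pmf" and \<gamma> :: "'s \<Rightarrow> real"
  assumes coverage: "\<And>s a. pmf (\<pi> s) a > 0 \<Longrightarrow> pmf (\<mu> s) a > 0"
begin

abbreviation "\<rho> \<equiv> is_ratio \<pi> \<mu> S A"
abbreviation "B \<equiv> trans_mat P \<pi> ** diag_mat \<gamma>"

lemma determined_ratio: "i < t \<Longrightarrow> determined t (\<rho> i)"
  unfolding is_ratio_def
  by (rule determined_compose2[of t "S i" "A i" "\<lambda>s a. pmf (\<pi> s) a / pmf (\<mu> s) a"])
    (simp_all add: determined_S determined_A)

lemma determined_trace:
  assumes "T \<le> t"
  shows "determined t (\<lambda>\<omega>. \<Prod>i\<in>{k..<T}. \<rho> i \<omega> * \<gamma> (S (Suc i) \<omega>))"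
proof (rule determined_prod)
  fix i assume "i \<in> {k..<T}"
  then show "determined t (\<lambda>\<omega>. \<rho> i \<omega> * \<gamma> (S (Suc i) \<omega>))"
    using assms by (intro determined_compose2[of t "\<rho> i" "S (Suc i)" "\<lambda>x s. x * \<gamma> s"]
      determined_ratio determined_S) auto
qed

text \<open>Change of measure: the ratio cancels the behavior probability in the one-step sum and
  leaves the target probability.\<close>

lemma expectation_ratio_step:
  fixes U :: "'w \<Rightarrow> 'a \<Rightarrow> 's \<Rightarrow> real"
  assumes U: "\<And>a s'. determined t (\<lambda>\<omega>. U \<omega> a s')"
  shows "expectation (\<lambda>\<omega>. \<rho> t \<omega> * U \<omega> (A t \<omega>) (S (Suc t) \<omega>))
    = expectation (\<lambda>\<omega>. \<Sum>a\<in>UNIV. \<Sum>s'\<in>UNIV. pmf (\<pi> (S t \<omega>)) a * pmf (P (S t \<omega>) a) s' * U \<omega> a s')"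
proof -
  define G where "G \<omega> a s' = pmf (\<pi> (S t \<omega>)) a / pmf (\<mu> (S t \<omega>)) a * U \<omega> a s'" for \<omega> a s'
  have "expectation (\<lambda>\<omega>. \<rho> t \<omega> * U \<omega> (A t \<omega>) (S (Suc t) \<omega>))
      = expectation (\<lambda>\<omega>. G \<omega> (A t \<omega>) (S (Suc t) \<omega>))"
    by (simp add: G_def is_ratio_def)
  also have "\<dots> = expectation (\<lambda>\<omega>. \<Sum>a\<in>UNIV. \<Sum>s'\<in>UNIV.
      pmf (\<mu> (S t \<omega>)) a * pmf (P (S t \<omega>) a) s' * G \<omega> a s')"
  proof (rule expectation_one_step)
    show "determined t (\<lambda>\<omega>. G \<omega> a s')" for a s'
      unfolding G_def by (rule determined_compose2[of t "S t" "\<lambda>\<omega>. U \<omega> a s'"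
        "\<lambda>s x. pmf (\<pi> s) a / pmf (\<mu> s) a * x"]) (simp_all add: determined_S U)
  qed
  also have "\<dots> = expectation (\<lambda>\<omega>. \<Sum>a\<in>UNIV. \<Sum>s'\<in>UNIV.
      pmf (\<pi> (S t \<omega>)) a * pmf (P (S t \<omega>) a) s' * U \<omega> a s')"
  proof (intro Bochner_Integration.integral_cong refl sum.cong)
    fix \<omega> a s'
    show "pmf (\<mu> (S t \<omega>)) a * pmf (P (S t \<omega>) a) s' * G \<omega> a s'
        = pmf (\<pi> (S t \<omega>)) a * pmf (P (S t \<omega>) a) s' * U \<omega> a s'"
    \<comment> \<open>Where the target probability vanishes both sides are 0; elsewhere coverage
      makes the divisor positive.\<close>
    proof (cases "pmf (\<pi> (S t \<omega>)) a = 0")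
      case False
      then have "pmf (\<mu> (S t \<omega>)) a > 0" by (intro coverage) (simp add: pmf_nonneg less_le)
      then show ?thesis by (simp add: G_def)
    qed (simp add: G_def)
  qed
  finally show ?thesis .
qed

lemma B_vec: "(B *v u) $ s = (\<Sum>a\<in>UNIV. \<Sum>s'\<in>UNIV. pmf (\<pi> s) a * pmf (P s a) s' * (\<gamma> s' * u $ s'))"
  by (subst sum.swap)
    (simp add: matrix_vector_mult_def mult_diag_component trans_mat_component sum_distrib_right mult.assoc)

text \<open>Each factor of the trace applies the discounted target kernel once. The last factor is
  peeled off first, which replaces u by \<open>B *v u\<close>; hence the induction generalises over
  u, and u has to be known already at time t.\<close>

proposition expectation_trace:
  fixes u :: "'w \<Rightarrow> real ^ 's"
  assumes "determined t u"
  shows "expectation (\<lambda>\<omega>. (\<Prod>i\<in>{t..<t + j}. \<rho> i \<omega> * \<gamma> (S (Suc i) \<omega>)) * u \<omega> $ S (t + j) \<omega>)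
    = expectation (\<lambda>\<omega>. (mat_pow B j *v u \<omega>) $ S t \<omega>)"
  using assms
proof (induction j arbitrary: u)
  case (Suc j)
  define T where "T \<omega> = (\<Prod>i\<in>{t..<t + j}. \<rho> i \<omega> * \<gamma> (S (Suc i) \<omega>))" for \<omega>
  have T: "determined (t + j) T" unfolding T_def by (rule determined_trace) simp
  have u: "determined (t + j) u" by (rule determined_mono[OF Suc.prems]) simp
  have "expectation (\<lambda>\<omega>. (\<Prod>i\<in>{t..<t + Suc j}. \<rho> i \<omega> * \<gamma> (S (Suc i) \<omega>)) * u \<omega> $ S (t + Suc j) \<omega>)
      = expectation (\<lambda>\<omega>. \<rho> (t + j) \<omega> * (T \<omega> * (\<gamma> (S (Suc (t + j)) \<omega>) * u \<omega> $ S (Suc (t + j)) \<omega>)))"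
    by (simp add: T_def mult_ac)
  also have "\<dots> = expectation (\<lambda>\<omega>. \<Sum>a\<in>UNIV. \<Sum>s'\<in>UNIV.
      pmf (\<pi> (S (t + j) \<omega>)) a * pmf (P (S (t + j) \<omega>) a) s' * (T \<omega> * (\<gamma> s' * u \<omega> $ s')))"
    by (rule expectation_ratio_step[of "t + j" "\<lambda>\<omega> a s'. T \<omega> * (\<gamma> s' * u \<omega> $ s')"])
      (rule determined_compose2[OF T u, of "\<lambda>x v. x * (\<gamma> s' * v $ s')" for s'])
  also have "\<dots> = expectation (\<lambda>\<omega>. T \<omega> * (B *v u \<omega>) $ S (t + j) \<omega>)"
    by (simp add: B_vec sum_distrib_left mult_ac)
  also have "\<dots> = expectation (\<lambda>\<omega>. (mat_pow B j *v (B *v u \<omega>)) $ S t \<omega>)"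
    unfolding T_def by (rule Suc.IH) (rule determined_compose[OF Suc.prems])
  finally show ?case by (simp add: mat_pow_Suc2 matrix_vector_mul_assoc)
qed simp

text \<open>The sum in the update for an arbitrary value vector v in place of the feature products,
  so that the Bellman computation does not mention the features.\<close>

definition td_error_sum :: "('s \<Rightarrow> 'a \<Rightarrow> real) \<Rightarrow> nat \<Rightarrow> nat \<Rightarrow> real ^ 's \<Rightarrow> 'w \<Rightarrow> real" where
  "td_error_sum r n t v \<omega> = (\<Sum>k\<in>{t..<t+n}. (\<Prod>i\<in>{t..<k}. \<gamma> (S (Suc i) \<omega>) * \<rho> i \<omega>) * \<rho> k \<omega> *
     (r (S k \<omega>) (A k \<omega>) + \<gamma> (S (Suc k) \<omega>) * v $ S (Suc k) \<omega> - v $ S k \<omega>))"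

lemma determined_td_error_sum:
  assumes v: "determined T v" and T: "t + n \<le> T"
  shows "determined T (\<lambda>\<omega>. td_error_sum r n t (v \<omega>) \<omega>)"
  unfolding td_error_sum_def
proof (rule determined_sum)
  fix k assume k: "k \<in> {t..<t + n}"
  have tr: "determined T (\<lambda>\<omega>. \<Prod>i\<in>{t..<k}. \<gamma> (S (Suc i) \<omega>) * \<rho> i \<omega>)"
    using determined_trace[of k T t] k T by (simp add: mult.commute)
  have "determined T (\<lambda>\<omega>. (S k \<omega>, A k \<omega>, S (Suc k) \<omega>))"
    using k T by (intro determined_compose3[of T "S k" "A k" "S (Suc k)" "\<lambda>x y z. (x, y, z)"]
      determined_S determined_A) auto
  moreover have "determined T (\<lambda>\<omega>. (v \<omega>, \<rho> k \<omega>))"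
    using k T by (intro determined_compose2[OF v, of "\<rho> k" Pair] determined_ratio) auto
  ultimately have "determined T (\<lambda>\<omega>. (\<lambda>x (s, a, s') (v, y). x * y * (r s a + \<gamma> s' * v $ s' - v $ s))
      (\<Prod>i\<in>{t..<k}. \<gamma> (S (Suc i) \<omega>) * \<rho> i \<omega>) (S k \<omega>, A k \<omega>, S (Suc k) \<omega>) (v \<omega>, \<rho> k \<omega>))"
    by (rule determined_compose3[OF tr])
  then show "determined T (\<lambda>\<omega>. (\<Prod>i\<in>{t..<k}. \<gamma> (S (Suc i) \<omega>) * \<rho> i \<omega>) * \<rho> k \<omega> *
     (r (S k \<omega>) (A k \<omega>) + \<gamma> (S (Suc k) \<omega>) * v \<omega> $ S (Suc k) \<omega> - v \<omega> $ S k \<omega>))"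
    by simp
qed

text \<open>Allowing every multiplier z known at time t amounts to computing the conditional
  expectation given the history, without introducing one.\<close>

lemma expectation_td_error:
  fixes v :: "'w \<Rightarrow> real ^ 's" and z :: "'w \<Rightarrow> real"
  assumes v: "determined t v" and z: "determined t z"
  shows "expectation (\<lambda>\<omega>. z \<omega> * ((\<Prod>i\<in>{t..<t+j}. \<gamma> (S (Suc i) \<omega>) * \<rho> i \<omega>) * \<rho> (t+j) \<omega> *
     (r (S (t+j) \<omega>) (A (t+j) \<omega>) + \<gamma> (S (Suc (t+j)) \<omega>) * v \<omega> $ S (Suc (t+j)) \<omega> - v \<omega> $ S (t+j) \<omega>)))
    = expectation (\<lambda>\<omega>. z \<omega> * (mat_pow B j *v (reward_vec r \<pi> + B *v v \<omega> - v \<omega>)) $ S t \<omega>)"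
proof -
  define T where "T \<omega> = (\<Prod>i\<in>{t..<t + j}. \<rho> i \<omega> * \<gamma> (S (Suc i) \<omega>))" for \<omega>
  define U where "U \<omega> a s' = z \<omega> * T \<omega> * (r (S (t+j) \<omega>) a + \<gamma> s' * v \<omega> $ s' - v \<omega> $ S (t+j) \<omega>)"
    for \<omega> a s'
  have T: "determined (t + j) T" unfolding T_def by (rule determined_trace) simp
  have v': "determined (t + j) v" and z': "determined (t + j) z"
    using v z by (auto intro: determined_mono)
  have U: "determined (t + j) (\<lambda>\<omega>. U \<omega> a s')" for a s'
    unfolding U_def
    by (rule determined_compose3[OF determined_compose2[OF z' T, of "(*)"] v' determined_S[OF order_refl],
      of "\<lambda>x v s. x * (r s a + \<gamma> s' * v $ s' - v $ s)"])
  have "expectation (\<lambda>\<omega>. z \<omega> * ((\<Prod>i\<in>{t..<t+j}. \<gamma> (S (Suc i) \<omega>) * \<rho> i \<omega>) * \<rho> (t+j) \<omega> *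
     (r (S (t+j) \<omega>) (A (t+j) \<omega>) + \<gamma> (S (Suc (t+j)) \<omega>) * v \<omega> $ S (Suc (t+j)) \<omega> - v \<omega> $ S (t+j) \<omega>)))
    = expectation (\<lambda>\<omega>. \<rho> (t+j) \<omega> * U \<omega> (A (t+j) \<omega>) (S (Suc (t+j)) \<omega>))"
    by (simp add: U_def T_def mult_ac)
  also have "\<dots> = expectation (\<lambda>\<omega>. \<Sum>a\<in>UNIV. \<Sum>s'\<in>UNIV.
      pmf (\<pi> (S (t+j) \<omega>)) a * pmf (P (S (t+j) \<omega>) a) s' * U \<omega> a s')"
    by (rule expectation_ratio_step[OF U])
  also have "\<dots> = expectation (\<lambda>\<omega>. T \<omega> * (z \<omega> *\<^sub>R (reward_vec r \<pi> + B *v v \<omega> - v \<omega>)) $ S (t+j) \<omega>)"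
  proof (rule Bochner_Integration.integral_cong[OF refl])
    fix \<omega>
    let ?s = "S (t+j) \<omega>"
    have "(\<Sum>a\<in>UNIV. \<Sum>s'\<in>UNIV. pmf (\<pi> ?s) a * pmf (P ?s a) s' * U \<omega> a s')
        = z \<omega> * T \<omega> * (\<Sum>a\<in>UNIV. \<Sum>s'\<in>UNIV. pmf (\<pi> ?s) a * pmf (P ?s a) s' *
            (r ?s a + \<gamma> s' * v \<omega> $ s' - v \<omega> $ ?s))"
      unfolding U_def sum_distrib_left by (intro sum.cong refl) simp
    also have "(\<Sum>a\<in>UNIV. \<Sum>s'\<in>UNIV. pmf (\<pi> ?s) a * pmf (P ?s a) s' *
            (r ?s a + \<gamma> s' * v \<omega> $ s' - v \<omega> $ ?s))
        = (\<Sum>a\<in>UNIV. pmf (\<pi> ?s) a * r ?s a) + (B *v v \<omega>) $ ?s - v \<omega> $ ?s"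
    proof -
      have "(\<Sum>a\<in>UNIV. \<Sum>s'\<in>UNIV. pmf (\<pi> ?s) a * pmf (P ?s a) s' * c a)
          = (\<Sum>a\<in>UNIV. pmf (\<pi> ?s) a * c a)" for c
        by (simp add: sum_pmf_UNIV flip: sum_distrib_left sum_distrib_right)
      from this[of "r ?s"] this[of "\<lambda>_. v \<omega> $ ?s"] show ?thesis
        by (simp add: B_vec distrib_left right_diff_distrib sum.distrib sum_subtractf sum_pmf_UNIV
          flip: sum_distrib_right)
    qed
    finally show "(\<Sum>a\<in>UNIV. \<Sum>s'\<in>UNIV. pmf (\<pi> ?s) a * pmf (P ?s a) s' * U \<omega> a s')
        = T \<omega> * (z \<omega> *\<^sub>R (reward_vec r \<pi> + B *v v \<omega> - v \<omega>)) $ ?s"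
      by (simp add: reward_vec_def)
  qed
  also have "\<dots> = expectation (\<lambda>\<omega>. (mat_pow B j *v (z \<omega> *\<^sub>R (reward_vec r \<pi> + B *v v \<omega> - v \<omega>))) $ S t \<omega>)"
    unfolding T_def by (rule expectation_trace)
      (rule determined_compose2[OF z v, of "\<lambda>x w. x *\<^sub>R (reward_vec r \<pi> + B *v w - w)"])
  finally show ?thesis by (simp add: matrix_vector_mult_scaleR)
qed

text \<open>The conditional means B^j (r_\<pi> + B v - v) telescope in j: the rewards add up to the
  n-step reward vector, and of the rest only B^n v - v remains.\<close>

proposition expectation_td_error_sum:
  fixes v :: "'w \<Rightarrow> real ^ 's" and z :: "'w \<Rightarrow> real"
  assumes v: "determined t v" and z: "determined t z"
  shows "expectation (\<lambda>\<omega>. z \<omega> * td_error_sum r n t (v \<omega>) \<omega>)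
    = expectation (\<lambda>\<omega>. z \<omega> * (nstep_reward_vec P r \<gamma> \<pi> n + mat_pow B n *v v \<omega> - v \<omega>) $ S t \<omega>)"
proof (induction n)
  case 0
  then show ?case by (simp add: td_error_sum_def nstep_reward_vec_def)
next
  case (Suc n)
  let ?X = "\<lambda>j \<omega>. z \<omega> * ((\<Prod>i\<in>{t..<t+j}. \<gamma> (S (Suc i) \<omega>) * \<rho> i \<omega>) * \<rho> (t+j) \<omega> *
     (r (S (t+j) \<omega>) (A (t+j) \<omega>) + \<gamma> (S (Suc (t+j)) \<omega>) * v \<omega> $ S (Suc (t+j)) \<omega> - v \<omega> $ S (t+j) \<omega>))"
  have split: "z \<omega> * td_error_sum r (Suc n) t (v \<omega>) \<omega> = z \<omega> * td_error_sum r n t (v \<omega>) \<omega> + ?X n \<omega>" for \<omega>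
    by (simp add: td_error_sum_def distrib_left)
  have int: "integrable M (\<lambda>\<omega>. z \<omega> * td_error_sum r k t (v \<omega>) \<omega>)" for k
    by (rule determined_integrable[of "t + k"], rule determined_compose2[of _ z _ "(*)"])
      (auto intro!: determined_td_error_sum intro: determined_mono[OF v] determined_mono[OF z])
  have intX: "integrable M (?X n)"
    using Bochner_Integration.integrable_diff[OF int[of "Suc n"] int[of n]] unfolding split by simp
  have int_det: "integrable M (\<lambda>\<omega>. z \<omega> * (F (v \<omega>)) $ S t \<omega>)" for F
    by (rule determined_integrable[of t], rule determined_compose3[OF z v determined_S[OF order_refl],
      of "\<lambda>x w s. x * F w $ s"])
  have "expectation (\<lambda>\<omega>. z \<omega> * td_error_sum r (Suc n) t (v \<omega>) \<omega>)
      = expectation (\<lambda>\<omega>. z \<omega> * td_error_sum r n t (v \<omega>) \<omega>) + expectation (?X n)"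
    unfolding split by (rule Bochner_Integration.integral_add[OF int intX])
  also have "\<dots> = expectation (\<lambda>\<omega>. z \<omega> * (nstep_reward_vec P r \<gamma> \<pi> n + mat_pow B n *v v \<omega> - v \<omega>) $ S t \<omega>)
      + expectation (\<lambda>\<omega>. z \<omega> * (mat_pow B n *v (reward_vec r \<pi> + B *v v \<omega> - v \<omega>)) $ S t \<omega>)"
    unfolding Suc.IH expectation_td_error[OF v z] ..
  also have "\<dots> = expectation (\<lambda>\<omega>. z \<omega> * (nstep_reward_vec P r \<gamma> \<pi> n + mat_pow B n *v v \<omega> - v \<omega>) $ S t \<omega>
      + z \<omega> * (mat_pow B n *v (reward_vec r \<pi> + B *v v \<omega> - v \<omega>)) $ S t \<omega>)"
    by (rule Bochner_Integration.integral_add[symmetric]) (rule int_det)+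
  also have "\<dots> = expectation (\<lambda>\<omega>. z \<omega> *
      (nstep_reward_vec P r \<gamma> \<pi> (Suc n) + mat_pow B (Suc n) *v v \<omega> - v \<omega>) $ S t \<omega>)"
    by (simp add: nstep_reward_vec_def mat_pow_Suc2 matrix_vector_right_distrib
        matrix_vector_mult_diff_distrib matrix_vector_mul_assoc algebra_simps)
  finally show ?case .
qed

end

section \<open>Positive definiteness\<close>

text \<open>The row sums of the discounted kernel and the balance equation for the weights dominate the
  off-diagonal part from both sides, via \<open>2xy \<le> x\<^sup>2 + y\<^sup>2\<close>.\<close>

lemma balanced_quadratic_form:
  fixes C :: "real ^ 's::finite ^ 's"
  assumes C: "substochastic C" and m: "\<And>s. m s \<ge> 0"
    and bal: "\<And>s. m s = d s + (\<Sum>s'\<in>UNIV. m s' * C $ s' $ s)"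
  shows "(\<Sum>s\<in>UNIV. d s * (x $ s)\<^sup>2) / 2 \<le> (\<Sum>s\<in>UNIV. m s * x $ s * (x - C *v x) $ s)"
proof -
  have c: "C $ i $ j \<ge> 0" "(\<Sum>j\<in>UNIV. C $ i $ j) \<le> 1" for i j
    using C by (auto simp: substochastic_def)
  define N where "N = (\<Sum>s\<in>UNIV. m s * (x $ s)\<^sup>2)"
  have "(\<Sum>s\<in>UNIV. m s * x $ s * (C *v x) $ s)
      = (\<Sum>s\<in>UNIV. \<Sum>s'\<in>UNIV. m s * C $ s $ s' * (x $ s * x $ s'))"
    by (simp add: matrix_vector_mult_def sum_distrib_left mult_ac)
  also have "\<dots> \<le> (\<Sum>s\<in>UNIV. \<Sum>s'\<in>UNIV. m s * C $ s $ s' * (((x $ s)\<^sup>2 + (x $ s')\<^sup>2) / 2))"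
  proof (intro sum_mono mult_left_mono)
    fix s s'
    show "x $ s * x $ s' \<le> ((x $ s)\<^sup>2 + (x $ s')\<^sup>2) / 2"
      using zero_le_power2[of "x $ s - x $ s'"] by (simp add: power2_diff)
  qed (use m c in auto)
  also have "\<dots> = (\<Sum>s\<in>UNIV. m s * (\<Sum>s'\<in>UNIV. C $ s $ s') * (x $ s)\<^sup>2 / 2)
      + (\<Sum>s'\<in>UNIV. (\<Sum>s\<in>UNIV. m s * C $ s $ s') * (x $ s')\<^sup>2 / 2)"
  proof -
    have "(\<Sum>s\<in>UNIV. \<Sum>s'\<in>UNIV. m s * C $ s $ s' * (((x $ s)\<^sup>2 + (x $ s')\<^sup>2) / 2))
        = (\<Sum>s\<in>UNIV. \<Sum>s'\<in>UNIV. m s * C $ s $ s' * (x $ s)\<^sup>2 / 2)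
        + (\<Sum>s\<in>UNIV. \<Sum>s'\<in>UNIV. m s * C $ s $ s' * (x $ s')\<^sup>2 / 2)"
      by (simp add: sum.distrib[symmetric] add_divide_distrib distrib_left)
    also have "(\<Sum>s\<in>UNIV. \<Sum>s'\<in>UNIV. m s * C $ s $ s' * (x $ s')\<^sup>2 / 2)
        = (\<Sum>s'\<in>UNIV. \<Sum>s\<in>UNIV. m s * C $ s $ s' * (x $ s')\<^sup>2 / 2)"
      by (rule sum.swap)
    finally show ?thesis
      by (simp add: sum_distrib_left sum_distrib_right sum_divide_distrib)
  qed
  also have "(\<Sum>s\<in>UNIV. m s * (\<Sum>s'\<in>UNIV. C $ s $ s') * (x $ s)\<^sup>2 / 2) \<le> N / 2"
    unfolding N_def sum_divide_distrib
    by (intro sum_mono divide_right_mono mult_right_mono mult_left_le) (use m c in auto)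
  also have "(\<Sum>s'\<in>UNIV. (\<Sum>s\<in>UNIV. m s * C $ s $ s') * (x $ s')\<^sup>2 / 2)
      = N / 2 - (\<Sum>s\<in>UNIV. d s * (x $ s)\<^sup>2) / 2"
  proof -
    have "(\<Sum>s\<in>UNIV. m s * C $ s $ s') = m s' - d s'" for s' using bal[of s'] by simp
    then show ?thesis
      by (simp add: N_def left_diff_distrib diff_divide_distrib sum_subtractf sum_divide_distrib)
  qed
  finally show ?thesis
    by (simp add: N_def right_diff_distrib sum_subtractf power2_eq_square mult.assoc)
qed

lemma mat_norm_bound:
  fixes D :: "real ^ 'm::finite ^ 'n::finite"
  shows "norm (D *v x) \<le> mat_norm D * norm x"
  unfolding mat_norm_def by (rule onorm) simp

lemma mat_norm_nonneg: "mat_norm D \<ge> 0" for D :: "real ^ 'm::finite ^ 'n::finite"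
  unfolding mat_norm_def by (rule onorm_pos_le) simp

lemma feature_mat_vec: "(feature_mat \<phi> *v w) $ s = w \<bullet> \<phi> s"
  by (simp add: feature_mat_def matrix_vector_mul_component inner_commute)

lemma inner_vector_matrix_mult: "e \<bullet> (y v* X) = (X *v e) \<bullet> y"
  for X :: "real ^ 'd::finite ^ 's::finite"
  by (metis dot_lmul_matrix inner_commute)

lemma xetd_A_quadratic:
  fixes \<phi> :: "'s::finite \<Rightarrow> real ^ 'd::finite"
  shows "e \<bullet> (xetd_A P \<gamma> \<pi> n \<phi> d f *v w) = (\<Sum>s\<in>UNIV. pmf d s * f s * (feature_mat \<phi> *v e) $ s *
    (feature_mat \<phi> *v w - mat_pow (trans_mat P \<pi> ** diag_mat \<gamma>) n *v (feature_mat \<phi> *v w)) $ s)"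
proof -
  have "e \<bullet> (xetd_A P \<gamma> \<pi> n \<phi> d f *v w) = (feature_mat \<phi> *v e) \<bullet>
      (D_theta d f *v (feature_mat \<phi> *v w - mat_pow (trans_mat P \<pi> ** diag_mat \<gamma>) n *v (feature_mat \<phi> *v w)))"
    by (simp add: xetd_A_def inner_vector_matrix_mult matrix_vector_mult_diff_rdistrib flip: matrix_vector_mul_assoc)
  then show ?thesis
    by (simp add: D_theta_def inner_vec_def diag_mat_vec mult_ac)
qed

lemma xetd_b_inner:
  fixes \<phi> :: "'s::finite \<Rightarrow> real ^ 'd::finite"
  shows "e \<bullet> xetd_b P r \<gamma> \<pi> n \<phi> d f
    = (\<Sum>s\<in>UNIV. pmf d s * f s * (feature_mat \<phi> *v e) $ s * nstep_reward_vec P r \<gamma> \<pi> n $ s)"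
proof -
  have "e \<bullet> xetd_b P r \<gamma> \<pi> n \<phi> d f = (feature_mat \<phi> *v e) \<bullet> (D_theta d f *v nstep_reward_vec P r \<gamma> \<pi> n)"
    by (simp add: xetd_b_def inner_vector_matrix_mult flip: matrix_vector_mul_assoc)
  then show ?thesis
    by (simp add: D_theta_def inner_vec_def diag_mat_vec mult_ac)
qed

section \<open>The followon trace and definiteness of the key matrix\<close>

context off_policy
begin

context
  fixes n :: nat and d :: "'s pmf"
  assumes n_pos: "n \<ge> 1"
    and discount: "\<And>s. 0 \<le> \<gamma> s \<and> \<gamma> s \<le> 1"
    and ergodic: "ergodic_chain (trans_mat P \<mu>)"
    and stationary: "stationary_distribution d (trans_mat P \<mu>)"
begin

abbreviation "F \<equiv> followon n \<gamma> \<pi> \<mu> S A"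

lemma followon_init: "t < n \<Longrightarrow> F t \<omega> = 1"
  unfolding followon_def by (subst followon_rec.simps) simp

lemma followon_step:
  "F (t + n) \<omega> = (\<Prod>i\<in>{t..<t + n}. \<rho> i \<omega> * \<gamma> (S (Suc i) \<omega>)) * F t \<omega> + 1"
  unfolding followon_def by (subst followon_rec.simps) (use n_pos in simp)

lemma followon_cases:
  obtains "t < n" | t' where "t = t' + n" "t' < t"
  using n_pos by (metis add.commute le_add_diff_inverse less_add_same_cancel1 not_le less_eq_Suc_le One_nat_def)

lemma determined_followon: "determined t (F t)"
proof (induction t rule: less_induct)
  case (less t)
  show ?case
  proof (cases rule: followon_cases[of t])
    case 1
    then have "F t = (\<lambda>_. 1)" by (auto simp: followon_init)
    then show ?thesis by (simp add: determined_const)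
  next
    case (2 t')
    then show ?thesis
      using determined_compose2[of t "\<lambda>\<omega>. \<Prod>i\<in>{t'..<t}. \<rho> i \<omega> * \<gamma> (S (Suc i) \<omega>)" "F t'" "\<lambda>x y. x * y + 1"]
        determined_trace[of t t t'] determined_mono[OF less.IH[of t'], of t]
      by (simp add: followon_step[abs_def])
  qed
qed

lemma followon_nonneg: "F t \<omega> \<ge> 0"
proof (induction t rule: less_induct)
  case (less t)
  show ?case
  proof (cases rule: followon_cases[of t])
    case 1
    then show ?thesis by (simp add: followon_init)
  next
    case (2 t')
    have "F (t' + n) \<omega> \<ge> 0"
      unfolding followon_step using discount less.IH[OF 2(2)]
      by (intro add_nonneg_nonneg mult_nonneg_nonneg prod_nonneg) (auto simp: is_ratio_def)
    then show ?thesis using 2(1) by simp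
  qed
qed

text \<open>The unnormalised form of the conditional expectation of the trace: it satisfies a linear
  recursion and involves no division by the probability of the state.\<close>

definition "emphasis t s = expectation (\<lambda>\<omega>. F t \<omega> * of_bool (S t \<omega> = s))"

lemma state_indicator: "of_bool (S t \<omega> = s) = axis s (1::real) $ S t \<omega>"
  by (simp add: axis_def)

text \<open>The summand 1 in the trace recursion contributes the state probability. The product over
  the window turns the indicator of s at time t + n into column s of the n-th kernel power at time
  t.\<close>

lemma emphasis_step:
  "emphasis (t + n) s = prob {\<omega>\<in>space M. S (t + n) \<omega> = s} + (\<Sum>s'\<in>UNIV. emphasis t s' * mat_pow B n $ s' $ s)"
proof -
  let ?T = "\<lambda>\<omega>. \<Prod>i\<in>{t..<t + n}. \<rho> i \<omega> * \<gamma> (S (Suc i) \<omega>)"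
  have det: "determined t (\<lambda>\<omega>. F t \<omega> *\<^sub>R axis s (1::real))"
    by (rule determined_compose[OF determined_followon])
  have i1: "integrable M (\<lambda>\<omega>. ?T \<omega> * (F t \<omega> *\<^sub>R axis s (1::real)) $ S (t + n) \<omega>)"
    by (rule determined_integrable[of "t + n"],
        rule determined_compose3[of _ ?T "\<lambda>\<omega>. F t \<omega> *\<^sub>R axis s (1::real)" "S (t + n)" "\<lambda>x v s. x * v $ s"])
      (auto intro: determined_trace determined_mono[OF det] determined_S)
  have i2: "integrable M (\<lambda>\<omega>. of_bool (S (t + n) \<omega> = s) :: real)"
    by (rule determined_integrable[of "t + n"], rule determined_compose[OF determined_S[OF order_refl]])
  have i3: "integrable M (\<lambda>\<omega>. F t \<omega> * of_bool (S t \<omega> = s'))" for s'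
    by (rule determined_integrable[of t], rule determined_compose2[OF determined_followon determined_S[OF order_refl],
      where F = "\<lambda>x s. x * of_bool (s = s')"])
  have "emphasis (t + n) s
      = expectation (\<lambda>\<omega>. ?T \<omega> * (F t \<omega> *\<^sub>R axis s (1::real)) $ S (t + n) \<omega> + of_bool (S (t + n) \<omega> = s))"
    unfolding emphasis_def followon_step by (simp add: state_indicator algebra_simps)
  also have "\<dots> = expectation (\<lambda>\<omega>. ?T \<omega> * (F t \<omega> *\<^sub>R axis s (1::real)) $ S (t + n) \<omega>)
      + expectation (\<lambda>\<omega>. of_bool (S (t + n) \<omega> = s))"
    by (rule Bochner_Integration.integral_add[OF i1 i2])
  also have "expectation (\<lambda>\<omega>. of_bool (S (t + n) \<omega> = s)) = prob {\<omega>\<in>space M. S (t + n) \<omega> = s}"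
  proof -
    have "expectation (\<lambda>\<omega>. of_bool (S (t + n) \<omega> = s)) = expectation (indicat_real {\<omega>\<in>space M. S (t + n) \<omega> = s})"
      by (intro Bochner_Integration.integral_cong) (auto simp: indicator_def)
    then show ?thesis by simp
  qed
  also have "expectation (\<lambda>\<omega>. ?T \<omega> * (F t \<omega> *\<^sub>R axis s (1::real)) $ S (t + n) \<omega>)
      = expectation (\<lambda>\<omega>. (mat_pow B n *v (F t \<omega> *\<^sub>R axis s 1)) $ S t \<omega>)"
    by (rule expectation_trace[OF det])
  also have "\<dots> = expectation (\<lambda>\<omega>. \<Sum>s'\<in>UNIV. F t \<omega> * of_bool (S t \<omega> = s') * mat_pow B n $ s' $ s)"
  proof (rule Bochner_Integration.integral_cong[OF refl])
    fix \<omega>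
    have "(\<Sum>s'\<in>UNIV. F t \<omega> * of_bool (S t \<omega> = s') * mat_pow B n $ s' $ s)
        = (\<Sum>s'\<in>UNIV. if s' = S t \<omega> then F t \<omega> * mat_pow B n $ s' $ s else 0)"
      by (intro sum.cong) auto
    then show "(mat_pow B n *v (F t \<omega> *\<^sub>R axis s 1)) $ S t \<omega>
        = (\<Sum>s'\<in>UNIV. F t \<omega> * of_bool (S t \<omega> = s') * mat_pow B n $ s' $ s)"
      by (simp add: matrix_vector_mult_scaleR matrix_vector_mult_basis column_def)
  qed
  also have "\<dots> = (\<Sum>s'\<in>UNIV. emphasis t s' * mat_pow B n $ s' $ s)"
    unfolding emphasis_def
    by (subst Bochner_Integration.integral_sum) (use i3 in auto)
  finally show ?thesis by simp
qed

text \<open>Subtracting \<open>pmf d s\<close> centres the indicator of s, so mixing applies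
  uniformly over the initial state, whose law is arbitrary.\<close>

lemma state_distribution_tendsto: "(\<lambda>t. prob {\<omega>\<in>space M. S t \<omega> = s}) \<longlonglongrightarrow> pmf d s"
proof -
  let ?Q = "trans_mat P \<mu>"
  obtain C q where C: "C > 0" "0 < q" "q < 1" and mix: "\<And>h k s. (\<Sum>s\<in>UNIV. pmf d s * h $ s) = 0 \<Longrightarrow>
      \<bar>(mat_pow ?Q k *v h) $ s\<bar> \<le> C * q ^ k * norm h"
    using geometric_mixing[OF stochastic_trans_mat ergodic stationary] by blast
  define h :: "real ^ 's" where "h = axis s 1 - pmf d s *\<^sub>R 1"
  have h0: "(\<Sum>s\<in>UNIV. pmf d s * h $ s) = 0"
    by (simp add: h_def axis_def right_diff_distrib sum_subtractf sum_pmf_UNIV if_distrib[of "\<lambda>x. _ * x"]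
        flip: sum_distrib_right cong: if_cong)
  have one: "mat_pow ?Q k *v 1 = 1" for k
    using stochastic_mat_pow[OF stochastic_trans_mat[of P \<mu>], of k]
    by (simp add: stochastic_def matrix_vector_mult_def vec_eq_iff)
  have diff: "norm (prob {\<omega>\<in>space M. S t \<omega> = s} - pmf d s) \<le> C * norm h * q ^ t" for t
  proof -
    have int: "integrable M (\<lambda>\<omega>. (v::real^'s) $ S t \<omega>)" for v t
      by (rule determined_integrable[of t], rule determined_compose[OF determined_S[OF order_refl]])
    have "prob {\<omega>\<in>space M. S t \<omega> = s} = expectation (indicator {\<omega>\<in>space M. S t \<omega> = s})" by simp
    also have "\<dots> = expectation (\<lambda>\<omega>. axis s 1 $ S t \<omega>)"
      by (intro Bochner_Integration.integral_cong) (auto simp: indicator_def axis_def)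
    finally have "prob {\<omega>\<in>space M. S t \<omega> = s} - pmf d s = expectation (\<lambda>\<omega>. h $ S t \<omega>)"
      using int[of "axis s 1" t] by (simp add: h_def prob_space)
    also have "\<dots> = expectation (\<lambda>\<omega>. (mat_pow ?Q t *v h) $ S 0 \<omega>)" by (rule expectation_state)
    also have "norm \<dots> \<le> expectation (\<lambda>\<omega>. norm ((mat_pow ?Q t *v h) $ S 0 \<omega>))"
      by (rule integral_norm_bound)
    also have "\<dots> \<le> expectation (\<lambda>\<omega>. C * q ^ t * norm h)"
      by (intro integral_mono integrable_norm int) (use mix[OF h0] in auto)
    finally show ?thesis by (simp add: prob_space mult_ac)
  qed
  have "(\<lambda>t. C * norm h * q ^ t) \<longlonglongrightarrow> C * norm h * 0"
    using C by (intro tendsto_intros LIMSEQ_power_zero) auto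
  then have "(\<lambda>t. prob {\<omega>\<in>space M. S t \<omega> = s} - pmf d s) \<longlonglongrightarrow> 0"
    by (intro Lim_null_comparison[OF always_eventually[OF allI[OF diff]]]) simp
  then show ?thesis by (simp add: LIM_zero_iff)
qed

lemma emphasis_eq_expected_followon:
  "emphasis t s = expected_followon n \<gamma> \<pi> \<mu> M S A t s * prob {\<omega>\<in>space M. S t \<omega> = s}"
proof -
  let ?E = "{\<omega>\<in>space M. S t \<omega> = s}"
  have eq: "emphasis t s = (LINT \<omega>:?E|M. F t \<omega>)"
    unfolding emphasis_def set_lebesgue_integral_def
    by (intro Bochner_Integration.integral_cong) (auto simp: indicator_def)
  show ?thesis
  proof (cases "prob ?E = 0")
    \<comment> \<open>On a null event the value of the conditional expectation is multiplied by 0,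
      and the emphasis vanishes as an integral over a null set.\<close>
    case True
    have "?E \<in> null_sets M" using True by (auto simp: null_sets_def emeasure_eq_measure)
    then have "AE \<omega> in M. \<omega> \<notin> ?E" by (rule AE_not_in)
    from this AE_space have "AE \<omega> in M. F t \<omega> * of_bool (S t \<omega> = s) = 0" by eventually_elim auto
    then have "emphasis t s = 0" unfolding emphasis_def by (rule integral_eq_zero_AE)
    then show ?thesis using True by simp
  qed (simp add: eq expected_followon_def cond_expectation_def)
qed

definition "limit_emphasis s = pmf d s * lim (\<lambda>t. expected_followon n \<gamma> \<pi> \<mu> M S A t s)"

context
  assumes followon_limit: "\<And>s. convergent (\<lambda>t. expected_followon n \<gamma> \<pi> \<mu> M S A t s)"
begin

lemma emphasis_tendsto: "(\<lambda>t. emphasis t s) \<longlonglongrightarrow> limit_emphasis s"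
  unfolding emphasis_eq_expected_followon limit_emphasis_def mult.commute[of "pmf d s"]
  by (intro tendsto_mult state_distribution_tendsto followon_limit[THEN convergent_LIMSEQ_iff[THEN iffD1]])

lemma limit_emphasis_nonneg: "limit_emphasis s \<ge> 0"
  using emphasis_tendsto
  by (rule LIMSEQ_le_const) (auto simp: emphasis_def followon_nonneg intro!: integral_nonneg_AE)

text \<open>One and the same sequence, the emphasis shifted by n, converges to both sides.\<close>

lemma limit_emphasis_balance:
  "limit_emphasis s = pmf d s + (\<Sum>s'\<in>UNIV. limit_emphasis s' * mat_pow B n $ s' $ s)"
proof (rule LIMSEQ_unique)
  show "(\<lambda>t. emphasis (t + n) s) \<longlonglongrightarrow> limit_emphasis s"
    by (rule LIMSEQ_ignore_initial_segment[OF emphasis_tendsto])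
  show "(\<lambda>t. emphasis (t + n) s) \<longlonglongrightarrow> pmf d s + (\<Sum>s'\<in>UNIV. limit_emphasis s' * mat_pow B n $ s' $ s)"
    unfolding emphasis_step
    by (intro tendsto_intros emphasis_tendsto LIMSEQ_ignore_initial_segment[OF state_distribution_tendsto])
qed

text \<open>\<eta> and c are chosen before f, so they serve all trace models at once. The balanced
  weights give \<delta> / 2 * |x|^2 for x = \<Phi> e, the perturbation of the weights takes away at
  most half of it, and full column rank transfers the rest from x to e.\<close>

proposition key_matrix_positive_definite:
  fixes \<phi> :: "'s \<Rightarrow> real ^ 'd"
  assumes features: "rank (feature_mat \<phi>) = CARD('d)"
  shows "\<exists>\<eta>>0. \<exists>c>0. \<forall>f. mat_norm (D_theta d f - D_followon d n \<gamma> \<pi> \<mu> M S A) < \<eta> \<longrightarrow>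
    (\<forall>e. c * (norm e)\<^sup>2 \<le> e \<bullet> (xetd_A P \<gamma> \<pi> n \<phi> d f *v e))"
proof -
  let ?\<Phi> = "feature_mat \<phi>" and ?C = "mat_pow B n"
  have "linear ((*v) ?\<Phi>)" "inj ((*v) ?\<Phi>)"
    using features by (auto simp: full_rank_injective)
  then obtain c0 where c0: "c0 > 0" "\<And>e. c0 * norm e \<le> norm (?\<Phi> *v e)"
    using linear_inj_bounded_below_pos by blast
  define \<delta> where "\<delta> = Min (range (pmf d))"
  have \<delta>: "\<delta> > 0" "\<And>s. \<delta> \<le> pmf d s"
    using stationary_pos[OF stochastic_trans_mat ergodic stationary] by (auto simp: \<delta>_def)
  \<comment> \<open>Adding 1 keeps the divisor in \<eta> positive even if the norm is 0.\<close>
  define K where "K = mat_norm (mat 1 - ?C) + 1"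
  have "K > 0" using mat_norm_nonneg[of "mat 1 - ?C"] by (simp add: K_def)
  \<comment> \<open>As |z| \<le> K * |x|, the perturbation changes the form by at most \<eta> * K *
    |x|^2 = \<delta> / 4 * |x|^2.\<close>
  define \<eta> where "\<eta> = \<delta> / (4 * K)"
  have \<eta>: "\<eta> > 0" using \<delta> \<open>K > 0\<close> by (simp add: \<eta>_def)
  have "\<delta> / 4 * c0\<^sup>2 * (norm e)\<^sup>2 \<le> e \<bullet> (xetd_A P \<gamma> \<pi> n \<phi> d f *v e)"
    if small: "mat_norm (D_theta d f - D_followon d n \<gamma> \<pi> \<mu> M S A) < \<eta>" for f e
  proof -
    define x where "x = ?\<Phi> *v e"
    define z where "z = x - ?C *v x"
    define \<Delta> where "\<Delta> = D_theta d f - D_followon d n \<gamma> \<pi> \<mu> M S A"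
    have z: "z = (mat 1 - ?C) *v x" by (simp add: z_def matrix_vector_mult_diff_rdistrib)
    have "norm z \<le> K * norm x" unfolding z K_def
      using mat_norm_bound[of "mat 1 - ?C" x] by (simp add: distrib_right add_increasing2)
    then have "norm (\<Delta> *v z) \<le> \<eta> * (K * norm x)"
      using small mat_norm_bound[of \<Delta> z] \<eta> unfolding \<Delta>_def[symmetric]
      by (smt (verit, best) mult_mono norm_ge_zero)
    also have "\<dots> = \<delta> / 4 * norm x" using \<open>K > 0\<close> by (simp add: \<eta>_def)
    finally have "\<bar>x \<bullet> (\<Delta> *v z)\<bar> \<le> norm x * (\<delta> / 4 * norm x)"
      using Cauchy_Schwarz_ineq2[of x "\<Delta> *v z"] mult_left_mono[of _ _ "norm x"] by (meson norm_ge_zero order_trans)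
    then have pert: "x \<bullet> (\<Delta> *v z) \<ge> - (\<delta> / 4 * (norm x)\<^sup>2)"
      by (simp add: power2_eq_square abs_le_iff mult_ac)
    have "(norm x)\<^sup>2 = (\<Sum>s\<in>UNIV. (x $ s)\<^sup>2)"
      by (simp add: norm_vec_def L2_set_def sum_nonneg)
    then have "\<delta> / 2 * (norm x)\<^sup>2 = (\<Sum>s\<in>UNIV. \<delta> * (x $ s)\<^sup>2) / 2"
      by (simp flip: sum_distrib_left)
    also have "\<dots> \<le> (\<Sum>s\<in>UNIV. pmf d s * (x $ s)\<^sup>2) / 2"
      using \<delta> by (intro divide_right_mono sum_mono mult_right_mono) auto
    also have "\<dots> \<le> (\<Sum>s\<in>UNIV. limit_emphasis s * x $ s * (x - ?C *v x) $ s)"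
      by (intro balanced_quadratic_form substochastic_mat_pow substochastic_discounted discount
        limit_emphasis_nonneg limit_emphasis_balance)
    finally have main: "\<delta> / 2 * (norm x)\<^sup>2 \<le> (\<Sum>s\<in>UNIV. limit_emphasis s * x $ s * z $ s)"
      by (simp add: z_def)
    have "e \<bullet> (xetd_A P \<gamma> \<pi> n \<phi> d f *v e) = x \<bullet> (D_theta d f *v z)"
      unfolding xetd_A_quadratic x_def[symmetric] z_def[symmetric]
      by (simp add: D_theta_def inner_vec_def diag_mat_vec mult_ac)
    also have "\<dots> = x \<bullet> (\<Delta> *v z) + x \<bullet> (D_followon d n \<gamma> \<pi> \<mu> M S A *v z)"
      by (simp add: \<Delta>_def matrix_vector_mult_diff_rdistrib inner_diff_right)
    also have "x \<bullet> (D_followon d n \<gamma> \<pi> \<mu> M S A *v z) = (\<Sum>s\<in>UNIV. limit_emphasis s * x $ s * z $ s)"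
      by (simp add: D_followon_def limit_emphasis_def inner_vec_def diag_mat_vec mult_ac)
    finally have "\<delta> / 4 * (norm x)\<^sup>2 \<le> e \<bullet> (xetd_A P \<gamma> \<pi> n \<phi> d f *v e)"
      using main pert by simp
    moreover have "(c0 * norm e)\<^sup>2 \<le> (norm x)\<^sup>2"
      unfolding x_def by (intro power_mono c0) (use c0 in auto)
    then have "\<delta> / 4 * c0\<^sup>2 * (norm e)\<^sup>2 \<le> \<delta> / 4 * (norm x)\<^sup>2"
      using \<delta> by (simp add: power_mult_distrib)
    ultimately show ?thesis by linarith
  qed
  then show ?thesis using \<eta> \<delta> c0
    by (intro exI[of _ \<eta>] conjI exI[of _ "\<delta> / 4 * c0\<^sup>2"]) auto
qed

end

end

end

section \<open>Convergence of the iterates\<close>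

lemma finite_type_bound: "\<exists>K\<ge>0. \<forall>b. \<bar>g b\<bar> \<le> K" for g :: "'b::finite \<Rightarrow> real"
proof (intro exI conjI allI)
  show "(\<Sum>b\<in>UNIV. \<bar>g b\<bar>) \<ge> 0" by (simp add: sum_nonneg)
  show "\<bar>g b\<bar> \<le> (\<Sum>b\<in>UNIV. \<bar>g b\<bar>)" for b by (rule member_le_sum) auto
qed

text \<open>Over at most m steps the quantity 1 + |z| grows by a factor of at most (1 + K a)^m. Each
  single step is then at most a constant times its step size, so the displacement is of the order of
  the window sum, relative to the size at the start.\<close>

lemma affine_growth:
  fixes z :: "nat \<Rightarrow> 'v::real_normed_vector"
  assumes step: "\<And>t. norm (z (Suc t) - z t) \<le> \<alpha> t * (K * (1 + norm (z t)))"
    and \<alpha>: "\<And>t. 0 \<le> \<alpha> t" "\<And>t. \<alpha> t \<le> a" and K: "K \<ge> 0" and j: "j \<le> m"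
  shows "1 + norm (z (t + j)) \<le> (1 + K * a) ^ m * (1 + norm (z t))"
    and "norm (z (t + j) - z t) \<le> K * (1 + K * a) ^ m * (\<Sum>i<m. \<alpha> (t + i)) * (1 + norm (z t))"
proof -
  let ?p = "1 + norm (z t)"
  have a: "a \<ge> 0" using \<alpha>[of 0] by linarith
  have one: "1 \<le> 1 + K * a" using K a by simp
  have p: "?p > 0" using norm_ge_zero[of "z t"] by linarith
  have pow: "1 + norm (z (t + i)) \<le> (1 + K * a) ^ i * ?p" for i
  proof (induction i)
    case (Suc i)
    have q: "0 \<le> 1 + norm (z (t + i))" by (simp add: add_nonneg_nonneg)
    have "norm (z (t + Suc i)) \<le> norm (z (t + i)) + \<alpha> (t + i) * (K * (1 + norm (z (t + i))))"
      using step[of "t + i"] norm_triangle_sub[of "z (Suc (t + i))" "z (t + i)"] by simp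
    also have "\<dots> \<le> norm (z (t + i)) + a * (K * (1 + norm (z (t + i))))"
      using \<alpha> K q by (intro add_left_mono mult_right_mono) auto
    finally have "1 + norm (z (t + Suc i)) \<le> (1 + K * a) * (1 + norm (z (t + i)))"
      by (simp add: algebra_simps)
    also have "\<dots> \<le> (1 + K * a) * ((1 + K * a) ^ i * ?p)"
      using Suc one by (intro mult_left_mono) auto
    finally show ?case by (simp add: mult.assoc)
  qed simp
  have powm: "1 + norm (z (t + i)) \<le> (1 + K * a) ^ m * ?p" if "i \<le> m" for i
    using pow[of i] mult_right_mono[OF power_increasing[OF that one], of ?p] p by linarith
  then show "1 + norm (z (t + j)) \<le> (1 + K * a) ^ m * ?p" using j .
  have "norm (z (t + j) - z t) = norm (\<Sum>i<j. z (Suc (t + i)) - z (t + i))"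
    using sum_lessThan_telescope[of "\<lambda>i. z (t + i)" j] by simp
  also have "\<dots> \<le> (\<Sum>i<j. norm (z (Suc (t + i)) - z (t + i)))" by (rule norm_sum)
  also have "\<dots> \<le> (\<Sum>i<j. \<alpha> (t + i) * (K * ((1 + K * a) ^ m * ?p)))"
  proof (rule sum_mono)
    fix i assume "i \<in> {..<j}"
    then have "K * (1 + norm (z (t + i))) \<le> K * ((1 + K * a) ^ m * ?p)"
      using powm j K by (intro mult_left_mono) auto
    then show "norm (z (Suc (t + i)) - z (t + i)) \<le> \<alpha> (t + i) * (K * ((1 + K * a) ^ m * ?p))"
      using step[of "t + i"] mult_left_mono[OF _ \<alpha>(1)[of "t + i"]] by (meson order_trans)
  qed
  also have "\<dots> = K * ((1 + K * a) ^ m * ?p) * (\<Sum>i<j. \<alpha> (t + i))"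
    by (simp add: sum_distrib_right[symmetric] mult.commute)
  also have "\<dots> \<le> K * ((1 + K * a) ^ m * ?p) * (\<Sum>i<m. \<alpha> (t + i))"
    using \<alpha> K p j one by (intro mult_left_mono sum_mono2) auto
  finally show "norm (z (t + j) - z t) \<le> K * (1 + K * a) ^ m * (\<Sum>i<m. \<alpha> (t + i)) * ?p"
    by (simp add: mult_ac)
qed

text \<open>Cauchy-Schwarz bounds the squared window sum by m times the sum of the m
  squares.\<close>

lemma window_square_summable:
  fixes \<alpha> :: "nat \<Rightarrow> real"
  assumes "summable (\<lambda>t. (\<alpha> t)\<^sup>2)"
  shows "summable (\<lambda>t. (\<Sum>i<m. \<alpha> (t + i))\<^sup>2)"
proof (rule summable_comparison_test')
  show "summable (\<lambda>t. (\<Sum>i<m. (\<alpha> (t + i))\<^sup>2) * real m)"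
    using assms by (intro summable_mult2 summable_sum) (simp add: summable_iff_shift[of "\<lambda>t. (\<alpha> t)\<^sup>2"])
  show "norm ((\<Sum>i<m. \<alpha> (t + i))\<^sup>2) \<le> (\<Sum>i<m. (\<alpha> (t + i))\<^sup>2) * real m" for t
    using sum_squared_le_sum_of_squares[of "\<lambda>i. \<alpha> (t + i)" "{..<m}"] by simp
qed

text \<open>Here the limit point is any solution of A w = b, and definiteness and mixing are
  assumptions. This separates the stochastic approximation argument from the followon trace.\<close>

locale xetd_iteration = off_policy P \<mu> M S A \<pi> \<gamma>
  for P :: "'s::finite \<Rightarrow> 'a::finite \<Rightarrow> 's pmf" and \<mu> :: "'s \<Rightarrow> 'a pmf"
    and M :: "'w measure" and S :: "nat \<Rightarrow> 'w \<Rightarrow> 's" and A :: "nat \<Rightarrow> 'w \<Rightarrow> 'a"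
    and \<pi> :: "'s \<Rightarrow> 'a pmf" and \<gamma> :: "'s \<Rightarrow> real" +
  fixes r :: "'s \<Rightarrow> 'a \<Rightarrow> real" and n :: nat and \<phi> :: "'s \<Rightarrow> real ^ 'd" and d :: "'s pmf"
    and \<alpha> :: "nat \<Rightarrow> real" and f :: "'s \<Rightarrow> real" and w0 w_lim :: "real ^ 'd" and c :: real
    and C q :: real
  assumes discount: "\<And>s. 0 \<le> \<gamma> s \<and> \<gamma> s \<le> 1"
    and \<alpha>_nonneg: "\<And>t. \<alpha> t \<ge> 0" and \<alpha>_diverges: "\<not> summable \<alpha>"
    and \<alpha>_square_summable: "summable (\<lambda>t. (\<alpha> t)\<^sup>2)"
    and c_pos: "c > 0"
    and definite: "\<And>e. c * (norm e)\<^sup>2 \<le> e \<bullet> (xetd_A P \<gamma> \<pi> n \<phi> d f *v e)"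
    and w_lim: "xetd_A P \<gamma> \<pi> n \<phi> d f *v w_lim = xetd_b P r \<gamma> \<pi> n \<phi> d f"
    and C_pos: "C > 0" and q: "0 < q" "q < 1"
    and mixing: "\<And>h k s. (\<Sum>s\<in>UNIV. pmf d s * h $ s) = 0 \<Longrightarrow>
      \<bar>(mat_pow (trans_mat P \<mu>) k *v h) $ s\<bar> \<le> C * q ^ k * norm h"
begin

abbreviation "\<Phi> \<equiv> feature_mat \<phi>"
abbreviation "\<A> \<equiv> xetd_A P \<gamma> \<pi> n \<phi> d f"

definition "err t \<omega> = xetd r \<gamma> \<pi> \<mu> n \<phi> S A \<alpha> f w0 t \<omega> - w_lim"

text \<open>The argument x is kept apart from the iterate, so that the direction of a later update
  can be evaluated at an earlier, frozen error.\<close>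

definition "direction t x \<omega> = (f (S t \<omega>) * td_error_sum r n t (\<Phi> *v (w_lim + x)) \<omega>) *\<^sub>R \<phi> (S t \<omega>)"

definition "mean_td x = nstep_reward_vec P r \<gamma> \<pi> n + mat_pow B n *v (\<Phi> *v (w_lim + x)) - \<Phi> *v (w_lim + x)"

text \<open>The first term is x paired with the conditional mean of the direction in state s. Its
  stationary mean is minus the quadratic form of A at x, because A w_lim = b; the added term
  therefore centres it.\<close>

definition "noise x = (\<chi> s. f s * (\<Phi> *v x) $ s * mean_td x $ s + x \<bullet> (\<A> *v x))"

definition "corr t x = poisson_corrector (trans_mat P \<mu>) \<alpha> t (noise x)"

text \<open>The factor 2 matches the cross term in the expansion of the squared norm of the next
  error.\<close>

definition "lyap t \<omega> = (norm (err t \<omega>))\<^sup>2 + 2 * corr t (err t \<omega>) $ S t \<omega>"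

lemma err_Suc: "err (Suc t) \<omega> = err t \<omega> + \<alpha> t *\<^sub>R direction t (err t \<omega>) \<omega>"
  by (simp add: err_def direction_def Let_def td_error_sum_def feature_mat_vec mult.assoc)

text \<open>For t > 0 the last update entering \<open>err t\<close> starts at t - 1 and reads the
  trajectory up to time t - 1 + n, in general beyond the history at t.\<close>

lemma determined_err: "determined (t + n) (err t)"
proof (induction t)
  case 0
  then show ?case by (simp add: err_def[abs_def] determined_const)
next
  case (Suc t)
  have e: "determined (Suc t + n) (err t)" by (rule determined_mono[OF Suc]) simp
  have td: "determined (Suc t + n) (\<lambda>\<omega>. td_error_sum r n t (\<Phi> *v (w_lim + err t \<omega>)) \<omega>)"
    by (rule determined_td_error_sum[OF determined_compose[OF e]]) simp
  have "determined (Suc t + n) (\<lambda>\<omega>. direction t (err t \<omega>) \<omega>)"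
    unfolding direction_def
    by (rule determined_compose2[OF td determined_S[of t], of "\<lambda>y s. (f s * y) *\<^sub>R \<phi> s"]) simp
  from determined_compose2[OF e this, of "\<lambda>x y. x + \<alpha> t *\<^sub>R y"]
  show ?case by (simp add: err_Suc[abs_def])
qed

lemma determined_lyap: "determined (t + n) (lyap t)"
  unfolding lyap_def
  by (rule determined_compose2[OF determined_err determined_S[of t],
    where F = "\<lambda>x s. (norm x)\<^sup>2 + 2 * corr t x $ s"]) simp

section \<open>Growth and Lipschitz bounds for the update and the noise\<close>

lemma ratio_bound: "\<exists>R\<ge>1. \<forall>t \<omega>. \<bar>\<rho> t \<omega>\<bar> \<le> R"
proof -
  obtain K where K: "\<And>x. \<bar>case x of (s, a) \<Rightarrow> pmf (\<pi> s) a / pmf (\<mu> s) a\<bar> \<le> K"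
    using finite_type_bound[of "\<lambda>(s, a). pmf (\<pi> s) a / pmf (\<mu> s) a"] by blast
  have "\<bar>\<rho> t \<omega>\<bar> \<le> max 1 K" for t \<omega>
    using K[of "(S t \<omega>, A t \<omega>)"] by (simp add: is_ratio_def)
  then show ?thesis by (intro exI[of _ "max 1 K"]) simp
qed

text \<open>One constant serves both claims. In each summand a change of v by b costs at most 2 * b,
  since \<gamma> \<le> 1, the rewards contribute at most \<open>Kr\<close>, and the weights are at
  most R^n; R \<ge> 1 makes shorter products comparable.\<close>

lemma td_error_sum_bounds:
  "\<exists>K\<ge>0. \<forall>t \<omega> v v' b. (\<forall>s. \<bar>v $ s - v' $ s\<bar> \<le> b) \<longrightarrow>
    \<bar>td_error_sum r n t v \<omega> - td_error_sum r n t v' \<omega>\<bar> \<le> K * b \<and> \<bar>td_error_sum r n t 0 \<omega>\<bar> \<le> K"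
proof -
  obtain R where R: "R \<ge> 1" "\<And>t \<omega>. \<bar>\<rho> t \<omega>\<bar> \<le> R" using ratio_bound by blast
  obtain Kr where Kr: "Kr \<ge> 0" "\<And>x. \<bar>case x of (s, a) \<Rightarrow> r s a\<bar> \<le> Kr"
    using finite_type_bound[of "\<lambda>(s, a). r s a"] by blast
  define W where "W t k \<omega> = (\<Prod>i\<in>{t..<k}. \<gamma> (S (Suc i) \<omega>) * \<rho> i \<omega>) * \<rho> k \<omega>" for t k \<omega>
  have W: "\<bar>W t k \<omega>\<bar> \<le> R ^ n" if "k \<in> {t..<t+n}" for t k \<omega>
  proof -
    have "\<bar>W t k \<omega>\<bar> = (\<Prod>i\<in>{t..<k}. \<bar>\<gamma> (S (Suc i) \<omega>) * \<rho> i \<omega>\<bar>) * \<bar>\<rho> k \<omega>\<bar>"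
      by (simp add: W_def abs_mult abs_prod)
    also have "\<dots> \<le> (\<Prod>i\<in>{t..<k}. R) * R"
    proof (intro mult_mono prod_mono conjI)
      fix i
      have "\<bar>\<gamma> (S (Suc i) \<omega>)\<bar> * \<bar>\<rho> i \<omega>\<bar> \<le> 1 * R"
        using R discount by (intro mult_mono) auto
      then show "\<bar>\<gamma> (S (Suc i) \<omega>) * \<rho> i \<omega>\<bar> \<le> R" by (simp add: abs_mult)
    qed (use R in \<open>auto intro!: prod_nonneg\<close>)
    also have "\<dots> = R ^ Suc (k - t)" by simp
    also have "\<dots> \<le> R ^ n" using R that by (intro power_increasing) auto
    finally show ?thesis .
  qed
  have td: "td_error_sum r n t v \<omega> = (\<Sum>k\<in>{t..<t+n}. W t k \<omega> *
     (r (S k \<omega>) (A k \<omega>) + \<gamma> (S (Suc k) \<omega>) * v $ S (Suc k) \<omega> - v $ S k \<omega>))" for t v \<omega>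
    by (simp add: td_error_sum_def W_def)
  have Rn: "0 \<le> R ^ n" using R by simp
  have lip: "\<bar>td_error_sum r n t v \<omega> - td_error_sum r n t v' \<omega>\<bar> \<le> (real n * R ^ n * (Kr + 2)) * b"
    if b: "\<And>s. \<bar>v $ s - v' $ s\<bar> \<le> b" for t \<omega> v v' b
  proof -
    have b0: "b \<ge> 0" using b[of undefined] by linarith
    have "\<bar>td_error_sum r n t v \<omega> - td_error_sum r n t v' \<omega>\<bar> = \<bar>\<Sum>k\<in>{t..<t+n}. W t k \<omega> *
        (\<gamma> (S (Suc k) \<omega>) * (v $ S (Suc k) \<omega> - v' $ S (Suc k) \<omega>) - (v $ S k \<omega> - v' $ S k \<omega>))\<bar>"
      unfolding td sum_subtractf[symmetric] by (simp add: algebra_simps)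
    also have "\<dots> \<le> (\<Sum>k\<in>{t..<t+n}. \<bar>W t k \<omega> *
        (\<gamma> (S (Suc k) \<omega>) * (v $ S (Suc k) \<omega> - v' $ S (Suc k) \<omega>) - (v $ S k \<omega> - v' $ S k \<omega>))\<bar>)"
      by (rule sum_abs)
    also have "\<dots> \<le> (\<Sum>k\<in>{t..<t+n}. R ^ n * (2 * b))"
    proof (rule sum_mono)
      fix k assume k: "k \<in> {t..<t+n}"
      have "\<bar>\<gamma> (S (Suc k) \<omega>) * (v $ S (Suc k) \<omega> - v' $ S (Suc k) \<omega>)\<bar> \<le> 1 * b"
        unfolding abs_mult using b discount by (intro mult_mono) auto
      then have "\<bar>\<gamma> (S (Suc k) \<omega>) * (v $ S (Suc k) \<omega> - v' $ S (Suc k) \<omega>) - (v $ S k \<omega> - v' $ S k \<omega>)\<bar> \<le> 2 * b"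
        using b[of "S k \<omega>"] by linarith
      then show "\<bar>W t k \<omega> * (\<gamma> (S (Suc k) \<omega>) * (v $ S (Suc k) \<omega> - v' $ S (Suc k) \<omega>)
          - (v $ S k \<omega> - v' $ S k \<omega>))\<bar> \<le> R ^ n * (2 * b)"
        unfolding abs_mult using W[OF k] Rn by (intro mult_mono) auto
    qed
    also have "\<dots> = real n * R ^ n * 2 * b" by simp
    also have "\<dots> \<le> real n * R ^ n * (Kr + 2) * b"
      using Kr Rn b0 by (intro mult_right_mono mult_left_mono) auto
    finally show ?thesis .
  qed
  have zero: "\<bar>td_error_sum r n t 0 \<omega>\<bar> \<le> real n * R ^ n * (Kr + 2)" for t \<omega>
  proof -
    have "\<bar>td_error_sum r n t 0 \<omega>\<bar> \<le> (\<Sum>k\<in>{t..<t+n}. \<bar>W t k \<omega> * r (S k \<omega>) (A k \<omega>)\<bar>)"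
      unfolding td by simp
    also have "\<dots> \<le> (\<Sum>k\<in>{t..<t+n}. R ^ n * Kr)"
    proof (rule sum_mono)
      fix k assume k: "k \<in> {t..<t+n}"
      show "\<bar>W t k \<omega> * r (S k \<omega>) (A k \<omega>)\<bar> \<le> R ^ n * Kr"
        unfolding abs_mult using W[OF k] Kr(2)[of "(S k \<omega>, A k \<omega>)"] Rn by (intro mult_mono) auto
    qed
    also have "\<dots> = real n * R ^ n * Kr" by simp
    also have "\<dots> \<le> real n * R ^ n * (Kr + 2)" using Rn by (intro mult_left_mono) auto
    finally show ?thesis .
  qed
  show ?thesis
    using lip zero Rn Kr by (intro exI[of _ "real n * R ^ n * (Kr + 2)"]) auto
qed

lemma direction_bounds:
  "\<exists>K\<ge>0. \<forall>t \<omega> x y. norm (direction t x \<omega>) \<le> K * (1 + norm x) \<and>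
     norm (direction t x \<omega> - direction t y \<omega>) \<le> K * norm (x - y)"
proof -
  obtain K0 where K0: "K0 \<ge> 0" "\<And>t \<omega> v v' b. (\<And>s. \<bar>v $ s - v' $ s\<bar> \<le> b) \<Longrightarrow>
    \<bar>td_error_sum r n t v \<omega> - td_error_sum r n t v' \<omega>\<bar> \<le> K0 * b \<and> \<bar>td_error_sum r n t 0 \<omega>\<bar> \<le> K0"
    using td_error_sum_bounds by blast
  obtain K1 where K1: "K1 \<ge> 0" "\<And>s. \<bar>norm (f s *\<^sub>R \<phi> s)\<bar> \<le> K1"
    using finite_type_bound[of "\<lambda>s. norm (f s *\<^sub>R \<phi> s)"] by blast
  define L where "L = mat_norm \<Phi>"
  have L: "\<bar>(\<Phi> *v w) $ s\<bar> \<le> L * norm w" "L \<ge> 0" for w s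
    using component_le_norm_cart[of "\<Phi> *v w" s] mat_norm_bound[of \<Phi> w]
    by (auto simp: L_def mat_norm_nonneg)
  have dir: "direction t x \<omega> = td_error_sum r n t (\<Phi> *v (w_lim + x)) \<omega> *\<^sub>R (f (S t \<omega>) *\<^sub>R \<phi> (S t \<omega>))" for t x \<omega>
    by (simp add: direction_def mult.commute)
  have norm_dir: "norm (y *\<^sub>R (f (S t \<omega>) *\<^sub>R \<phi> (S t \<omega>))) \<le> z * K1" if "\<bar>y\<bar> \<le> z" for y z t \<omega>
    unfolding norm_scaleR[of y] using K1(2)[of "S t \<omega>"] that K1(1) by (intro mult_mono) auto
  have lip: "norm (direction t x \<omega> - direction t y \<omega>) \<le> K0 * L * K1 * norm (x - y)" for t \<omega> x y
  proof -
    have "\<bar>(\<Phi> *v (w_lim + x)) $ s - (\<Phi> *v (w_lim + y)) $ s\<bar> \<le> L * norm (x - y)" for s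
      using L(1)[of "x - y" s] by (simp add: matrix_vector_right_distrib matrix_vector_mult_diff_distrib)
    then have "\<bar>td_error_sum r n t (\<Phi> *v (w_lim + x)) \<omega> - td_error_sum r n t (\<Phi> *v (w_lim + y)) \<omega>\<bar>
        \<le> K0 * (L * norm (x - y))" using K0 by blast
    from norm_dir[OF this] show ?thesis unfolding dir scaleR_left_diff_distrib[symmetric]
      by (simp add: mult_ac)
  qed
  have zero: "norm (direction t 0 \<omega>) \<le> (K0 * (L * norm w_lim) + K0) * K1" for t \<omega>
  proof -
    have "\<bar>(\<Phi> *v (w_lim + 0)) $ s - (0::real^'s) $ s\<bar> \<le> L * norm w_lim" for s
      using L(1)[of w_lim s] by simp
    from K0(2)[OF this, of t \<omega>] have "\<bar>td_error_sum r n t (\<Phi> *v (w_lim + 0)) \<omega>\<bar> \<le> K0 * (L * norm w_lim) + K0"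
      by linarith
    then show ?thesis unfolding dir by (rule norm_dir)
  qed
  define K where "K = K0 * L * K1 + (K0 * (L * norm w_lim) + K0) * K1"
  have K: "K \<ge> 0" "K0 * L * K1 \<le> K" "(K0 * (L * norm w_lim) + K0) * K1 \<le> K"
    unfolding K_def using K0(1) K1(1) L(2) by auto
  have "norm (direction t x \<omega>) \<le> K * (1 + norm x)" for t \<omega> x
  proof -
    have "norm (direction t x \<omega>) \<le> norm (direction t 0 \<omega>) + norm (direction t x \<omega> - direction t 0 \<omega>)"
      by (rule norm_triangle_sub)
    also have "\<dots> \<le> K + K0 * L * K1 * norm x"
      using zero[of t \<omega>] lip[of t x \<omega> 0] K(3) by simp
    also have "\<dots> \<le> K + K * norm x" using K(2) by (intro add_left_mono mult_right_mono) auto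
    finally show ?thesis by (simp add: distrib_left)
  qed
  moreover have "norm (direction t x \<omega> - direction t y \<omega>) \<le> K * norm (x - y)" for t \<omega> x y
    using lip[of t x \<omega> y] mult_right_mono[OF K(2), of "norm (x - y)"] by simp
  ultimately show ?thesis using K by blast
qed

lemma noise_mean_zero: "(\<Sum>s\<in>UNIV. pmf d s * noise x $ s) = 0"
proof -
  let ?w = "w_lim + x"
  have "(\<Sum>s\<in>UNIV. pmf d s * noise x $ s)
      = (\<Sum>s\<in>UNIV. pmf d s * f s * (\<Phi> *v x) $ s * nstep_reward_vec P r \<gamma> \<pi> n $ s)
        - (\<Sum>s\<in>UNIV. pmf d s * f s * (\<Phi> *v x) $ s * (\<Phi> *v ?w - mat_pow B n *v (\<Phi> *v ?w)) $ s)
        + (\<Sum>s\<in>UNIV. pmf d s) * (x \<bullet> (\<A> *v x))"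
    unfolding sum_distrib_right sum_subtractf[symmetric] sum.distrib[symmetric]
    by (intro sum.cong refl) (simp add: noise_def mean_td_def algebra_simps)
  also have "\<dots> = x \<bullet> xetd_b P r \<gamma> \<pi> n \<phi> d f - x \<bullet> (\<A> *v ?w) + x \<bullet> (\<A> *v x)"
    unfolding xetd_A_quadratic[of x P \<gamma> \<pi> n \<phi> d f ?w] xetd_b_inner by (simp add: sum_pmf_UNIV)
  also have "\<dots> = 0" unfolding w_lim[symmetric]
    by (simp add: matrix_vector_right_distrib inner_add_right)
  finally show ?thesis .
qed

lemma noise_zero: "noise 0 = 0"
  by (simp add: noise_def vec_eq_iff)

text \<open>The noise is a quadratic polynomial in x, so its Lipschitz constant grows with the size
  of the arguments.\<close>

lemma noise_lipschitz:
  "\<exists>K\<ge>0. \<forall>x y. norm (noise x - noise y) \<le> K * norm (x - y) * (1 + norm x + norm y)"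
proof -
  define T where "T = mat_pow B n ** \<Phi> - \<Phi>"
  define N where "N = mat_norm \<Phi> + mat_norm T + mat_norm \<A> + norm (mean_td 0)"
  have N: "N \<ge> 0" "mat_norm \<Phi> \<le> N" "mat_norm T \<le> N" "mat_norm \<A> \<le> N" "norm (mean_td 0) \<le> N"
    unfolding N_def using mat_norm_nonneg[of \<Phi>] mat_norm_nonneg[of T] mat_norm_nonneg[of \<A>]
      norm_ge_zero[of "mean_td 0"] by linarith+
  obtain F0 where F0: "F0 \<ge> 0" "\<And>s. \<bar>f s\<bar> \<le> F0" using finite_type_bound[of f] by blast
  have bound: "norm (X *v x) \<le> N * norm x" if "mat_norm X \<le> N" for X :: "real ^ 'd ^ 'j::finite" and x
    using mat_norm_bound[of X x] mult_right_mono[OF that, of "norm x"] by simp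
  have comp: "\<bar>(X *v x) $ s\<bar> \<le> N * norm x" if "mat_norm X \<le> N" for X :: "real ^ 'd ^ 's" and x s
    using bound[OF that, of x] component_le_norm_cart[of "X *v x" s] by simp
  have mean: "mean_td x = mean_td 0 + T *v x" for x
    by (simp add: mean_td_def T_def matrix_vector_right_distrib matrix_vector_mult_diff_rdistrib
        matrix_vector_mul_assoc)
  \<comment> \<open>The bilinear part of the noise. The quadratic terms at x and y differ by
    \<open>\<beta> s (x - y) x + \<beta> s y (x - y)\<close>.\<close>
  define \<beta> where "\<beta> s x y = f s * (\<Phi> *v x) $ s * (T *v y) $ s + x \<bullet> (\<A> *v y)" for s x y
  have \<beta>: "\<bar>\<beta> s x y\<bar> \<le> (F0 * N * N + N) * (norm x * norm y)" for s x y
  proof -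
    have "\<bar>f s * (\<Phi> *v x) $ s * (T *v y) $ s\<bar> \<le> F0 * (N * norm x) * (N * norm y)"
      unfolding abs_mult using F0 N by (intro mult_mono comp) auto
    moreover have "\<bar>x \<bullet> (\<A> *v y)\<bar> \<le> norm x * (N * norm y)"
      using Cauchy_Schwarz_ineq2[of x "\<A> *v y"] mult_left_mono[OF bound[OF N(4), of y], of "norm x"] by simp
    ultimately show ?thesis unfolding \<beta>_def by (simp add: algebra_simps)
  qed
  define K where "K = F0 * N * N + N"
  have K: "K \<ge> 0" using F0 N by (simp add: K_def)
  have comp_noise: "noise x $ s - noise y $ s
      = f s * (\<Phi> *v (x - y)) $ s * mean_td 0 $ s + (\<beta> s (x - y) x + \<beta> s y (x - y))" for x y s
    by (simp add: noise_def mean[of x] mean[of y] \<beta>_def matrix_vector_mult_diff_distrib algebra_simps)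
  have each: "\<bar>noise x $ s - noise y $ s\<bar> \<le> K * (norm (x - y) * (1 + norm x + norm y))" for x y s
  proof -
    have "\<bar>f s * (\<Phi> *v (x - y)) $ s * mean_td 0 $ s\<bar> \<le> F0 * (N * norm (x - y)) * N"
      unfolding abs_mult using F0 N component_le_norm_cart[of "mean_td 0" s]
      by (intro mult_mono comp) auto
    also have "\<dots> \<le> K * norm (x - y)" using N(1) by (simp add: K_def algebra_simps)
    finally have "\<bar>noise x $ s - noise y $ s\<bar> \<le> K * norm (x - y) + (K * (norm (x - y) * norm x) + K * (norm y * norm (x - y)))"
      unfolding comp_noise using \<beta>[of s "x - y" x] \<beta>[of s y "x - y"] unfolding K_def by linarith
    then show ?thesis by (simp add: algebra_simps)
  qed
  have "norm (noise x - noise y) \<le> (real CARD('s) * K) * norm (x - y) * (1 + norm x + norm y)" for x y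
  proof -
    have "norm (noise x - noise y) \<le> (\<Sum>s\<in>UNIV. \<bar>(noise x - noise y) $ s\<bar>)" by (rule norm_le_l1_cart)
    also have "\<dots> \<le> (\<Sum>s::'s\<in>UNIV. K * (norm (x - y) * (1 + norm x + norm y)))"
      using each by (intro sum_mono) simp
    finally show ?thesis by (simp add: mult.assoc)
  qed
  then show ?thesis using K by (intro exI[of _ "real CARD('s) * K"]) auto
qed

text \<open>The corrector is linear in the noise, although the noise is quadratic in the error, so
  the difference of correctors is the corrector of a centred noise difference.\<close>

lemma corr_diff_bound:
  "\<bar>corr t x $ s - corr t y $ s\<bar> \<le> C * discounted_tail q \<alpha> t * norm (noise x - noise y)"
proof -
  have "(\<Sum>s\<in>UNIV. pmf d s * (noise x - noise y) $ s) = 0"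
    using noise_mean_zero[of x] noise_mean_zero[of y] by (simp add: right_diff_distrib sum_subtractf)
  from poisson_corrector_bound[OF \<alpha>_nonneg \<alpha>_square_summable q C_pos mixing this]
  show ?thesis unfolding corr_def
    by (simp add: poisson_corrector_diff[OF \<alpha>_nonneg \<alpha>_square_summable q C_pos mixing noise_mean_zero noise_mean_zero]
        flip: vector_minus_component)
qed

lemma corr_rec: "corr t x $ s = \<alpha> t * noise x $ s + (trans_mat P \<mu> *v corr (Suc t) x) $ s"
  unfolding corr_def
  by (rule poisson_corrector_rec[OF \<alpha>_nonneg \<alpha>_square_summable q C_pos mixing noise_mean_zero])

lemma expected_drift:
  assumes g: "determined t g" and x: "determined t x"
  shows "integrable M (\<lambda>\<omega>. g \<omega> * (\<alpha> t * (x \<omega> \<bullet> direction t (x \<omega>) \<omega>)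
      + corr (Suc t) (x \<omega>) $ S (Suc t) \<omega> - corr t (x \<omega>) $ S t \<omega>))" (is ?int)
    and "expectation (\<lambda>\<omega>. g \<omega> * (\<alpha> t * (x \<omega> \<bullet> direction t (x \<omega>) \<omega>)
      + corr (Suc t) (x \<omega>) $ S (Suc t) \<omega> - corr t (x \<omega>) $ S t \<omega>))
    = expectation (\<lambda>\<omega>. g \<omega> * (- \<alpha> t * (x \<omega> \<bullet> (\<A> *v x \<omega>))))" (is ?eq)
proof -
  \<comment> \<open>The product of x with the feature of \<open>S t\<close> is a component of \<Phi>
    x, so z is the scalar in front of the TD sum.\<close>
  define z where "z \<omega> = g \<omega> * f (S t \<omega>) * (\<Phi> *v x \<omega>) $ S t \<omega>" for \<omega>
  let ?v = "\<lambda>\<omega>. \<Phi> *v (w_lim + x \<omega>)"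
  have z: "determined t z" unfolding z_def
    by (rule determined_compose3[OF g x determined_S[OF order_refl],
      of "\<lambda>y x s. y * f s * (\<Phi> *v x) $ s"])
  have v: "determined t ?v" by (rule determined_compose[OF x])
  have gx: "determined t (\<lambda>\<omega>. F (g \<omega>) (x \<omega>) (S t \<omega>))" for F :: "real \<Rightarrow> real^'d \<Rightarrow> 's \<Rightarrow> 'b"
    by (rule determined_compose3[OF g x determined_S[OF order_refl]])
  have det_g: "determined t (\<lambda>\<omega>. g \<omega> *\<^sub>R corr (Suc t) (x \<omega>))" by (rule gx)
  have inner_dir: "g \<omega> * (x \<omega> \<bullet> direction t (x \<omega>) \<omega>) = z \<omega> * td_error_sum r n t (?v \<omega>) \<omega>" for \<omega>
    by (simp add: z_def direction_def feature_mat_vec mult_ac)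
  have i1: "integrable M (\<lambda>\<omega>. z \<omega> * td_error_sum r n t (?v \<omega>) \<omega>)"
    by (rule determined_integrable[of "t + n"], rule determined_compose2[OF determined_mono[OF z]
      determined_td_error_sum[OF determined_mono[OF v]], where F = "(*)"]) simp_all
  have i2: "integrable M (\<lambda>\<omega>. (g \<omega> *\<^sub>R corr (Suc t) (x \<omega>)) $ S (Suc t) \<omega>)"
    by (rule determined_integrable[of "Suc t"],
        rule determined_compose2[OF determined_mono[OF det_g] determined_S[OF order_refl], where F = "\<lambda>v s. v $ s"]) simp
  have igx: "integrable M (\<lambda>\<omega>. F (g \<omega>) (x \<omega>) (S t \<omega>))" for F :: "real \<Rightarrow> real^'d \<Rightarrow> 's \<Rightarrow> real"
    by (rule determined_integrable[OF gx])
  have i3: "integrable M (\<lambda>\<omega>. g \<omega> * corr t (x \<omega>) $ S t \<omega>)" by (rule igx)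
  have split: "(\<lambda>\<omega>. g \<omega> * (\<alpha> t * (x \<omega> \<bullet> direction t (x \<omega>) \<omega>)
      + corr (Suc t) (x \<omega>) $ S (Suc t) \<omega> - corr t (x \<omega>) $ S t \<omega>))
    = (\<lambda>\<omega>. \<alpha> t * (z \<omega> * td_error_sum r n t (?v \<omega>) \<omega>)
      + (g \<omega> *\<^sub>R corr (Suc t) (x \<omega>)) $ S (Suc t) \<omega> - g \<omega> * corr t (x \<omega>) $ S t \<omega>)"
    unfolding inner_dir[symmetric] by (simp add: algebra_simps)
  show ?int unfolding split
    by (intro Bochner_Integration.integrable_diff Bochner_Integration.integrable_add integrable_mult_right i1 i2 i3)
  have "expectation (\<lambda>\<omega>. \<alpha> t * (z \<omega> * td_error_sum r n t (?v \<omega>) \<omega>)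
      + (g \<omega> *\<^sub>R corr (Suc t) (x \<omega>)) $ S (Suc t) \<omega> - g \<omega> * corr t (x \<omega>) $ S t \<omega>)
    = \<alpha> t * expectation (\<lambda>\<omega>. z \<omega> * td_error_sum r n t (?v \<omega>) \<omega>)
      + expectation (\<lambda>\<omega>. (g \<omega> *\<^sub>R corr (Suc t) (x \<omega>)) $ S (Suc t) \<omega>)
      - expectation (\<lambda>\<omega>. g \<omega> * corr t (x \<omega>) $ S t \<omega>)"
    using i1 i2 i3 by simp
  also have "expectation (\<lambda>\<omega>. z \<omega> * td_error_sum r n t (?v \<omega>) \<omega>)
      = expectation (\<lambda>\<omega>. g \<omega> * (f (S t \<omega>) * (\<Phi> *v x \<omega>) $ S t \<omega> * mean_td (x \<omega>) $ S t \<omega>))"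
    unfolding expectation_td_error_sum[OF v z] by (simp add: z_def mean_td_def mult.assoc)
  also have "expectation (\<lambda>\<omega>. (g \<omega> *\<^sub>R corr (Suc t) (x \<omega>)) $ S (Suc t) \<omega>)
      = expectation (\<lambda>\<omega>. g \<omega> * (trans_mat P \<mu> *v corr (Suc t) (x \<omega>)) $ S t \<omega>)"
    unfolding expectation_next_state[OF det_g] by (simp add: matrix_vector_mult_scaleR)
  also have "\<alpha> t * expectation (\<lambda>\<omega>. g \<omega> * (f (S t \<omega>) * (\<Phi> *v x \<omega>) $ S t \<omega> * mean_td (x \<omega>) $ S t \<omega>))
      + expectation (\<lambda>\<omega>. g \<omega> * (trans_mat P \<mu> *v corr (Suc t) (x \<omega>)) $ S t \<omega>)
      - expectation (\<lambda>\<omega>. g \<omega> * corr t (x \<omega>) $ S t \<omega>)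
    = expectation (\<lambda>\<omega>. \<alpha> t * (g \<omega> * (f (S t \<omega>) * (\<Phi> *v x \<omega>) $ S t \<omega> * mean_td (x \<omega>) $ S t \<omega>))
      + g \<omega> * (trans_mat P \<mu> *v corr (Suc t) (x \<omega>)) $ S t \<omega> - g \<omega> * corr t (x \<omega>) $ S t \<omega>)"
    using igx[of "\<lambda>y x s. y * (f s * (\<Phi> *v x) $ s * mean_td x $ s)"]
      igx[of "\<lambda>y x s. y * (trans_mat P \<mu> *v corr (Suc t) x) $ s"] i3 by simp
  also have "\<dots> = expectation (\<lambda>\<omega>. g \<omega> * (- \<alpha> t * (x \<omega> \<bullet> (\<A> *v x \<omega>))))"
    by (intro Bochner_Integration.integral_cong refl) (simp add: corr_rec[of t] noise_def algebra_simps)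
  finally show ?eq unfolding split .
qed

lemma corr_zero: "corr t 0 = 0"
  by (simp add: corr_def noise_zero poisson_corrector_def vec_eq_iff)

text \<open>The current error \<open>err (t + n)\<close> depends on actions inside the window of the update. Replacing it
  by \<open>err t\<close> costs only products of step sizes, which are summable.\<close>

lemma lyap_increment:
  "\<exists>L\<ge>0. \<forall>t \<omega>. lyap (Suc (t + n)) \<omega> - lyap (t + n) \<omega>
     \<le> 2 * (\<alpha> (t + n) * (err t \<omega> \<bullet> direction (t + n) (err t \<omega>) \<omega>)
          + corr (Suc (t + n)) (err t \<omega>) $ S (Suc (t + n)) \<omega> - corr (t + n) (err t \<omega>) $ S (t + n) \<omega>)
       + L * ((\<Sum>i<Suc n. \<alpha> (t + i))\<^sup>2 + (discounted_tail q \<alpha> (t + n))\<^sup>2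
          + (discounted_tail q \<alpha> (Suc (t + n)))\<^sup>2) * (1 + (norm (err t \<omega>))\<^sup>2)
     \<and> norm (err (t + n) \<omega> - err t \<omega>) \<le> L * (\<Sum>i<Suc n. \<alpha> (t + i)) * (1 + norm (err t \<omega>))"
proof -
  obtain K where K: "K \<ge> 0" "\<And>t \<omega> x. norm (direction t x \<omega>) \<le> K * (1 + norm x)"
    "\<And>t \<omega> x y. norm (direction t x \<omega> - direction t y \<omega>) \<le> K * norm (x - y)"
    using direction_bounds by blast
  obtain H where H: "H \<ge> 0" "\<And>x y. norm (noise x - noise y) \<le> H * norm (x - y) * (1 + norm x + norm y)"
    using noise_lipschitz by blast
  obtain a where a: "\<And>t. \<bar>\<alpha> t\<bar> \<le> a" using square_summable_imp_bounded[OF \<alpha>_square_summable] by blast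
  have a0: "a \<ge> 0" using a[of 0] by linarith
  define G where "G = (1 + K * a) ^ Suc n"
  define L1 where "L1 = K * G"
  \<comment> \<open>Product of the corrector scale C, the noise constant H, the displacement
    constant L1, and G + 1, which bounds 1 + |z| + |x| relative to 1 + |x| for x = err t.\<close>
  define L2 where "L2 = C * H * L1 * (G + 1)"
  have G: "G \<ge> 0" unfolding G_def using K(1) a0 by simp
  have L: "L1 \<ge> 0" "L2 \<ge> 0" unfolding L2_def L1_def using K(1) G C_pos H(1) by simp_all
  have step: "norm (err (Suc t) \<omega> - err t \<omega>) \<le> \<alpha> t * (K * (1 + norm (err t \<omega>)))" for t \<omega>
    using K(2)[of t "err t \<omega>" \<omega>] \<alpha>_nonneg[of t] by (simp add: err_Suc mult_left_mono)
  have up: "\<alpha> t \<le> a" for t using a[of t] by linarith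
  \<comment> \<open>The range includes \<open>Suc n\<close> because both ends of the increment,
    \<open>err (t + n)\<close> and \<open>err (Suc (t + n))\<close>, are compared with
    \<open>err t\<close>.\<close>
  have growth: "1 + norm (err (t + j) \<omega>) \<le> G * (1 + norm (err t \<omega>))"
    "norm (err (t + j) \<omega> - err t \<omega>) \<le> L1 * (\<Sum>i<Suc n. \<alpha> (t + i)) * (1 + norm (err t \<omega>))"
    if "j \<le> Suc n" for j t \<omega>
    unfolding G_def L1_def using affine_growth[of "\<lambda>t. err t \<omega>" \<alpha> K a j "Suc n" t, OF step \<alpha>_nonneg up K(1) that]
    by (simp_all only:)
  \<comment> \<open>In the bracket, 3 * L1^2 + 2 * K * L1 comes from the squared norms and 4 * L2
    from two corrector replacements, each counted twice. The factor 2 passes from (1 + |x|)^2 to 1 +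
    |x|^2, and the summand L1 covers the displacement claim.\<close>
  define L where "L = 2 * (3 * L1\<^sup>2 + 2 * K * L1 + 4 * L2) + L1"
  have main: "lyap (Suc u) \<omega> - lyap u \<omega>
     \<le> 2 * (\<alpha> u * (x \<bullet> direction u x \<omega>) + corr (Suc u) x $ S (Suc u) \<omega> - corr u x $ S u \<omega>)
       + L * (s\<^sup>2 + (discounted_tail q \<alpha> u)\<^sup>2 + (discounted_tail q \<alpha> (Suc u))\<^sup>2) * (1 + (norm x)\<^sup>2)"
    if "u = t + n" "x = err t \<omega>" "s = (\<Sum>i<Suc n. \<alpha> (t + i))" for t u x s \<omega>
  proof -
    define p where "p = 1 + norm x"
    define y where "y = err u \<omega>"
    define y' where "y' = err (Suc u) \<omega>"
    have p: "p \<ge> 1" "norm x \<le> p" by (auto simp: p_def)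
    have s: "s \<ge> 0" unfolding that by (intro sum_nonneg \<alpha>_nonneg)
    have \<alpha>s: "\<alpha> u \<le> s" "0 \<le> \<alpha> u"
      unfolding that by (auto intro!: member_le_sum[of n "{..<Suc n}" "\<lambda>i. \<alpha> (t + i)"] simp: \<alpha>_nonneg simp del: sum.lessThan_Suc)
    have y: "1 + norm y \<le> G * p" "norm (y - x) \<le> L1 * s * p"
      using growth[of n t \<omega>] by (simp_all add: y_def p_def that del: sum.lessThan_Suc)
    have y': "1 + norm y' \<le> G * p" "norm (y' - x) \<le> L1 * s * p"
      using growth[of "Suc n" t \<omega>] by (simp_all add: y'_def p_def that del: sum.lessThan_Suc)
    have y'_eq: "y' = y + \<alpha> u *\<^sub>R direction u y \<omega>" by (simp add: y_def y'_def err_Suc)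
    have D: "norm (direction u y \<omega>) \<le> L1 * p"
      using K(2)[of u y \<omega>] mult_left_mono[OF y(1) K(1)] by (simp add: L1_def mult.assoc)
    have DD: "norm (direction u y \<omega> - direction u x \<omega>) \<le> K * (L1 * s * p)"
      using K(3)[of u y \<omega> x] mult_left_mono[OF y(2) K(1)] by simp
    \<comment> \<open>Both arguments of the inner product are moved from y to x. One factor s comes
      from the step size, the other from the displacement.\<close>
    have sq: "(norm y')\<^sup>2 - (norm y)\<^sup>2 \<le> 2 * (\<alpha> u * (x \<bullet> direction u x \<omega>)) + (3 * L1\<^sup>2 + 2 * K * L1) * (s\<^sup>2 * p\<^sup>2)"
    proof -
      have "(norm y')\<^sup>2 - (norm y)\<^sup>2 = 2 * (\<alpha> u * (y \<bullet> direction u y \<omega>)) + (\<alpha> u * norm (direction u y \<omega>))\<^sup>2"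
        unfolding y'_eq power_mult_distrib power2_norm_eq_inner
        by (simp add: inner_add_left inner_add_right inner_commute power2_eq_square algebra_simps)
      moreover have "\<alpha> u * (y \<bullet> direction u y \<omega> - x \<bullet> direction u x \<omega>) \<le> s * ((L1 * s * p) * (L1 * p) + p * (K * (L1 * s * p)))"
      proof -
        have "y \<bullet> direction u y \<omega> - x \<bullet> direction u x \<omega>
            = (y - x) \<bullet> direction u y \<omega> + x \<bullet> (direction u y \<omega> - direction u x \<omega>)"
          by (simp add: inner_diff_left inner_diff_right)
        also have "\<dots> \<le> norm (y - x) * norm (direction u y \<omega>) + norm x * norm (direction u y \<omega> - direction u x \<omega>)"
          by (intro add_mono norm_cauchy_schwarz)
        also have "\<dots> \<le> (L1 * s * p) * (L1 * p) + p * (K * (L1 * s * p))"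
          using y D DD p s L by (intro add_mono mult_mono) auto
        finally have le: "y \<bullet> direction u y \<omega> - x \<bullet> direction u x \<omega> \<le> (L1 * s * p) * (L1 * p) + p * (K * (L1 * s * p))" .
        have nn: "0 \<le> (L1 * s * p) * (L1 * p) + p * (K * (L1 * s * p))" using L s p K(1) by simp
        show ?thesis
          using mult_left_mono[OF le \<alpha>s(2)] mult_right_mono[OF \<alpha>s(1) nn] by linarith
      qed
      moreover have "(\<alpha> u * norm (direction u y \<omega>))\<^sup>2 \<le> (s * (L1 * p))\<^sup>2"
        using \<alpha>s D s by (intro power_mono mult_mono) auto
      ultimately show ?thesis by (simp add: algebra_simps power2_eq_square)
    qed
    \<comment> \<open>The product of discounted tail and window sum is split into their squares,
      each of which is summable in time.\<close>
    have co: "\<bar>corr v z $ \<sigma> - corr v x $ \<sigma>\<bar> \<le> L2 * (((discounted_tail q \<alpha> v)\<^sup>2 + s\<^sup>2) * p\<^sup>2)"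
      if z: "1 + norm z \<le> G * p" "norm (z - x) \<le> L1 * s * p" for v z \<sigma>
    proof -
      let ?b = "discounted_tail q \<alpha> v"
      have b: "?b \<ge> 0" by (rule discounted_tail_nonneg[OF \<alpha>_nonneg \<alpha>_square_summable q])
      have "norm (noise z - noise x) \<le> H * norm (z - x) * (1 + norm z + norm x)" by (rule H(2))
      also have "\<dots> \<le> H * (L1 * s * p) * ((G + 1) * p)"
        using z p H(1) L s by (intro mult_mono) (auto simp: distrib_right)
      finally have "C * ?b * norm (noise z - noise x) \<le> C * ?b * (H * (L1 * s * p) * ((G + 1) * p))"
        using C_pos b by (intro mult_left_mono) auto
      then have "\<bar>corr v z $ \<sigma> - corr v x $ \<sigma>\<bar> \<le> L2 * ((?b * s) * p\<^sup>2)"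
        using corr_diff_bound[of v z \<sigma> x] by (simp add: L2_def power2_eq_square mult_ac)
      also have "?b * s \<le> ?b\<^sup>2 + s\<^sup>2"
        using zero_le_power2[of "?b - s"] zero_le_power2[of ?b] zero_le_power2[of s]
        unfolding power2_diff by linarith
      then have "L2 * ((?b * s) * p\<^sup>2) \<le> L2 * ((?b\<^sup>2 + s\<^sup>2) * p\<^sup>2)"
        using L(2) by (intro mult_left_mono mult_right_mono) auto
      finally show ?thesis .
    qed
    let ?b = "discounted_tail q \<alpha> u" and ?b' = "discounted_tail q \<alpha> (Suc u)"
    define E where "E = (s\<^sup>2 + ?b\<^sup>2 + ?b'\<^sup>2) * p\<^sup>2"
    have E: "s\<^sup>2 * p\<^sup>2 \<le> E" "(?b\<^sup>2 + s\<^sup>2) * p\<^sup>2 \<le> E" "(?b'\<^sup>2 + s\<^sup>2) * p\<^sup>2 \<le> E"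
      unfolding E_def by (intro mult_right_mono; simp)+
    have "lyap (Suc u) \<omega> - lyap u \<omega> = ((norm y')\<^sup>2 - (norm y)\<^sup>2)
        + 2 * (corr (Suc u) y' $ S (Suc u) \<omega> - corr u y $ S u \<omega>)"
      by (simp add: lyap_def y_def y'_def)
    also have "\<dots> \<le> 2 * (\<alpha> u * (x \<bullet> direction u x \<omega>)) + (3 * L1\<^sup>2 + 2 * K * L1) * E
        + 2 * ((corr (Suc u) x $ S (Suc u) \<omega> + L2 * E) - (corr u x $ S u \<omega> - L2 * E))"
    proof -
      have "(norm y')\<^sup>2 - (norm y)\<^sup>2 \<le> 2 * (\<alpha> u * (x \<bullet> direction u x \<omega>)) + (3 * L1\<^sup>2 + 2 * K * L1) * E"
        by (rule order.trans[OF sq], intro add_left_mono mult_left_mono E(1)) (use L K(1) in simp)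
      moreover have "corr (Suc u) y' $ S (Suc u) \<omega> \<le> corr (Suc u) x $ S (Suc u) \<omega> + L2 * E"
        using co[OF y', of "Suc u" "S (Suc u) \<omega>"] mult_left_mono[OF E(3) L(2)] by linarith
      moreover have "corr u x $ S u \<omega> - L2 * E \<le> corr u y $ S u \<omega>"
        using co[OF y, of u "S u \<omega>"] mult_left_mono[OF E(2) L(2)] by linarith
      moreover have "p - q + 2 * (c - d) \<le> x + k + 2 * ((a + l) - (b - l))"
        if "p - q \<le> x + k" "c \<le> a + l" "b - l \<le> d" for p q x k a b c d l :: real
        using that by simp
      ultimately show ?thesis by blast
    qed
    also have "\<dots> = 2 * (\<alpha> u * (x \<bullet> direction u x \<omega>) + corr (Suc u) x $ S (Suc u) \<omega> - corr u x $ S u \<omega>)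
        + (3 * L1\<^sup>2 + 2 * K * L1 + 4 * L2) * E"
      by (simp add: algebra_simps)
    also have "(3 * L1\<^sup>2 + 2 * K * L1 + 4 * L2) * E
        \<le> L * (s\<^sup>2 + ?b\<^sup>2 + ?b'\<^sup>2) * (1 + (norm x)\<^sup>2)"
    proof -
      have "p\<^sup>2 \<le> 2 * (1 + (norm x)\<^sup>2)"
        using zero_le_power2[of "1 - norm x"] unfolding p_def power2_diff power2_sum by simp
      then have "E \<le> (s\<^sup>2 + ?b\<^sup>2 + ?b'\<^sup>2) * (2 * (1 + (norm x)\<^sup>2))"
        unfolding E_def by (intro mult_left_mono) auto
      then have "(3 * L1\<^sup>2 + 2 * K * L1 + 4 * L2) * E
          \<le> (3 * L1\<^sup>2 + 2 * K * L1 + 4 * L2) * ((s\<^sup>2 + ?b\<^sup>2 + ?b'\<^sup>2) * (2 * (1 + (norm x)\<^sup>2)))"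
        using L K(1) by (intro mult_left_mono) auto
      also have "\<dots> = (2 * (3 * L1\<^sup>2 + 2 * K * L1 + 4 * L2)) * ((s\<^sup>2 + ?b\<^sup>2 + ?b'\<^sup>2) * (1 + (norm x)\<^sup>2))"
        by (simp only: mult.left_commute mult.assoc)
      also have "\<dots> \<le> L * ((s\<^sup>2 + ?b\<^sup>2 + ?b'\<^sup>2) * (1 + (norm x)\<^sup>2))"
        using L by (intro mult_right_mono) (auto simp: L_def)
      finally show ?thesis by (simp add: mult.assoc)
    qed
    finally show ?thesis by simp
  qed
  have "norm (err (t + n) \<omega> - err t \<omega>) \<le> L * (\<Sum>i<Suc n. \<alpha> (t + i)) * (1 + norm (err t \<omega>))" for t \<omega>
  proof -
    have "norm (err (t + n) \<omega> - err t \<omega>) \<le> L1 * (\<Sum>i<Suc n. \<alpha> (t + i)) * (1 + norm (err t \<omega>))"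
      using growth(2)[of n t \<omega>] by (simp del: sum.lessThan_Suc)
    also have "\<dots> \<le> L * (\<Sum>i<Suc n. \<alpha> (t + i)) * (1 + norm (err t \<omega>))"
      using L K(1) by (intro mult_right_mono sum_nonneg \<alpha>_nonneg) (auto simp: L_def add_nonneg_nonneg)
    finally show ?thesis .
  qed
  moreover have "L \<ge> 0" using L K(1) by (simp add: L_def)
  ultimately show ?thesis using main[OF refl refl refl] by blast
qed

theorem err_tendsto_zero: "AE \<omega> in M. (\<lambda>t. err t \<omega>) \<longlonglongrightarrow> 0"
proof -
  let ?\<beta> = "discounted_tail q \<alpha>"
  let ?s = "\<lambda>t. \<Sum>i<Suc n. \<alpha> (t + i)"
  obtain L where L: "L \<ge> 0" and increment: "\<And>t \<omega>. lyap (Suc (t + n)) \<omega> - lyap (t + n) \<omega>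
     \<le> 2 * (\<alpha> (t + n) * (err t \<omega> \<bullet> direction (t + n) (err t \<omega>) \<omega>)
          + corr (Suc (t + n)) (err t \<omega>) $ S (Suc (t + n)) \<omega> - corr (t + n) (err t \<omega>) $ S (t + n) \<omega>)
       + L * ((?s t)\<^sup>2 + (?\<beta> (t + n))\<^sup>2 + (?\<beta> (Suc (t + n)))\<^sup>2) * (1 + (norm (err t \<omega>))\<^sup>2)"
    and drift_bound: "\<And>t \<omega>. norm (err (t + n) \<omega> - err t \<omega>) \<le> L * ?s t * (1 + norm (err t \<omega>))"
    using lyap_increment by blast
  obtain H where H: "H \<ge> 0" "\<And>x y. norm (noise x - noise y) \<le> H * norm (x - y) * (1 + norm x + norm y)"
    using noise_lipschitz by blast
  have \<beta>_nonneg: "?\<beta> t \<ge> 0" for t by (rule discounted_tail_nonneg[OF \<alpha>_nonneg \<alpha>_square_summable q])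
  have \<beta>_sq: "summable (\<lambda>t. (?\<beta> t)\<^sup>2)" by (rule discounted_tail_square_summable[OF \<alpha>_nonneg \<alpha>_square_summable q])
  define \<kappa> where "\<kappa> t = L * ((?s t)\<^sup>2 + (?\<beta> (t + n))\<^sup>2 + (?\<beta> (Suc (t + n)))\<^sup>2)" for t
  have s_nonneg: "?s t \<ge> 0" for t by (intro sum_nonneg \<alpha>_nonneg)
  have int_err: "integrable M (\<lambda>\<omega>. F (err t \<omega>))" for F :: "real^'d \<Rightarrow> real" and t
    by (rule determined_integrable[OF determined_compose[OF determined_err]])
  \<comment> \<open>The errors keep their index while V and the step sizes are shifted by n, since
    the increment from t + n to t + n + 1 is measured against the error at t. The constant is 2 * c
    because the increment contains twice the inner product.\<close>
  interpret L: perturbed_lyapunov M "\<lambda>t \<omega>. norm (err t \<omega>)" "\<lambda>t. lyap (t + n)" "\<lambda>t. \<alpha> (t + n)" \<kappa>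
    "\<lambda>t. L * ?s t" "\<lambda>t. 4 * C * H * ?\<beta> (t + n)" n "2 * c"
  proof
    show "(\<lambda>\<omega>. norm (err t \<omega>)) \<in> borel_measurable M" for t
      using int_err[of norm] by (rule borel_measurable_integrable)
    show "integrable M (\<lambda>\<omega>. (norm (err t \<omega>))\<^sup>2)" for t by (rule int_err)
    show "integrable M (lyap (t + n))" for t by (rule determined_integrable[OF determined_lyap])
    show "2 * c > 0" using c_pos by simp
    show "\<not> summable (\<lambda>t. \<alpha> (t + n))" using \<alpha>_diverges by (simp add: summable_iff_shift)
    show "\<kappa> t \<ge> 0" for t using L by (simp add: \<kappa>_def)
    show "summable \<kappa>" unfolding \<kappa>_def
      using \<beta>_sq summable_iff_shift[of "\<lambda>t. (?\<beta> t)\<^sup>2" n] summable_iff_shift[of "\<lambda>t. (?\<beta> t)\<^sup>2" "Suc n"]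
      by (intro summable_mult summable_add window_square_summable \<alpha>_square_summable) auto
    have "(\<lambda>t. L * ?s t) \<longlonglongrightarrow> L * (\<Sum>i<Suc n. 0)"
      by (intro tendsto_intros LIMSEQ_ignore_initial_segment square_summable_imp_tendsto_zero \<alpha>_square_summable)
    then show "(\<lambda>t. L * ?s t) \<longlonglongrightarrow> 0" by simp
    show "0 \<le> L * ?s t" for t using L s_nonneg by (rule mult_nonneg_nonneg)
    have "(\<lambda>t. 4 * C * H * ?\<beta> (t + n)) \<longlonglongrightarrow> 4 * C * H * 0"
      by (intro tendsto_intros LIMSEQ_ignore_initial_segment square_summable_imp_tendsto_zero \<beta>_sq)
    then show "(\<lambda>t. 4 * C * H * ?\<beta> (t + n)) \<longlonglongrightarrow> 0" by simp
    show "0 \<le> 4 * C * H * ?\<beta> (t + n)" for t using C_pos H \<beta>_nonneg by simp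
    show "\<bar>norm (err (t + n) \<omega>) - norm (err t \<omega>)\<bar> \<le> L * ?s t * (1 + norm (err t \<omega>))" for t \<omega>
      using drift_bound[of t \<omega>] norm_triangle_ineq3[of "err (t + n) \<omega>" "err t \<omega>"] by linarith
    show "\<bar>lyap (t + n) \<omega> - (norm (err (t + n) \<omega>))\<^sup>2\<bar>
        \<le> 4 * C * H * ?\<beta> (t + n) * (1 + (norm (err (t + n) \<omega>))\<^sup>2)" for t \<omega>
    proof -
      \<comment> \<open>Comparison with the error 0, where the noise vanishes, bounds the noise by 2
        * H * (1 + |y|^2); the factor 2 of the corrector in \<open>lyap\<close> then yields the
        4.\<close>
      let ?y = "err (t + n) \<omega>"
      have "norm (noise ?y) \<le> H * (norm ?y * (1 + norm ?y))"
        using H(2)[of ?y 0] by (simp add: noise_zero mult.assoc)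
      also have "\<dots> \<le> H * (2 * (1 + (norm ?y)\<^sup>2))"
      proof (rule mult_left_mono[OF _ H(1)])
        show "norm ?y * (1 + norm ?y) \<le> 2 * (1 + (norm ?y)\<^sup>2)"
        proof -
          have "norm ?y * (1 + norm ?y) = norm ?y + (norm ?y)\<^sup>2"
            by (simp add: power2_eq_square distrib_left)
          moreover have "norm ?y \<le> 1/4 + (norm ?y)\<^sup>2"
            using zero_le_power2[of "1/2 - norm ?y"] unfolding power2_diff by (simp add: power_divide)
          ultimately show ?thesis by simp
        qed
      qed
      finally have noise: "norm (noise ?y) \<le> H * (2 * (1 + (norm ?y)\<^sup>2))" .
      have "\<bar>lyap (t + n) \<omega> - (norm ?y)\<^sup>2\<bar> = 2 * \<bar>corr (t + n) ?y $ S (t + n) \<omega>\<bar>"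
        by (simp add: lyap_def abs_mult)
      also have "\<dots> \<le> 2 * (C * ?\<beta> (t + n) * norm (noise ?y))"
        using corr_diff_bound[of "t + n" ?y "S (t + n) \<omega>" 0] by (simp add: corr_zero noise_zero)
      also have "\<dots> \<le> 2 * (C * ?\<beta> (t + n) * (H * (2 * (1 + (norm ?y)\<^sup>2))))"
        using C_pos \<beta>_nonneg noise by (intro mult_left_mono) auto
      also have "\<dots> = 4 * C * H * ?\<beta> (t + n) * (1 + (norm ?y)\<^sup>2)"
        by (simp add: algebra_simps)
      finally show ?thesis .
    qed
    fix t and I :: "nat set" and \<theta> :: real assume I: "I \<subseteq> {..t}"
    define g where "g \<omega> = (of_bool (\<forall>s\<in>I. norm (err s \<omega>) < \<theta>) :: real)" for \<omega>
    have g01: "0 \<le> g \<omega>" for \<omega> by (simp add: g_def)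
    \<comment> \<open>Errors up to time t are known at time t + n, which is the time at which
      \<open>expected_drift\<close> is applied.\<close>
    have det_g: "determined (t + n) g" unfolding g_def
    proof (rule determined_compose[of _ _ of_bool], rule determined_Ball)
      fix s assume "s \<in> I"
      then have "determined (t + n) (err s)" using I by (intro determined_mono[OF determined_err]) auto
      then show "determined (t + n) (\<lambda>\<omega>. norm (err s \<omega>) < \<theta>)"
        by (rule determined_compose)
    qed
    note drift = expected_drift[OF det_g determined_err[of t]]
    let ?Z = "\<lambda>\<omega>. \<alpha> (t + n) * (err t \<omega> \<bullet> direction (t + n) (err t \<omega>) \<omega>)
          + corr (Suc (t + n)) (err t \<omega>) $ S (Suc (t + n)) \<omega> - corr (t + n) (err t \<omega>) $ S (t + n) \<omega>"
    have int_g: "integrable M (\<lambda>\<omega>. g \<omega> * F (err t \<omega>))" for F :: "real^'d \<Rightarrow> real"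
      by (rule determined_integrable[OF determined_compose2[OF det_g determined_err]])
    have int_gl: "integrable M (\<lambda>\<omega>. g \<omega> * (lyap (Suc t + n) \<omega> - lyap (t + n) \<omega>))"
    proof (rule determined_integrable[of "Suc t + n + n"])
      show "determined (Suc t + n + n) (\<lambda>\<omega>. g \<omega> * (lyap (Suc t + n) \<omega> - lyap (t + n) \<omega>))"
        by (rule determined_compose3[OF determined_mono[OF det_g] determined_lyap
          determined_mono[OF determined_lyap], where F = "\<lambda>x y z. x * (y - z)"]) simp_all
    qed
    have two: "a * (2 * z + x) = 2 * (a * z) + a * x" for a z x :: real by (simp add: distrib_left)
    have "expectation (\<lambda>\<omega>. g \<omega> * (lyap (Suc t + n) \<omega> - lyap (t + n) \<omega>))
        \<le> expectation (\<lambda>\<omega>. 2 * (g \<omega> * ?Z \<omega>) + g \<omega> * (\<kappa> t * (1 + (norm (err t \<omega>))\<^sup>2)))"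
    proof (intro integral_mono int_gl Bochner_Integration.integrable_add integrable_mult_right drift(1) int_g)
      fix \<omega>
      have "g \<omega> * (lyap (Suc t + n) \<omega> - lyap (t + n) \<omega>) \<le> g \<omega> * (2 * ?Z \<omega> + \<kappa> t * (1 + (norm (err t \<omega>))\<^sup>2))"
        using increment[of t \<omega>] g01 by (intro mult_left_mono) (auto simp: \<kappa>_def)
      then show "g \<omega> * (lyap (Suc t + n) \<omega> - lyap (t + n) \<omega>)
          \<le> 2 * (g \<omega> * ?Z \<omega>) + g \<omega> * (\<kappa> t * (1 + (norm (err t \<omega>))\<^sup>2))"
        unfolding two .
    qed
    also have "\<dots> = 2 * expectation (\<lambda>\<omega>. g \<omega> * ?Z \<omega>) + expectation (\<lambda>\<omega>. g \<omega> * (\<kappa> t * (1 + (norm (err t \<omega>))\<^sup>2)))"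
      by (subst Bochner_Integration.integral_add)
        (simp_all add: drift(1) int_g[of "\<lambda>x. \<kappa> t * (1 + (norm x)\<^sup>2)"])
    also have "expectation (\<lambda>\<omega>. g \<omega> * ?Z \<omega>)
        = expectation (\<lambda>\<omega>. g \<omega> * (- \<alpha> (t + n) * (err t \<omega> \<bullet> (\<A> *v err t \<omega>))))"
      by (rule drift(2))
    also have "\<dots> \<le> expectation (\<lambda>\<omega>. g \<omega> * (- \<alpha> (t + n) * (c * (norm (err t \<omega>))\<^sup>2)))"
    proof (intro integral_mono int_g[of "\<lambda>x. - \<alpha> (t + n) * (x \<bullet> (\<A> *v x))"] int_g[of "\<lambda>x. - \<alpha> (t + n) * (c * (norm x)\<^sup>2)"])
      fix \<omega>
      show "g \<omega> * (- \<alpha> (t + n) * (err t \<omega> \<bullet> (\<A> *v err t \<omega>)))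
          \<le> g \<omega> * (- \<alpha> (t + n) * (c * (norm (err t \<omega>))\<^sup>2))"
        using g01 \<alpha>_nonneg definite by (intro mult_left_mono mult_left_mono_neg) auto
    qed
    also have "2 * expectation (\<lambda>\<omega>. g \<omega> * (- \<alpha> (t + n) * (c * (norm (err t \<omega>))\<^sup>2)))
        + expectation (\<lambda>\<omega>. g \<omega> * (\<kappa> t * (1 + (norm (err t \<omega>))\<^sup>2)))
      = expectation (\<lambda>\<omega>. 2 * (g \<omega> * (- \<alpha> (t + n) * (c * (norm (err t \<omega>))\<^sup>2)))
        + g \<omega> * (\<kappa> t * (1 + (norm (err t \<omega>))\<^sup>2)))"
      by (subst Bochner_Integration.integral_add) (auto intro!: integrable_mult_right int_g simp del: mult_minus_left mult_minus_right)
    also have "\<dots> = expectation (\<lambda>\<omega>. g \<omega> * (\<kappa> t * (1 + (norm (err t \<omega>))\<^sup>2)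
        - 2 * c * \<alpha> (t + n) * (norm (err t \<omega>))\<^sup>2))"
      by (intro Bochner_Integration.integral_cong) (auto simp: algebra_simps)
    finally show "expectation (\<lambda>\<omega>. of_bool (\<forall>s\<in>I. norm (err s \<omega>) < \<theta>) * (lyap (Suc t + n) \<omega> - lyap (t + n) \<omega>))
        \<le> expectation (\<lambda>\<omega>. of_bool (\<forall>s\<in>I. norm (err s \<omega>) < \<theta>) * (\<kappa> t * (1 + (norm (err t \<omega>))\<^sup>2)
          - 2 * c * \<alpha> (t + n) * (norm (err t \<omega>))\<^sup>2))"
      by (simp add: g_def)
  qed (simp_all add: \<alpha>_nonneg)
  show ?thesis using L.x_tendsto_zero by (simp add: tendsto_norm_zero_iff)
qed

end

text \<open>Invertibility is part of the conclusion because \<open>matrix_inv\<close> denotes an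
  inverse only for invertible matrices. Full column rank is what makes it possible: a kernel vector
  of the feature matrix would be a kernel vector of A.\<close>

theorem theorem1:
  fixes P :: "'s::finite \<Rightarrow> 'a::finite \<Rightarrow> 's pmf"
    and r :: "'s \<Rightarrow> 'a \<Rightarrow> real"
    and \<gamma> :: "'s \<Rightarrow> real"
    and \<pi> \<mu> :: "'s \<Rightarrow> 'a pmf"
    and n :: nat
    and \<phi> :: "'s \<Rightarrow> real ^ 'd"
    and d\<^sub>\<mu> :: "'s pmf"
    and M :: "'w measure"
    and S :: "nat \<Rightarrow> 'w \<Rightarrow> 's"
    and A :: "nat \<Rightarrow> 'w \<Rightarrow> 'a"
    and \<alpha> :: "nat \<Rightarrow> real"
  assumes discount: "\<And>s. 0 \<le> \<gamma> s \<and> \<gamma> s \<le> 1"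
    and n_pos: "n \<ge> 1"
    and ergodic: "ergodic_chain (trans_mat P \<mu>)"
    and stationary: "stationary_distribution d\<^sub>\<mu> (trans_mat P \<mu>)"
    and coverage: "\<And>s a. pmf (\<pi> s) a > 0 \<Longrightarrow> pmf (\<mu> s) a > 0"
    and features: "rank (feature_mat \<phi>) = CARD('d)"
    and trajectory: "mdp_trajectory P \<mu> M S A"
    and followon_limit: "\<And>s. convergent (\<lambda>t. expected_followon n \<gamma> \<pi> \<mu> M S A t s)"
    and rates: "\<And>t. \<alpha> t \<ge> 0" "\<not> summable \<alpha>" "summable (\<lambda>t. (\<alpha> t)\<^sup>2)"
  shows "\<exists>\<eta>>0. \<forall>f w0.
           mat_norm (D_theta d\<^sub>\<mu> f - D_followon d\<^sub>\<mu> n \<gamma> \<pi> \<mu> M S A) < \<eta> \<longrightarrow>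
           invertible (xetd_A P \<gamma> \<pi> n \<phi> d\<^sub>\<mu> f) \<and>
           (AE \<omega> in M. (\<lambda>t. xetd r \<gamma> \<pi> \<mu> n \<phi> S A \<alpha> f w0 t \<omega>)
              \<longlonglongrightarrow> matrix_inv (xetd_A P \<gamma> \<pi> n \<phi> d\<^sub>\<mu> f) *v xetd_b P r \<gamma> \<pi> n \<phi> d\<^sub>\<mu> f)"
proof -
  interpret off_policy P \<mu> M S A \<pi> \<gamma>
    using trajectory coverage by unfold_locales
  obtain \<eta> c where "\<eta> > 0" and c: "c > 0" and definite: "\<And>f e.
      mat_norm (D_theta d\<^sub>\<mu> f - D_followon d\<^sub>\<mu> n \<gamma> \<pi> \<mu> M S A) < \<eta> \<Longrightarrow>
      c * (norm e)\<^sup>2 \<le> e \<bullet> (xetd_A P \<gamma> \<pi> n \<phi> d\<^sub>\<mu> f *v e)"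
    using key_matrix_positive_definite[OF n_pos discount ergodic stationary followon_limit features]
    by blast
  obtain C q where mixing: "C > 0" "0 < q" "q < 1" "\<And>h k s. (\<Sum>s\<in>UNIV. pmf d\<^sub>\<mu> s * h $ s) = 0 \<Longrightarrow>
      \<bar>(mat_pow (trans_mat P \<mu>) k *v h) $ s\<bar> \<le> C * q ^ k * norm h"
    using geometric_mixing[OF stochastic_trans_mat ergodic stationary] by blast
  have "invertible (xetd_A P \<gamma> \<pi> n \<phi> d\<^sub>\<mu> f) \<and>
      (AE \<omega> in M. (\<lambda>t. xetd r \<gamma> \<pi> \<mu> n \<phi> S A \<alpha> f w0 t \<omega>)
         \<longlonglongrightarrow> matrix_inv (xetd_A P \<gamma> \<pi> n \<phi> d\<^sub>\<mu> f) *v xetd_b P r \<gamma> \<pi> n \<phi> d\<^sub>\<mu> f)"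
    if small: "mat_norm (D_theta d\<^sub>\<mu> f - D_followon d\<^sub>\<mu> n \<gamma> \<pi> \<mu> M S A) < \<eta>" for f w0
  proof
    let ?A = "xetd_A P \<gamma> \<pi> n \<phi> d\<^sub>\<mu> f" and ?b = "xetd_b P r \<gamma> \<pi> n \<phi> d\<^sub>\<mu> f"
    have "inj ((*v) ?A)"
    proof (rule injI)
      fix x y assume "?A *v x = ?A *v y"
      then have "c * (norm (x - y))\<^sup>2 \<le> 0"
        using definite[OF small, of "x - y"] by (simp add: matrix_vector_mult_diff_distrib)
      then show "x = y" using c by (simp add: mult_le_0_iff)
    qed
    then show inv: "invertible ?A"
      by (simp add: invertible_left_inverse matrix_left_invertible_injective)
    then have "?A ** matrix_inv ?A = mat 1"
      unfolding invertible_def matrix_inv_def by (rule someI2_ex) blast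
    then have sol: "?A *v (matrix_inv ?A *v ?b) = ?b"
      by (simp add: matrix_vector_mul_assoc)
    interpret xetd_iteration P \<mu> M S A \<pi> \<gamma> r n \<phi> d\<^sub>\<mu> \<alpha> f w0 "matrix_inv ?A *v ?b" c C q
      using discount rates c definite[OF small] sol mixing by unfold_locales
    show "AE \<omega> in M. (\<lambda>t. xetd r \<gamma> \<pi> \<mu> n \<phi> S A \<alpha> f w0 t \<omega>) \<longlonglongrightarrow> matrix_inv ?A *v ?b"
      using err_tendsto_zero by (simp add: err_def LIM_zero_iff)
  qed
  then show ?thesis using \<open>\<eta> > 0\<close> by blast
qed

end
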